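(* Let $X$ be an oriented closed connected 3-manifold, $\alpha:\pi_1(X)\to\mathbb{Z}$ an epimorphism, and $\Sigma_\alpha\in H_2(X;\mathbb{Z})$ the homology 2-class dual to $\alpha$ under Poincaré duality $H_2(X;\mathbb{Z})\cong H^1(X;\mathbb{Z})\cong\mathrm{Hom}(\pi_1(X),\mathbb{Z})$. Let $\mathbb{F}$ be a commutative field with involution $\bar{\ }$ (possibly the identity), $\rho:\pi_1(X)\to\mathrm{GL}_n(\mathbb{F})$ a representation and $\psi:\mathbb{F}^n\times\mathbb{F}^n\to\mathbb{F}$ a non-degenerate (anti-)hermitian $\rho$-invariant bilinear form. Suppose that the triple $(\rho,\psi,\Sigma_\alpha)$ is admissible and that the zeroth homology $H_0^\rho(X;\mathbb{F}^n)$ vanishes. By the non-degeneracy, one chooses a normalized orthonormal basis $\mathbf{h}_1$ of $H^1_\rho(X;\mathbb{F}^n)$ with respect to the pairing $$H^1_\rho(X;\mathbb{F}^n)\times H^1_\rho(X;\mathbb{F}^n)\to\mathbb{F},\qquad (x,y)\mapsto\psi_*\big((x\smile y)\cap\Sigma_\alpha\big),$$ and the dual basis $\mathbf{h}_1^{\rm dual}$ of $H^2_\rho(X;\mathbb{F}^n)$. Then the refined torsion $$\tau^0_\rho(X,\{\mathbf{h}_1,\mathbf{h}_1^{\rm dual}\})\in\mathbb{F}^\times/\pm\det(\rho(\pi_1(X)))$$ modulo $\pm\det(\rho(\pi_1(X)))$ is independent of the choice of the basis $\mathbf{h}_1$.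
   Context: Forms: $\psi$ is hermitian or anti-hermitian with respect to the involution, and $\rho$-invariant means $\psi(\rho(g)v,\rho(g)w)=\psi(v,w)$ for all $g\in\pi_1(X)$, $v,w\in\mathbb{F}^n$. $\psi_*$ is the map induced by $\psi$ on coefficients. Admissible: $(\rho,\psi,\Sigma_\alpha)$ is admissible if the pairing $(x,y)\mapsto\psi_*((x\smile y)\cap\Sigma_\alpha)$ on $H^1_\rho(X;\mathbb{F}^n)\times H^1_\rho(X;\mathbb{F}^n)$ and the pairings $(x,y)\mapsto\psi_*((x\smile y)\cap[X])$ on $H^i_\rho(X;\mathbb{F}^n)\times H^{3-i}_\rho(X;\mathbb{F}^n)$ are non-degenerate, where $[X]$ is the fundamental class. The dual basis $\mathbf{h}_1^{\rm dual}$ is taken with respect to the latter pairing for $i=1$. Orthonormal bases: any two normalized orthonormal bases of $H^1_\rho(X;\mathbb{F}^n)$ are understood to be related by an element $T$ of the unitary group $U(\dim H^1_\rho(X;\mathbb{F}^n);\mathbb{F})$, so that $\det(T)\overline{\det(T)}=1$. Torsion: for bases $\mathbf{b},\mathbf{c}$ of a finite-dimensional space, $[\mathbf{b}/\mathbf{c}]$ is the determinant of the matrix $P$ with $b_i=\sum_jP_{(j,i)}c_j$. For a cochain complex $C^*$ of finite-dimensional $\mathbb{F}$-spaces in degrees $0,\dots,k$ with coboundaries $\delta^i$, bases $\mathbf{c}_i$ of $C^i$ and $\mathbf{h}_i$ of $H^i$, choose bases $\mathbf{b}_i$ of $\mathrm{Im}(\delta^{i-1})$, lifts $\widetilde{\mathbf{b}}_{i+1}\subset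 C^i$ of $\mathbf{b}_{i+1}$ along $\delta^i$, and lifts $\widetilde{\mathbf{h}}_i$ of $\mathbf{h}_i$ to cocycles; then $\tau(C^*,\mathbf{c},\mathbf{h})=\prod_{i=0}^k[(\mathbf{b}_i\cup\widetilde{\mathbf{h}}_i\cup\widetilde{\mathbf{b}}_{i+1})/\mathbf{c}_i]^{(-1)^{i+1}}$. For a finite CW structure on $X$ with universal cover $\widetilde X$, $C^*_\rho(X;\mathbb{F}^n)=\mathrm{Hom}_{\mathbb{Z}[\pi_1(X)]}(C_*(\widetilde X;\mathbb{Z}),\mathbb{F}^n)$ with basis $\mathbf{c}_X$ dual to (lifted oriented cells)$\otimes$(standard basis of $\mathbb{F}^n$); $H^*_\rho$ is its cohomology, and $H^\rho_*$ is the homology of $C_*(\widetilde X;\mathbb{Z})\otimes_{\mathbb{Z}[\pi_1(X)]}\mathbb{F}^n$. Up to sign, the refined torsion $\tau^0_\rho(X,\mathbf{h})$ is $\tau(C^*_\rho(X;\mathbb{F}^n),\mathbf{c}_X,\mathbf{h})$. Since $H_0^\rho(X;\mathbb{F}^n)=0$, also $H^0_\rho=H^3_\rho=0$, so $\mathbf{h}$ consists of bases in degrees 1 and 2 only. $\pm\det(\rho(\pi_1(X)))=\{\varepsilon\det\rho(g)\mid g\in\pi_1(X),\ \varepsilon\in\{\pm1\}\}$. *)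

theory Defs
  imports
    "HOL-Homology.Homology"
    "HOL-Library.Function_Algebras"
    "Jordan_Normal_Form.Determinant"
    "HOL-Analysis.Analysis"
begin

section \<open>Linear algebra and torsion of based cochain complexes\<close>

text \<open>
  Subspaces, their bases (lists) and quotient spaces inside an ambient additive group
  \<open>'v\<close> on which the field acts by \<open>s\<close>. \<open>basis_mod s V B vs\<close> says that the images of \<open>vs\<close>
  form a basis of \<open>V / B\<close>; for \<open>B = {0}\<close> this is a basis of \<open>V\<close>.
\<close>

definition lincomb :: "('f::field \<Rightarrow> 'v \<Rightarrow> 'v::ab_group_add) \<Rightarrow> (nat \<Rightarrow> 'f) \<Rightarrow> 'v list \<Rightarrow> 'v" where
  "lincomb s a vs = (\<Sum>i<length vs. s (a i) (vs ! i))"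

definition basis_mod ::
  "('f::field \<Rightarrow> 'v \<Rightarrow> 'v::ab_group_add) \<Rightarrow> 'v set \<Rightarrow> 'v set \<Rightarrow> 'v list \<Rightarrow> bool" where
  "basis_mod s V B vs \<longleftrightarrow>
     set vs \<subseteq> V \<and>
     (\<forall>v\<in>V. \<exists>!a. (\<forall>i\<ge>length vs. a i = 0) \<and> v - lincomb s a vs \<in> B)"

definition coset_mod :: "'v::ab_group_add set \<Rightarrow> 'v \<Rightarrow> 'v set" where
  "coset_mod B v = (\<lambda>b. v + b) ` B"

definition quotient_basis ::
  "('f::field \<Rightarrow> 'v \<Rightarrow> 'v::ab_group_add) \<Rightarrow> 'v set \<Rightarrow> 'v set \<Rightarrow> 'v set list \<Rightarrow> bool" where
  "quotient_basis s V B hs \<longleftrightarrow> (\<exists>vs. hs = map (coset_mod B) vs \<and> basis_mod s V B vs)"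

definition base_change_det ::
  "('f::field \<Rightarrow> 'v \<Rightarrow> 'v::ab_group_add) \<Rightarrow> 'v list \<Rightarrow> 'v list \<Rightarrow> 'f" where
  "base_change_det s b c =
     (THE d. \<exists>P \<in> carrier_mat (length c) (length b).
        (\<forall>i<length b. b ! i = lincomb s (\<lambda>j. P $$ (j, i)) c) \<and> d = Determinant.det P)"

text \<open>
  Cochain complexes are given by subspaces \<open>C i\<close> of \<open>'v\<close> and coboundaries \<open>\<delta> i\<close> from \<open>C i\<close>
  to \<open>C (Suc i)\<close>.
\<close>

definition coc :: "(nat \<Rightarrow> 'v::ab_group_add set) \<Rightarrow> (nat \<Rightarrow> 'v \<Rightarrow> 'v) \<Rightarrow> nat \<Rightarrow> 'v set" where
  "coc C \<delta> i = {f \<in> C i. \<delta> i f = 0}"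

definition cob :: "(nat \<Rightarrow> 'v::ab_group_add set) \<Rightarrow> (nat \<Rightarrow> 'v \<Rightarrow> 'v) \<Rightarrow> nat \<Rightarrow> 'v set" where
  "cob C \<delta> i = (case i of 0 \<Rightarrow> {0} | Suc j \<Rightarrow> \<delta> j ` C j)"

definition cohom :: "(nat \<Rightarrow> 'v::ab_group_add set) \<Rightarrow> (nat \<Rightarrow> 'v \<Rightarrow> 'v) \<Rightarrow> nat \<Rightarrow> 'v set set" where
  "cohom C \<delta> i = coset_mod (cob C \<delta> i) ` coc C \<delta> i"

definition cohom_basis ::
  "('f::field \<Rightarrow> 'v \<Rightarrow> 'v::ab_group_add) \<Rightarrow> (nat \<Rightarrow> 'v set) \<Rightarrow> (nat \<Rightarrow> 'v \<Rightarrow> 'v) \<Rightarrow> nat \<Rightarrow>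
   'v set list \<Rightarrow> bool" where
  "cohom_basis s C \<delta> i = quotient_basis s (coc C \<delta> i) (cob C \<delta> i)"

text \<open>
  \<open>b i\<close> is a basis of the image of \<open>\<delta> (i - 1)\<close> and \<open>l i\<close> is a lift of \<open>b (Suc i)\<close> to \<open>C i\<close>.
  A cohomology class is the set of the cocycles representing it, so the lift \<open>z i\<close> of \<open>h i\<close>
  consists of elements of the classes in \<open>h i\<close>.
\<close>

definition is_torsion ::
  "('f::field \<Rightarrow> 'v \<Rightarrow> 'v::ab_group_add) \<Rightarrow> nat \<Rightarrow> (nat \<Rightarrow> 'v set) \<Rightarrow> (nat \<Rightarrow> 'v \<Rightarrow> 'v) \<Rightarrow>
   (nat \<Rightarrow> 'v list) \<Rightarrow> (nat \<Rightarrow> 'v set list) \<Rightarrow> 'f \<Rightarrow> bool" where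
  "is_torsion s k C \<delta> c h t \<longleftrightarrow>
     (\<forall>i\<le>k. basis_mod s (C i) {0} (c i)) \<and>
     (\<forall>i\<le>k. cohom_basis s C \<delta> i (h i)) \<and>
     (\<exists>b z l.
        (\<forall>i\<le>Suc k. basis_mod s (cob C \<delta> i) {0} (b i)) \<and>
        (\<forall>i\<le>k. list_all2 (\<in>) (z i) (h i)) \<and>
        (\<forall>i\<le>k. set (l i) \<subseteq> C i \<and> map (\<delta> i) (l i) = b (Suc i)) \<and>
        t = (\<Prod>i\<le>k. base_change_det s (b i @ z i @ l i) (c i) powi ((-1) ^ (i + 1))))"

definition torsion ::
  "('f::field \<Rightarrow> 'v \<Rightarrow> 'v::ab_group_add) \<Rightarrow> nat \<Rightarrow> (nat \<Rightarrow> 'v set) \<Rightarrow> (nat \<Rightarrow> 'v \<Rightarrow> 'v) \<Rightarrow>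
   (nat \<Rightarrow> 'v list) \<Rightarrow> (nat \<Rightarrow> 'v set list) \<Rightarrow> 'f" where
  "torsion s k C \<delta> c h = (THE t. is_torsion s k C \<delta> c h t)"

definition nondegenerate_pairing ::
  "'x \<Rightarrow> 'x set \<Rightarrow> 'y \<Rightarrow> 'y set \<Rightarrow> ('x \<Rightarrow> 'y \<Rightarrow> 'f::zero) \<Rightarrow> bool" where
  "nondegenerate_pairing zx A zy B P \<longleftrightarrow>
     (\<forall>x\<in>A. (\<forall>y\<in>B. P x y = 0) \<longrightarrow> x = zx) \<and> (\<forall>y\<in>B. (\<forall>x\<in>A. P x y = 0) \<longrightarrow> y = zy)"


section \<open>The coefficient field and the form\<close>

definition field_involution :: "('f::field \<Rightarrow> 'f) \<Rightarrow> bool" where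
  "field_involution bar \<longleftrightarrow>
     (\<forall>x y. bar (x + y) = bar x + bar y) \<and> (\<forall>x y. bar (x * y) = bar x * bar y) \<and>
     (\<forall>x. bar (bar x) = x)"

text \<open>
  Forms are linear in the first and \<open>bar\<close>-linear in the second variable; they are bilinear if
  \<open>bar\<close> is the identity.
\<close>

definition hermitian_or_antihermitian ::
  "('f::field \<Rightarrow> 'f) \<Rightarrow> ('f^'n \<Rightarrow> 'f^'n \<Rightarrow> 'f) \<Rightarrow> bool" where
  "hermitian_or_antihermitian bar \<psi> \<longleftrightarrow>
     (\<forall>u v w. \<psi> (u + v) w = \<psi> u w + \<psi> v w) \<and> (\<forall>a v w. \<psi> (a *s v) w = a * \<psi> v w) \<and>
     (\<forall>u v w. \<psi> u (v + w) = \<psi> u v + \<psi> u w) \<and> (\<forall>a v w. \<psi> v (a *s w) = bar a * \<psi> v w) \<and>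
     ((\<forall>v w. \<psi> w v = bar (\<psi> v w)) \<or> (\<forall>v w. \<psi> w v = - bar (\<psi> v w)))"

definition general_linear_group :: "('f::field^'n^'n) monoid" where
  "general_linear_group =
     \<lparr>carrier = {A. invertible A}, monoid.mult = (**), one = Finite_Cartesian_Product.mat 1\<rparr>"

definition mult_group_field :: "'f::field monoid" where
  "mult_group_field = \<lparr>carrier = UNIV - {0}, monoid.mult = (*), one = 1\<rparr>"


section \<open>Fundamental group and universal covering\<close>

definition homotopy_class :: "'a::topological_space set \<Rightarrow> (real \<Rightarrow> 'a) \<Rightarrow> (real \<Rightarrow> 'a) set" where
  "homotopy_class M \<gamma> = {\<delta>. homotopic_paths M \<gamma> \<delta>}"

definition loops_at :: "'a::topological_space set \<Rightarrow> 'a \<Rightarrow> (real \<Rightarrow> 'a) set" where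
  "loops_at M x0 = {\<gamma>. path \<gamma> \<and> path_image \<gamma> \<subseteq> M \<and> pathstart \<gamma> = x0 \<and> pathfinish \<gamma> = x0}"

definition fundamental_group ::
  "'a::topological_space set \<Rightarrow> 'a \<Rightarrow> (real \<Rightarrow> 'a) set monoid" where
  "fundamental_group M x0 =
     \<lparr>carrier = homotopy_class M ` loops_at M x0,
      monoid.mult = (\<lambda>A B. \<Union>\<gamma>\<in>A. \<Union>\<delta>\<in>B. homotopy_class M (\<gamma> +++ \<delta>)),
      one = homotopy_class M (\<lambda>_. x0)\<rparr>"

text \<open>
  \<open>act g\<close> is the deck transformation belonging to the element \<open>g\<close> of the fundamental group:
  it moves the base point \<open>e0\<close> to the end point of the lift, starting at \<open>e0\<close>, of a loop in \<open>g\<close>.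
  On a simply connected covering these conditions determine \<open>act\<close>, and they make it a left action.
\<close>

definition universal_covering ::
  "'a::topological_space set \<Rightarrow> 'a \<Rightarrow> 'b::topological_space set \<Rightarrow> ('b \<Rightarrow> 'a) \<Rightarrow> 'b \<Rightarrow>
   ((real \<Rightarrow> 'a) set \<Rightarrow> 'b \<Rightarrow> 'b) \<Rightarrow> bool" where
  "universal_covering M x0 E p e0 act \<longleftrightarrow>
     covering_space E p M \<and> simply_connected E \<and> e0 \<in> E \<and> p e0 = x0 \<and>
     (\<forall>g \<in> carrier (fundamental_group M x0).
        (\<exists>k. homeomorphism E E (act g) k) \<and>
        (\<forall>e\<in>E. p (act g e) = p e) \<and>
        (\<forall>\<gamma>. path \<gamma> \<and> path_image \<gamma> \<subseteq> E \<and> pathstart \<gamma> = e0 \<and> p \<circ> \<gamma> \<in> g \<longrightarrow>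
             act g e0 = pathfinish \<gamma>))"


section \<open>Oriented closed 3-manifolds and Poincare duality\<close>

definition closed_connected_3_manifold :: "'a::topological_space set \<Rightarrow> bool" where
  "closed_connected_3_manifold M \<longleftrightarrow>
     compact M \<and> connected M \<and> M \<noteq> {} \<and> Hausdorff_space (top_of_set M) \<and>
     (\<forall>x\<in>M. \<exists>U (V::(real^3) set). openin (top_of_set M) U \<and> x \<in> U \<and> open V \<and> U homeomorphic V)"

definition fundamental_class :: "'a::topological_space set \<Rightarrow> 'a chain set \<Rightarrow> bool" where
  "fundamental_class M c \<longleftrightarrow>
     c \<in> carrier (homology_group 3 (top_of_set M)) \<and>
     (\<forall>x\<in>M. generate (relative_homology_group 3 (top_of_set M) (M - {x}))
               {hom_induced 3 (top_of_set M) {} (top_of_set M) (M - {x}) id c}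
             = carrier (relative_homology_group 3 (top_of_set M) (M - {x})))"

definition front_face :: "nat \<Rightarrow> ((nat \<Rightarrow> real) \<Rightarrow> 'a) \<Rightarrow> (nat \<Rightarrow> real) \<Rightarrow> 'a" where
  "front_face i \<sigma> = restrict \<sigma> (standard_simplex i)"

definition back_face :: "nat \<Rightarrow> nat \<Rightarrow> ((nat \<Rightarrow> real) \<Rightarrow> 'a) \<Rightarrow> (nat \<Rightarrow> real) \<Rightarrow> 'a" where
  "back_face i j \<sigma> = restrict (\<lambda>x. \<sigma> (\<lambda>l. if l < i then 0 else x (l - i))) (standard_simplex j)"

text \<open>
  The cap product of a singular \<open>(i + j)\<close>-chain with an integral singular \<open>i\<close>-cochain is
  given by \<open>\<sigma> \<frown> a = a (front face) \<cdot> back face\<close>.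
\<close>

definition cap_product :: "nat \<Rightarrow> nat \<Rightarrow> 'a chain \<Rightarrow> ('a chain \<Rightarrow> int) \<Rightarrow> 'a chain" where
  "cap_product i j z a =
     frag_extend (\<lambda>\<sigma>. frag_cmul (a (frag_of (front_face i \<sigma>))) (frag_of (back_face i j \<sigma>))) z"

definition loop_simplex :: "(real \<Rightarrow> 'a) \<Rightarrow> (nat \<Rightarrow> real) \<Rightarrow> 'a" where
  "loop_simplex \<gamma> = restrict (\<lambda>x. \<gamma> (x 1)) (standard_simplex 1)"

text \<open>
  \<open>S\<close> is the cap product of \<open>c = [X]\<close> with the class in \<open>H\<^sup>1(X; \<int>)\<close> of a cocycle \<open>a\<close> whose
  value on each loop is given by \<open>\<alpha>\<close>.
\<close>

definition poincare_dual_of_hom ::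
  "'a::topological_space set \<Rightarrow> 'a \<Rightarrow> 'a chain set \<Rightarrow> ((real \<Rightarrow> 'a) set \<Rightarrow> int) \<Rightarrow>
   'a chain set \<Rightarrow> bool" where
  "poincare_dual_of_hom M x0 c \<alpha> S \<longleftrightarrow>
     S \<in> carrier (homology_group 2 (top_of_set M)) \<and>
     (\<exists>a \<in> hom (chain_group 1 (top_of_set M)) integer_group.
        (\<forall>d. singular_chain 2 (top_of_set M) d \<longrightarrow> a (chain_boundary 2 d) = 0) \<and>
        (\<forall>\<gamma>\<in>loops_at M x0. a (frag_of (loop_simplex \<gamma>)) = \<alpha> (homotopy_class M \<gamma>)) \<and>
        (\<exists>z\<in>c. cap_product 1 2 z a \<in> S))"


section \<open>Twisted cochains and homology\<close>

text \<open>
  A complex of abelian groups with an action of (the elements \<open>'g\<close> of) a group;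
  \<open>bd k\<close> is the boundary from degree \<open>Suc k\<close> to degree \<open>k\<close>.
\<close>

record ('g, 'c) eqv_complex =
  grp :: "nat \<Rightarrow> 'c monoid"
  bd :: "nat \<Rightarrow> 'c \<Rightarrow> 'c"
  actn :: "nat \<Rightarrow> 'g \<Rightarrow> 'c \<Rightarrow> 'c"

text \<open>
  \<open>cochains K \<pi> \<rho> k\<close> is \<open>Hom\<^bsub>\<int>[\<pi>]\<^esub>(K\<^sub>k, F\<^sup>n)\<close>. Maps are set to \<open>0\<close> outside the carrier,
  so that these sets are subspaces of the space of all functions \<open>'c \<Rightarrow> F\<^sup>n\<close>.
\<close>

definition cochains ::
  "('g, 'c) eqv_complex \<Rightarrow> 'g monoid \<Rightarrow> ('g \<Rightarrow> 'f::field^'n^'n) \<Rightarrow> nat \<Rightarrow> ('c \<Rightarrow> 'f^'n) set" where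
  "cochains K \<pi> \<rho> k =
     {f. (\<forall>x\<in>carrier (grp K k). \<forall>y\<in>carrier (grp K k). f (x \<otimes>\<^bsub>grp K k\<^esub> y) = f x + f y) \<and>
         (\<forall>g\<in>carrier \<pi>. \<forall>x\<in>carrier (grp K k). f (actn K k g x) = \<rho> g *v f x) \<and>
         (\<forall>x. x \<notin> carrier (grp K k) \<longrightarrow> f x = 0)}"

definition coboundary ::
  "('g, 'c) eqv_complex \<Rightarrow> nat \<Rightarrow> ('c \<Rightarrow> 'f::field^'n) \<Rightarrow> 'c \<Rightarrow> 'f^'n" where
  "coboundary K k f = (\<lambda>x. if x \<in> carrier (grp K (Suc k)) then f (bd K k x) else 0)"

definition fscale :: "'f::field \<Rightarrow> ('c \<Rightarrow> 'f^'n) \<Rightarrow> 'c \<Rightarrow> 'f^'n" where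
  "fscale a f = (\<lambda>x. a *s f x)"

abbreviation twisted_coboundaries where
  "twisted_coboundaries K \<pi> \<rho> \<equiv> cob (cochains K \<pi> \<rho>) (coboundary K)"

abbreviation twisted_cohomology where
  "twisted_cohomology K \<pi> \<rho> \<equiv> cohom (cochains K \<pi> \<rho>) (coboundary K)"

abbreviation twisted_cohomology_basis where
  "twisted_cohomology_basis K \<pi> \<rho> \<equiv> cohom_basis fscale (cochains K \<pi> \<rho>) (coboundary K)"

definition singular_complex ::
  "'b::topological_space set \<Rightarrow> ('g \<Rightarrow> 'b \<Rightarrow> 'b) \<Rightarrow> ('g, 'b chain) eqv_complex" where
  "singular_complex E act =
     \<lparr>grp = (\<lambda>k. chain_group k (top_of_set E)),
      bd = (\<lambda>k. chain_boundary (Suc k)),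
      actn = (\<lambda>k g. chain_map k (act g))\<rparr>"

text \<open>
  Twisted homology: the group \<open>S\<^sub>k(E) \<otimes>\<^bsub>\<int>[\<pi>]\<^esub> F\<^sup>n\<close> is the quotient of
  \<open>S\<^sub>k(E) \<otimes>\<^bsub>\<int>\<^esub> F\<^sup>n\<close>, i.e. of the finitely supported functions from singular simplices to \<open>F\<^sup>n\<close>,
  by the subgroup generated by all \<open>g \<sigma> \<otimes> \<rho>(g) v - \<sigma> \<otimes> v\<close> (the right action on simplices
  being \<open>\<sigma> g = g\<^sup>-\<^sup>1 \<sigma>\<close>). Cycles and boundaries of the quotient complex are described
  by their preimages.
\<close>

inductive_set additive_span :: "'v::ab_group_add set \<Rightarrow> 'v set" for S where
  zero: "0 \<in> additive_span S"
| add: "x \<in> additive_span S \<Longrightarrow> y \<in> S \<Longrightarrow> x + y \<in> additive_span S"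
| diff: "x \<in> additive_span S \<Longrightarrow> y \<in> S \<Longrightarrow> x - y \<in> additive_span S"

definition tensor_chains ::
  "'b::topological_space set \<Rightarrow> nat \<Rightarrow> (((nat \<Rightarrow> real) \<Rightarrow> 'b) \<Rightarrow>\<^sub>0 'f::field^'n) set" where
  "tensor_chains E k = {c. Poly_Mapping.keys c \<subseteq> singular_simplex_set k (top_of_set E)}"

definition tensor_relations ::
  "'b::topological_space set \<Rightarrow> ('g \<Rightarrow> 'b \<Rightarrow> 'b) \<Rightarrow> 'g monoid \<Rightarrow> ('g \<Rightarrow> 'f::field^'n^'n) \<Rightarrow> nat \<Rightarrow>
   (((nat \<Rightarrow> real) \<Rightarrow> 'b) \<Rightarrow>\<^sub>0 'f^'n) set" where
  "tensor_relations E act \<pi> \<rho> k =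
     additive_span {Poly_Mapping.single (simplex_map k (act g) \<sigma>) (\<rho> g *v v) - Poly_Mapping.single \<sigma> v
                    | g \<sigma> v. g \<in> carrier \<pi> \<and> singular_simplex k (top_of_set E) \<sigma>}"

definition tensor_boundary ::
  "nat \<Rightarrow> (((nat \<Rightarrow> real) \<Rightarrow> 'b) \<Rightarrow>\<^sub>0 'f::field^'n) \<Rightarrow> (((nat \<Rightarrow> real) \<Rightarrow> 'b) \<Rightarrow>\<^sub>0 'f^'n)" where
  "tensor_boundary k c =
     (if k = 0 then 0
      else \<Sum>\<sigma>\<in>Poly_Mapping.keys c. \<Sum>i\<le>k.
             Poly_Mapping.single (singular_face k i \<sigma>) ((-1) ^ i *s Poly_Mapping.lookup c \<sigma>))"

definition twisted_cycles ::
  "'b::topological_space set \<Rightarrow> ('g \<Rightarrow> 'b \<Rightarrow> 'b) \<Rightarrow> 'g monoid \<Rightarrow> ('g \<Rightarrow> 'f::field^'n^'n) \<Rightarrow> nat \<Rightarrow>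
   (((nat \<Rightarrow> real) \<Rightarrow> 'b) \<Rightarrow>\<^sub>0 'f^'n) set" where
  "twisted_cycles E act \<pi> \<rho> k =
     {c \<in> tensor_chains E k. tensor_boundary k c \<in> tensor_relations E act \<pi> \<rho> (k - 1)}"

definition twisted_boundaries ::
  "'b::topological_space set \<Rightarrow> ('g \<Rightarrow> 'b \<Rightarrow> 'b) \<Rightarrow> 'g monoid \<Rightarrow> ('g \<Rightarrow> 'f::field^'n^'n) \<Rightarrow> nat \<Rightarrow>
   (((nat \<Rightarrow> real) \<Rightarrow> 'b) \<Rightarrow>\<^sub>0 'f^'n) set" where
  "twisted_boundaries E act \<pi> \<rho> k =
     {tensor_boundary (Suc k) d + r | d r. d \<in> tensor_chains E (Suc k) \<and> r \<in> tensor_relations E act \<pi> \<rho> k}"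

definition twisted_homology ::
  "'b::topological_space set \<Rightarrow> ('g \<Rightarrow> 'b \<Rightarrow> 'b) \<Rightarrow> 'g monoid \<Rightarrow> ('g \<Rightarrow> 'f::field^'n^'n) \<Rightarrow> nat \<Rightarrow>
   (((nat \<Rightarrow> real) \<Rightarrow> 'b) \<Rightarrow>\<^sub>0 'f^'n) set set" where
  "twisted_homology E act \<pi> \<rho> k =
     coset_mod (twisted_boundaries E act \<pi> \<rho> k) ` twisted_cycles E act \<pi> \<rho> k"


section \<open>The cohomology pairings\<close>

text \<open>\<open>\<psi>\<^sub>*(f \<smile> f')\<close>, evaluated on a singular simplex of the covering space\<close>

definition cup_form ::
  "('f^'n \<Rightarrow> 'f^'n \<Rightarrow> 'f) \<Rightarrow> nat \<Rightarrow> nat \<Rightarrow> ('b chain \<Rightarrow> 'f^'n) \<Rightarrow> ('b chain \<Rightarrow> 'f^'n) \<Rightarrow>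
   ((nat \<Rightarrow> real) \<Rightarrow> 'b) \<Rightarrow> 'f::field" where
  "cup_form \<psi> i j f f' \<sigma> = \<psi> (f (frag_of (front_face i \<sigma>))) (f' (frag_of (back_face i j \<sigma>)))"

text \<open>
  By \<open>\<rho>\<close>-invariance of \<open>\<psi>\<close>, \<open>\<psi>\<^sub>*(f \<smile> f')\<close> is invariant under deck transformations, so it
  descends to an \<open>F\<close>-valued cochain on \<open>X\<close>. It is evaluated on an integral homology class \<open>c\<close> of \<open>X\<close>
  by lifting, simplex by simplex, a representing cycle to a chain \<open>w\<close> (in general not a cycle) of
  the covering space.
\<close>

definition eval_descended ::
  "'b::topological_space set \<Rightarrow> ('b \<Rightarrow> 'a) \<Rightarrow> nat \<Rightarrow> (((nat \<Rightarrow> real) \<Rightarrow> 'b) \<Rightarrow> 'f::field) \<Rightarrow>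
   'a chain set \<Rightarrow> 'f" where
  "eval_descended E p k u c =
     (let w = (SOME w. singular_chain k (top_of_set E) w \<and> chain_map k p w \<in> c)
      in \<Sum>\<sigma>\<in>Poly_Mapping.keys w. of_int (Poly_Mapping.lookup w \<sigma>) * u \<sigma>)"

text \<open>\<open>(x, y) \<mapsto> \<psi>\<^sub>*((x \<smile> y) \<frown> c)\<close> for classes \<open>x\<close>, \<open>y\<close> of degrees \<open>i\<close>, \<open>j\<close> and \<open>c\<close> of degree \<open>i + j\<close>\<close>

definition cup_pairing ::
  "'b::topological_space set \<Rightarrow> ('b \<Rightarrow> 'a) \<Rightarrow> ('f^'n \<Rightarrow> 'f^'n \<Rightarrow> 'f) \<Rightarrow> nat \<Rightarrow> nat \<Rightarrow> 'a chain set \<Rightarrow>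
   ('b chain \<Rightarrow> 'f^'n) set \<Rightarrow> ('b chain \<Rightarrow> 'f^'n) set \<Rightarrow> 'f::field" where
  "cup_pairing E p \<psi> i j c x y =
     eval_descended E p (i + j) (cup_form \<psi> i j (SOME f. f \<in> x) (SOME f'. f' \<in> y)) c"

definition admissible ::
  "'b::topological_space set \<Rightarrow> ('b \<Rightarrow> 'a) \<Rightarrow> ('g \<Rightarrow> 'b \<Rightarrow> 'b) \<Rightarrow> 'g monoid \<Rightarrow>
   'a chain set \<Rightarrow> 'a chain set \<Rightarrow> ('g \<Rightarrow> 'f::field^'n^'n) \<Rightarrow> ('f^'n \<Rightarrow> 'f^'n \<Rightarrow> 'f) \<Rightarrow> bool" where
  "admissible E p act \<pi> X_fund \<Sigma>\<^sub>\<alpha> \<rho> \<psi> \<longleftrightarrow>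
     (let H = twisted_cohomology (singular_complex E act) \<pi> \<rho>;
          Z = twisted_coboundaries (singular_complex E act) \<pi> \<rho>
      in nondegenerate_pairing (Z 1) (H 1) (Z 1) (H 1) (cup_pairing E p \<psi> 1 1 \<Sigma>\<^sub>\<alpha>) \<and>
         (\<forall>i\<le>3. nondegenerate_pairing (Z i) (H i) (Z (3 - i)) (H (3 - i))
                   (cup_pairing E p \<psi> i (3 - i) X_fund)))"

text \<open>
  The matrix \<open>J\<close> is the normal form to which the Gram matrix is normalised. For the identity
  matrix one gets orthonormal bases in the strict sense. Other normal forms are needed since the
  pairing on \<open>H\<^sup>1\<close> is anti-hermitian if \<open>\<psi>\<close> is hermitian, and since \<open>F\<close> is arbitrary.
  The matrices \<open>T\<close> relating two such bases form the unitary group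
  \<open>{T. T J (bar T)\<^sup>t = J}\<close> of the pairing.
\<close>

definition normalized_orthonormal_basis ::
  "'b::topological_space set \<Rightarrow> ('b \<Rightarrow> 'a) \<Rightarrow> ('g \<Rightarrow> 'b \<Rightarrow> 'b) \<Rightarrow> 'g monoid \<Rightarrow> 'a chain set \<Rightarrow>
   ('g \<Rightarrow> 'f::field^'n^'n) \<Rightarrow> ('f^'n \<Rightarrow> 'f^'n \<Rightarrow> 'f) \<Rightarrow> (nat \<Rightarrow> nat \<Rightarrow> 'f) \<Rightarrow>
   ('b chain \<Rightarrow> 'f^'n) set list \<Rightarrow> bool" where
  "normalized_orthonormal_basis E p act \<pi> \<Sigma>\<^sub>\<alpha> \<rho> \<psi> J h \<longleftrightarrow>
     twisted_cohomology_basis (singular_complex E act) \<pi> \<rho> 1 h \<and>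
     (\<forall>i<length h. \<forall>j<length h. cup_pairing E p \<psi> 1 1 \<Sigma>\<^sub>\<alpha> (h ! i) (h ! j) = J i j)"

definition dual_basis ::
  "'b::topological_space set \<Rightarrow> ('b \<Rightarrow> 'a) \<Rightarrow> ('g \<Rightarrow> 'b \<Rightarrow> 'b) \<Rightarrow> 'g monoid \<Rightarrow> 'a chain set \<Rightarrow>
   ('g \<Rightarrow> 'f::field^'n^'n) \<Rightarrow> ('f^'n \<Rightarrow> 'f^'n \<Rightarrow> 'f) \<Rightarrow>
   ('b chain \<Rightarrow> 'f^'n) set list \<Rightarrow> ('b chain \<Rightarrow> 'f^'n) set list \<Rightarrow> bool" where
  "dual_basis E p act \<pi> X_fund \<rho> \<psi> h k \<longleftrightarrow>
     twisted_cohomology_basis (singular_complex E act) \<pi> \<rho> 2 k \<and> length k = length h \<and>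
     (\<forall>i<length h. \<forall>j<length h.
        cup_pairing E p \<psi> 1 2 X_fund (h ! i) (k ! j) = (if i = j then 1 else 0))"


section \<open>CW structures and the refined torsion\<close>

text \<open>
  The \<open>k\<close>-disc is modelled by the standard simplex, so that a characteristic map is a
  singular simplex \<open>\<sigma>\<close>, and the oriented cell is the class of \<open>\<sigma>\<close> in the relative homology
  of consecutive skeleta. \<open>chi k\<close> lists the characteristic maps of the \<open>k\<close>-cells, and
  \<open>skel chi k\<close> is the union of the cells of dimension \<^emph>\<open>less than\<close> \<open>k\<close>.
  In a Hausdorff space, a finite structure needs no further topological conditions.
\<close>

definition open_simplex :: "nat \<Rightarrow> (nat \<Rightarrow> real) set" where
  "open_simplex k = {x \<in> standard_simplex k. \<forall>i\<le>k. 0 < x i}"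

definition skel :: "(nat \<Rightarrow> ((nat \<Rightarrow> real) \<Rightarrow> 'a) list) \<Rightarrow> nat \<Rightarrow> 'a set" where
  "skel chi k = (\<Union>i<k. \<Union>\<sigma>\<in>set (chi i). \<sigma> ` standard_simplex i)"

definition finite_cw_structure ::
  "'a::topological_space set \<Rightarrow> (nat \<Rightarrow> ((nat \<Rightarrow> real) \<Rightarrow> 'a) list) \<Rightarrow> bool" where
  "finite_cw_structure M chi \<longleftrightarrow>
     (\<forall>k>3. chi k = []) \<and>
     (\<forall>k. \<forall>\<sigma>\<in>set (chi k).
        singular_simplex k (top_of_set M) \<sigma> \<and>
        embedding_map (subtopology (powertop_real UNIV) (open_simplex k)) (top_of_set M) \<sigma> \<and>
        \<sigma> ` (standard_simplex k - open_simplex k) \<subseteq> skel chi k) \<and>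
     (\<forall>x\<in>M. \<exists>!(k, j). j < length (chi k) \<and> x \<in> (chi k ! j) ` open_simplex k)"

definition lifted_cells ::
  "'b::topological_space set \<Rightarrow> ('b \<Rightarrow> 'a) \<Rightarrow> (nat \<Rightarrow> ((nat \<Rightarrow> real) \<Rightarrow> 'a) list) \<Rightarrow>
   (nat \<Rightarrow> ((nat \<Rightarrow> real) \<Rightarrow> 'b) list) \<Rightarrow> bool" where
  "lifted_cells E p chi chiE \<longleftrightarrow>
     (\<forall>k. chi k = map (simplex_map k p) (chiE k) \<and>
          (\<forall>\<sigma>\<in>set (chiE k). singular_simplex k (top_of_set E) \<sigma>))"

definition skelE ::
  "'b set \<Rightarrow> ('b \<Rightarrow> 'a) \<Rightarrow> (nat \<Rightarrow> ((nat \<Rightarrow> real) \<Rightarrow> 'a) list) \<Rightarrow> nat \<Rightarrow> 'b set" where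
  "skelE E p chi k = {e \<in> E. p e \<in> skel chi k}"

definition cellular_complex ::
  "'b::topological_space set \<Rightarrow> ('b \<Rightarrow> 'a) \<Rightarrow> ('g \<Rightarrow> 'b \<Rightarrow> 'b) \<Rightarrow>
   (nat \<Rightarrow> ((nat \<Rightarrow> real) \<Rightarrow> 'a) list) \<Rightarrow> ('g, 'b chain set) eqv_complex" where
  "cellular_complex E p act chi = (let Sk = skelE E p chi in
     \<lparr>grp = (\<lambda>k. relative_homology_group (int k) (top_of_set (Sk (Suc k))) (Sk k)),
      bd = (\<lambda>k. hom_relboundary (int (Suc k)) (top_of_set (Sk (Suc (Suc k)))) (Sk (Suc k)) (Sk k)),
      actn = (\<lambda>k g. hom_induced (int k) (top_of_set (Sk (Suc k))) (Sk k)
                                        (top_of_set (Sk (Suc k))) (Sk k) (act g))\<rparr>)"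

definition cell_class ::
  "'b::topological_space set \<Rightarrow> ('b \<Rightarrow> 'a) \<Rightarrow> (nat \<Rightarrow> ((nat \<Rightarrow> real) \<Rightarrow> 'a) list) \<Rightarrow> nat \<Rightarrow>
   ((nat \<Rightarrow> real) \<Rightarrow> 'b) \<Rightarrow> 'b chain set" where
  "cell_class E p chi k \<sigma> =
     homologous_rel_set k (top_of_set (skelE E p chi (Suc k))) (skelE E p chi k) (frag_of \<sigma>)"

text \<open>
  An equivariant chain map from cellular to singular chains sending each cellular chain, i.e. each
  class in the relative homology of consecutive skeleta, to a relative cycle representing it.
  Since the cellular chain groups are free over the group ring, such maps exist; they are
  unique up to equivariant homotopy, and they induce the canonical isomorphism
  from singular to cellular cohomology.
\<close>

definition cellular_to_singular ::
  "'b::topological_space set \<Rightarrow> ('b \<Rightarrow> 'a) \<Rightarrow> ('g \<Rightarrow> 'b \<Rightarrow> 'b) \<Rightarrow> 'g monoid \<Rightarrow>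
   (nat \<Rightarrow> ((nat \<Rightarrow> real) \<Rightarrow> 'a) list) \<Rightarrow> (nat \<Rightarrow> 'b chain set \<Rightarrow> 'b chain) \<Rightarrow> bool" where
  "cellular_to_singular E p act \<pi> chi \<phi> \<longleftrightarrow>
     (let C = cellular_complex E p act chi; S = singular_complex E act in
      \<forall>k. \<phi> k \<in> hom (grp C k) (grp S k) \<and>
          (\<forall>x\<in>carrier (grp C k). \<phi> k x \<in> x) \<and>
          (\<forall>g\<in>carrier \<pi>. \<forall>x\<in>carrier (grp C k). \<phi> k (actn C k g x) = actn S k g (\<phi> k x)) \<and>
          (\<forall>x\<in>carrier (grp C (Suc k)). bd S k (\<phi> (Suc k) x) = \<phi> k (bd C k x)))"

definition to_cellular_class ::
  "('g, 'c) eqv_complex \<Rightarrow> 'g monoid \<Rightarrow> ('g \<Rightarrow> 'f::field^'n^'n) \<Rightarrow> (nat \<Rightarrow> 'c \<Rightarrow> 'd) \<Rightarrow> nat \<Rightarrow>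
   ('d \<Rightarrow> 'f^'n) set \<Rightarrow> ('c \<Rightarrow> 'f^'n) set" where
  "to_cellular_class C \<pi> \<rho> \<phi> k x =
     (\<Union>f\<in>x. coset_mod (twisted_coboundaries C \<pi> \<rho> k)
                (\<lambda>y. if y \<in> carrier (grp C k) then f (\<phi> k y) else 0))"

definition index_order :: "'n::finite list" where
  "index_order = (SOME xs. distinct xs \<and> set xs = UNIV)"

text \<open>The basis dual to (lifted oriented cells) \<open>\<otimes>\<close> (standard basis of \<open>F\<^sup>n\<close>)\<close>

definition cell_cochain_basis ::
  "'b::topological_space set \<Rightarrow> ('b \<Rightarrow> 'a) \<Rightarrow> ('g \<Rightarrow> 'b \<Rightarrow> 'b) \<Rightarrow> 'g monoid \<Rightarrow>
   (nat \<Rightarrow> ((nat \<Rightarrow> real) \<Rightarrow> 'a) list) \<Rightarrow> (nat \<Rightarrow> ((nat \<Rightarrow> real) \<Rightarrow> 'b) list) \<Rightarrow>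
   ('g \<Rightarrow> 'f::field^'n^'n) \<Rightarrow> nat \<Rightarrow> ('b chain set \<Rightarrow> 'f^'n) list" where
  "cell_cochain_basis E p act \<pi> chi chiE \<rho> k =
     concat (map (\<lambda>j. map (\<lambda>i.
        THE f. f \<in> cochains (cellular_complex E p act chi) \<pi> \<rho> k \<and>
               (\<forall>l<length (chiE k). f (cell_class E p chi k (chiE k ! l)) = (if l = j then axis i 1 else 0)))
      index_order) [0..<length (chiE k)])"

definition plus_minus_det :: "'g monoid \<Rightarrow> ('g \<Rightarrow> 'f::field^'n^'n) \<Rightarrow> 'f set" where
  "plus_minus_det \<pi> \<rho> = {\<epsilon> * Determinants.det (\<rho> g) | \<epsilon> g. \<epsilon> \<in> {1, -1} \<and> g \<in> carrier \<pi>}"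

text \<open>
  The refined torsion, as a coset of \<open>\<plusminus>det(\<rho>(\<pi>))\<close> in the multiplicative group of \<open>F\<close>; the bases
  \<open>h1\<close>, \<open>h2\<close> of singular cohomology are transported to the cellular cochain complex.
\<close>

definition refined_torsion ::
  "'b::topological_space set \<Rightarrow> ('b \<Rightarrow> 'a) \<Rightarrow> ('g \<Rightarrow> 'b \<Rightarrow> 'b) \<Rightarrow> 'g monoid \<Rightarrow>
   (nat \<Rightarrow> ((nat \<Rightarrow> real) \<Rightarrow> 'a) list) \<Rightarrow> (nat \<Rightarrow> ((nat \<Rightarrow> real) \<Rightarrow> 'b) list) \<Rightarrow>
   (nat \<Rightarrow> 'b chain set \<Rightarrow> 'b chain) \<Rightarrow> ('g \<Rightarrow> 'f::field^'n^'n) \<Rightarrow>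
   ('b chain \<Rightarrow> 'f^'n) set list \<Rightarrow> ('b chain \<Rightarrow> 'f^'n) set list \<Rightarrow> 'f set" where
  "refined_torsion E p act \<pi> chi chiE \<phi> \<rho> h1 h2 =
     (let C = cellular_complex E p act chi;
          h = (\<lambda>k. if k = 1 then map (to_cellular_class C \<pi> \<rho> \<phi> 1) h1
                   else if k = 2 then map (to_cellular_class C \<pi> \<rho> \<phi> 2) h2 else [])
      in plus_minus_det \<pi> \<rho> #>\<^bsub>mult_group_field\<^esub>
           torsion fscale 3 (cochains C \<pi> \<rho>) (coboundary C)
             (cell_cochain_basis E p act \<pi> chi chiE \<rho>) h)"

end

theory Submission
  imports Defs
begin

text \<open>
  Let \<open>T\<close> be the matrix relating two normalized bases of \<open>H\<^sup>1\<close> and \<open>S\<close> the one relating their dual bases.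
  Both pairings are sesquilinear on classes, so \<open>T J (bar T)\<^sup>t = J\<close> and \<open>T (bar S)\<^sup>t = 1\<close>. As \<open>J\<close> is invertible
  by nondegeneracy, \<open>det T \<sqdot> bar (det T) = 1 = det T \<sqdot> bar (det S)\<close> and therefore \<open>det S = det T\<close>. The torsion
  is multiplied by \<open>det T\<close> in degree one and by \<open>(det S)\<^sup>-\<^sup>1\<close> in degree two, so it does not change at all,
  not only modulo \<open>\<plusminus>det (\<rho> (\<pi>))\<close>.

  The pairings are evaluated on a chain of the covering space lifting a cycle of \<open>M\<close>. It exists since
  cycles can be subdivided into simplices lying in evenly covered sets. A coboundary evaluates to zero on it
  because lifts of the same simplex differ by a deck transformation.
\<close>

section \<open>Lifting along the universal covering\<close>

text \<open>\<open>torsion\<close> is a definite description, so the proof does not compute its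
  value. It shows that \<open>is_torsion\<close> holds for the same values with either pair of
  bases, and the two descriptions then pick the same element. What has to be bridged is that the
  bases live in singular cohomology while the torsion lives on cellular cochains. Transition
  matrices are therefore formed on singular cocycles modulo coboundaries, where the pairings can be
  evaluated, and are carried over by pullback along \<open>\<phi>\<close>, which leaves them
  unchanged. That the new cellular classes again form a basis comes from \<open>is_torsion\<close>
  for the old ones together with the invertible matrix. Inside the torsion the lifts of the classes
  may be chosen freely; taking for the new ones exactly the matrix combinations of the old ones
  turns a congruence modulo coboundaries into an equation between cochains, and only then does a
  determinant split off.\<close>

lemma covering_space_evenly_covered:
  assumes "covering_space E p M" "y \<in> M"
  obtains U \<V> where "y \<in> U" "openin (top_of_set M) U" "\<Union>\<V> = E \<inter> p -` U"
    "\<And>V. V \<in> \<V> \<Longrightarrow> openin (top_of_set E) V" "pairwise disjnt \<V>"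
    "\<And>V. V \<in> \<V> \<Longrightarrow> \<exists>q. homeomorphism V U p q"
  using assms unfolding covering_space_def by metis

lemma eventually_at_within_openin:
  assumes "openin (top_of_set T) N" "z \<in> N" "\<And>y. y \<in> N \<Longrightarrow> P y"
  shows "eventually P (at z within T)"
  using assms unfolding openin_open eventually_at_topological by blast

text \<open>Agreement of the two lifts is locally constant on the connected set \<open>T\<close>.
  Near \<open>z\<close> each lift stays in one sheet. If both stay in the same sheet,
  \<open>p\<close> is injective there and they agree; if the sheets differ, they are disjoint and
  the lifts disagree.\<close>

lemma covering_space_unique_lift:
  fixes p :: "'b::topological_space \<Rightarrow> 'a::topological_space" and T :: "'c::topological_space set"
  assumes cov: "covering_space E p M" and T: "connected T" "a \<in> T" "x \<in> T"
    and g1: "continuous_on T g1" "g1 ` T \<subseteq> E" and g2: "continuous_on T g2" "g2 ` T \<subseteq> E"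
    and p: "\<And>y. y \<in> T \<Longrightarrow> p (g1 y) = p (g2 y)" and a: "g1 a = g2 a"
  shows "g1 x = g2 x"
proof -
  have "\<forall>z\<in>T. eventually (\<lambda>y. (g1 z = g2 z) = (g1 y = g2 y)) (at z within T)"
  proof
    fix z assume z: "z \<in> T"
    have zE: "g1 z \<in> E" "g2 z \<in> E" using g1 g2 z by auto
    then have "p (g1 z) \<in> M" using cov by (auto simp: covering_space_def)
    then obtain U \<V> where U: "p (g1 z) \<in> U" "openin (top_of_set M) U" "\<Union>\<V> = E \<inter> p -` U"
      "\<And>V. V \<in> \<V> \<Longrightarrow> openin (top_of_set E) V" "pairwise disjnt \<V>"
      "\<And>V. V \<in> \<V> \<Longrightarrow> \<exists>q. homeomorphism V U p q"
      by (rule covering_space_evenly_covered[OF cov]) blast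
    have inj: "inj_on p V" if "V \<in> \<V>" for V
      using U(6)[OF that] by (auto simp: homeomorphism_def intro: inj_on_inverseI)
    obtain V1 V2 where V: "V1 \<in> \<V>" "V2 \<in> \<V>" "g1 z \<in> V1" "g2 z \<in> V2"
      using U(1,3) zE p[OF z] by (metis IntI UnionE vimageI)
    define N where "N = (T \<inter> g1 -` V1) \<inter> (T \<inter> g2 -` V2)"
    have "openin (top_of_set T) N"
      unfolding N_def
      by (rule openin_Int; rule continuous_openin_preimage[OF _ _ U(4)]) (use V g1 g2 in auto)
    moreover have "z \<in> N" using V z by (auto simp: N_def)
    moreover have "(g1 z = g2 z) = (g1 y = g2 y)" if "y \<in> N" for y
    proof (cases "V1 = V2")
      case True
      with that V show ?thesis
        using inj_onD[OF inj[OF V(1)]] p z unfolding N_def by (metis IntE vimageE)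
    next
      case False
      then have "V1 \<inter> V2 = {}" using U(5) V by (auto simp: pairwise_def disjnt_def)
      with that V show ?thesis unfolding N_def by auto
    qed
    ultimately show "eventually (\<lambda>y. (g1 z = g2 z) = (g1 y = g2 y)) (at z within T)"
      by (rule eventually_at_within_openin)
  qed
  from connected_local_const[OF T(1,2,3) this] a show ?thesis by simp
qed

text \<open>Interval induction by \<open>Bolzano\<close>: lifts over adjacent intervals can be
  glued, and over a short interval the path stays in one evenly covered set, where a local inverse
  of \<open>p\<close> on the sheet containing the starting point gives the lift.\<close>

lemma covering_space_path_lifting:
  fixes p :: "'b::topological_space \<Rightarrow> 'a::topological_space"
  assumes cov: "covering_space E p M" and \<gamma>: "path \<gamma>" "path_image \<gamma> \<subseteq> M"
    and e: "e \<in> E" "p e = pathstart \<gamma>"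
  obtains \<delta> where "path \<delta>" "path_image \<delta> \<subseteq> E" "pathstart \<delta> = e"
    "\<And>t. t \<in> {0..1} \<Longrightarrow> p (\<delta> t) = \<gamma> t"
proof -
  \<comment> \<open>Extended by constants beyond the unit interval, so that the local condition of
    \<open>Bolzano\<close> makes sense at every real number.\<close>
  define c where "c = (\<lambda>t. \<gamma> (max 0 (min 1 t)))"
  have c: "continuous_on UNIV c"
    unfolding c_def
    by (rule continuous_on_compose2[of "{0..1}" \<gamma>])
       (use \<gamma> in \<open>auto simp: path_def intro!: continuous_intros\<close>)
  have cM: "c t \<in> M" for t
    using \<gamma> by (auto simp: c_def path_image_def)
  \<comment> \<open>The starting point is quantified inside \<open>P\<close>, because the lift over
    the second of two adjacent intervals has to start where the first one ends.\<close>
  define P where "P = (\<lambda>a b. a \<le> b \<longrightarrow> (\<forall>e\<in>E. p e = c a \<longrightarrow>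
     (\<exists>g. continuous_on {a..b} g \<and> g a = e \<and> (\<forall>t\<in>{a..b}. g t \<in> E \<and> p (g t) = c t))))"
  have "P 0 1"
  proof (rule Bolzano)
    show "(0::real) \<le> 1" by simp
  next
    fix a b d :: real
    assume P: "P a b" "P b d" and le: "a \<le> b" "b \<le> d"
    show "P a d"
      unfolding P_def
    proof (intro impI ballI)
      fix e assume e: "e \<in> E" "p e = c a"
      obtain g where g: "continuous_on {a..b} g" "g a = e" "\<forall>t\<in>{a..b}. g t \<in> E \<and> p (g t) = c t"
        using P(1) le e unfolding P_def by blast
      then have "g b \<in> E" "p (g b) = c b" using le by auto
      then obtain h where h: "continuous_on {b..d} h" "h b = g b"
          "\<forall>t\<in>{b..d}. h t \<in> E \<and> p (h t) = c t"
        using P(2) le unfolding P_def by blast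
      define k where "k = (\<lambda>t. if t \<le> b then g t else h t)"
      have "continuous_on ({a..b} \<union> {b..d}) k"
        unfolding k_def
        by (rule continuous_on_If) (use g h le in \<open>auto simp: dual_order.antisym\<close>)
      then have "continuous_on {a..d} k" using le by (simp add: ivl_disj_un)
      then show "\<exists>g. continuous_on {a..d} g \<and> g a = e \<and> (\<forall>t\<in>{a..d}. g t \<in> E \<and> p (g t) = c t)"
        using g h le by (intro exI[of _ k]) (auto simp: k_def)
    qed
  next
    fix x :: real
    obtain U \<V> where U: "c x \<in> U" "openin (top_of_set M) U" "\<Union>\<V> = E \<inter> p -` U"
      "\<And>V. V \<in> \<V> \<Longrightarrow> openin (top_of_set E) V" "pairwise disjnt \<V>"
      "\<And>V. V \<in> \<V> \<Longrightarrow> \<exists>q. homeomorphism V U p q"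
      by (rule covering_space_evenly_covered[OF cov cM[of x]]) blast
    have "openin (top_of_set UNIV) (UNIV \<inter> c -` U)"
      using c U(2) cM by (intro continuous_openin_preimage) auto
    then have "open (c -` U)" by simp
    then obtain d where d: "d > 0" "ball x d \<subseteq> c -` U"
      using U(1) by (meson openE vimageI)
    show "\<exists>d>0. \<forall>a b. a \<le> x \<and> x \<le> b \<and> b - a < d \<longrightarrow> P a b"
    proof (intro exI[of _ d] conjI allI impI)
      fix a b assume ab: "a \<le> x \<and> x \<le> b \<and> b - a < d"
      have cU: "c t \<in> U" if "t \<in> {a..b}" for t
        using that ab subsetD[OF d(2), of t] by (auto simp: dist_real_def)
      show "P a b"
        unfolding P_def
      proof (intro impI ballI)
        fix e assume e: "e \<in> E" "p e = c a"
        then have "e \<in> \<Union>\<V>" using U(3) cU[of a] ab by auto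
        then obtain V q where V: "V \<in> \<V>" "e \<in> V" and q: "homeomorphism V U p q"
          using U(6) by blast
        have "V \<subseteq> E" using V U(3) by blast
        show "\<exists>g. continuous_on {a..b} g \<and> g a = e \<and> (\<forall>t\<in>{a..b}. g t \<in> E \<and> p (g t) = c t)"
        proof (intro exI[of _ "q \<circ> c"] conjI ballI)
          show "continuous_on {a..b} (q \<circ> c)"
            using q cU by (intro continuous_on_compose continuous_on_subset[OF c])
              (auto simp: homeomorphism_def intro: continuous_on_subset)
          show "(q \<circ> c) a = e" using q V e by (metis comp_apply homeomorphism_def)
        qed (use q cU \<open>V \<subseteq> E\<close> in \<open>auto simp: homeomorphism_def\<close>)
      qed
    qed (rule d)
  qed
  moreover have "p e = c 0" using e by (simp add: c_def pathstart_def)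
  ultimately obtain g where g: "continuous_on {0..1} g" "g 0 = e" "\<forall>t\<in>{0..1}. g t \<in> E \<and> p (g t) = c t"
    using e unfolding P_def by auto
  have "p (g t) = \<gamma> t" if "t \<in> {0..1}" for t
    using g that by (auto simp: c_def)
  then show ?thesis
    by (intro that[of g]) (use g in \<open>auto simp: path_def path_image_def pathstart_def\<close>)
qed

text \<open>Simple connectedness says that any two loops are freely homotopic. Applied to the
  constant loops at \<open>a\<close> and \<open>b\<close>, it gives a homotopy along which a single
  parameter value traces a path from \<open>a\<close> to \<open>b\<close>.\<close>

lemma simply_connected_joining_path:
  fixes E :: "'b::topological_space set"
  assumes "simply_connected E" "a \<in> E" "b \<in> E"
  obtains \<gamma> where "path \<gamma>" "path_image \<gamma> \<subseteq> E" "pathstart \<gamma> = a" "pathfinish \<gamma> = b"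
proof -
  have c: "path (\<lambda>_::real. x)" "path_image (\<lambda>_::real. x) \<subseteq> E" if "x \<in> E" for x
    using that by (auto simp: path_def path_image_def)
  have "homotopic_loops E (\<lambda>_. a) (\<lambda>_. b)"
    using assms c unfolding simply_connected_def by (auto simp: pathstart_def pathfinish_def)
  then obtain h where h: "continuous_on ({0..1::real} \<times> {0..1::real}) h"
      "h ` ({0..1} \<times> {0..1}) \<subseteq> E" "\<forall>x\<in>{0..1}. h (0, x) = a" "\<forall>x\<in>{0..1}. h (1, x) = b"
    unfolding homotopic_loops image_subset_iff_funcset by auto
  show ?thesis
  proof (rule that[of "\<lambda>t. h (t, 0)"])
    show "path (\<lambda>t. h (t, 0))"
      unfolding path_def
      by (rule continuous_on_compose2[OF h(1)]) (auto intro!: continuous_intros)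
  qed (use h in \<open>auto simp: path_image_def pathstart_def pathfinish_def\<close>)
qed

section \<open>Deck transformations\<close>

lemma fundamental_group_carrierI:
  assumes "path \<gamma>" "path_image \<gamma> \<subseteq> M" "pathstart \<gamma> = x0" "pathfinish \<gamma> = x0"
  shows "homotopy_class M \<gamma> \<in> carrier (fundamental_group M x0)" "\<gamma> \<in> homotopy_class M \<gamma>"
proof -
  show "homotopy_class M \<gamma> \<in> carrier (fundamental_group M x0)"
    unfolding fundamental_group_def partial_object.simps loops_at_def
    using assms by (intro imageI CollectI conjI)
  show "\<gamma> \<in> homotopy_class M \<gamma>"
    unfolding homotopy_class_def mem_Collect_eq homotopic_paths_refl using assms by (intro conjI)
qed

lemma universal_covering_deck_transformation:
  assumes uc: "universal_covering M x0 E p e0 act" and g: "g \<in> carrier (fundamental_group M x0)"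
  shows "continuous_on E (act g)" "act g ` E = E" "\<And>e. e \<in> E \<Longrightarrow> p (act g e) = p e"
proof -
  have "(\<exists>k. homeomorphism E E (act g) k) \<and> (\<forall>e\<in>E. p (act g e) = p e)"
    using uc g unfolding universal_covering_def by (elim conjE) (drule bspec, assumption, elim conjE, intro conjI)
  then obtain k where "homeomorphism E E (act g) k" and p: "\<forall>e\<in>E. p (act g e) = p e" by blast
  then show "continuous_on E (act g)" "act g ` E = E" by (auto simp: homeomorphism_def)
  show "p (act g e) = p e" if "e \<in> E" for e using p that by (rule bspec)
qed

text \<open>
  For a path \<open>\<gamma>\<close> from \<open>e0\<close> to \<open>e\<close>, the projection of \<open>\<gamma>\<close> is lifted backwards from \<open>e'\<close>; the point over \<open>x0\<close>
  where this lift ends determines \<open>g\<close>.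
\<close>
lemma universal_covering_transitive:
  fixes E :: "'b::topological_space set" and M :: "'a::topological_space set"
  assumes uc: "universal_covering M x0 E p e0 act" and e: "e \<in> E" "e' \<in> E" "p e = p e'"
  obtains g where "g \<in> carrier (fundamental_group M x0)" "act g e = e'"
proof -
  have cov: "covering_space E p M" and sc: "simply_connected E" and e0: "e0 \<in> E" "p e0 = x0"
    using uc by (auto simp: universal_covering_def)
  have p: "continuous_on E p" "p ` E = M" using cov by (auto simp: covering_space_def)
  have proj: "path (p \<circ> \<gamma>)" "path_image (p \<circ> \<gamma>) \<subseteq> M" if "path \<gamma>" "path_image \<gamma> \<subseteq> E" for \<gamma>
    using that p unfolding path_image_compose
    by (auto intro!: path_continuous_image continuous_on_subset[OF p(1)])
  obtain \<gamma> where \<gamma>: "path \<gamma>" "path_image \<gamma> \<subseteq> E" "pathstart \<gamma> = e0" "pathfinish \<gamma> = e"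
    by (rule simply_connected_joining_path[OF sc e0(1) e(1)])
  have "path (reversepath (p \<circ> \<gamma>))" "path_image (reversepath (p \<circ> \<gamma>)) \<subseteq> M"
    "p e' = pathstart (reversepath (p \<circ> \<gamma>))"
    using proj[OF \<gamma>(1,2)] e(3) \<gamma>(4) by (simp_all add: pathfinish_compose)
  from covering_space_path_lifting[OF cov this(1,2) e(2) this(3)]
  obtain \<eta> where \<eta>: "path \<eta>" "path_image \<eta> \<subseteq> E" "pathstart \<eta> = e'"
    "\<And>t. t \<in> {0..1} \<Longrightarrow> p (\<eta> t) = reversepath (p \<circ> \<gamma>) t" by blast
  have fin: "pathfinish \<eta> \<in> E" "p (pathfinish \<eta>) = x0"
    using \<eta>(2) \<eta>(4)[of 1] \<gamma>(3) e0
    by (auto simp: pathstart_def pathfinish_def reversepath_def path_image_def)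
  \<comment> \<open>The loop \<open>p \<circ> \<delta>\<close> has the lift \<open>\<delta>\<close>
    from \<open>e0\<close> to \<open>pathfinish \<eta>\<close>; by the definition of
    \<open>act\<close> its class moves \<open>e0\<close> to that point.\<close>
  obtain \<delta> where \<delta>: "path \<delta>" "path_image \<delta> \<subseteq> E" "pathstart \<delta> = e0" "pathfinish \<delta> = pathfinish \<eta>"
    by (rule simply_connected_joining_path[OF sc e0(1) fin(1)])
  define g where "g = homotopy_class M (p \<circ> \<delta>)"
  have g: "g \<in> carrier (fundamental_group M x0)" "p \<circ> \<delta> \<in> g"
    unfolding g_def
    by (rule fundamental_group_carrierI; use proj[OF \<delta>(1,2)] \<delta> fin e0 in
        \<open>simp add: pathstart_compose pathfinish_compose\<close>)+
  have "\<forall>\<gamma>. path \<gamma> \<and> path_image \<gamma> \<subseteq> E \<and> pathstart \<gamma> = e0 \<and> p \<circ> \<gamma> \<in> g \<longrightarrow> act g e0 = pathfinish \<gamma>"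
    using uc g(1) unfolding universal_covering_def by (elim conjE) (drule bspec, assumption, elim conjE)
  then have act: "act g e0 = pathfinish \<eta>"
    using \<delta> g(2) by simp
  note deck = universal_covering_deck_transformation[OF uc g(1)]
  \<comment> \<open>Both paths lift \<open>p \<circ> \<gamma>\<close> and start at
    \<open>pathfinish \<eta>\<close>, so they have the same end point, which is
    \<open>act g e\<close> for the first and \<open>e'\<close> for the second.\<close>
  have "(act g \<circ> \<gamma>) 1 = (reversepath \<eta>) 1"
  proof (rule covering_space_unique_lift[OF cov, of "{0..1}" 0])
    show "continuous_on {0..1} (act g \<circ> \<gamma>)"
      using \<gamma> unfolding path_def path_image_def
      by (intro continuous_on_compose continuous_on_subset[OF deck(1)])
    show "(act g \<circ> \<gamma>) ` {0..1} \<subseteq> E" using \<gamma>(2) deck(2) by (auto simp: path_image_def)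
    show "continuous_on {0..1} (reversepath \<eta>)"
      using \<eta>(1) path_reversepath[of \<eta>] by (simp only: path_def)
    show "reversepath \<eta> ` {0..1} \<subseteq> E"
      using \<eta>(2) path_image_reversepath[of \<eta>] by (simp only: path_image_def)
    show "p ((act g \<circ> \<gamma>) y) = p (reversepath \<eta> y)" if "y \<in> {0..1}" for y
    proof -
      have "\<gamma> y \<in> E" using \<gamma>(2) that by (auto simp: path_image_def)
      then show ?thesis using \<eta>(4)[of "1 - y"] that deck(3) by (auto simp: reversepath_def)
    qed
    show "(act g \<circ> \<gamma>) 0 = reversepath \<eta> 0"
      using act \<gamma>(3) by (simp add: reversepath_def pathstart_def pathfinish_def)
  qed auto
  then have "act g e = e'"
    using \<gamma>(4) \<eta>(3) by (simp add: reversepath_def pathstart_def pathfinish_def)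
  with g show ?thesis using that by blast
qed

section \<open>Lifting singular simplices and cycles\<close>

lemma singular_simplex_top_of_set:
  "singular_simplex k (top_of_set E) \<sigma> \<longleftrightarrow>
     continuous_on (standard_simplex k) \<sigma> \<and> \<sigma> ` standard_simplex k \<subseteq> E \<and>
     \<sigma> \<in> extensional (standard_simplex k)"
  unfolding singular_simplex_def euclidean_product_topology continuous_map_subtopology_eu by blast

lemma connected_standard_simplex: "connected (standard_simplex k)"
  using connectedin_standard_simplex[of k]
  unfolding euclidean_product_topology connectedin_iff_connected .

text \<open>Transitivity gives \<open>g\<close> for a single point \<open>v\<close> of the simplex.
  The simplex is connected, so two lifts that agree at \<open>v\<close> agree on all of it; outside
  it both maps are undefined by extensionality.\<close>

lemma lifted_simplices_differ_by_deck_transformation: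
  fixes E :: "'b::topological_space set" and M :: "'a::topological_space set"
  assumes uc: "universal_covering M x0 E p e0 act"
    and \<sigma>: "singular_simplex k (top_of_set E) \<sigma>" and \<tau>: "singular_simplex k (top_of_set E) \<tau>"
    and eq: "simplex_map k p \<sigma> = simplex_map k p \<tau>"
  obtains g where "g \<in> carrier (fundamental_group M x0)" "\<tau> = simplex_map k (act g) \<sigma>"
proof -
  have cov: "covering_space E p M" using uc by (auto simp: universal_covering_def)
  note \<sigma> = \<sigma>[unfolded singular_simplex_top_of_set] and \<tau> = \<tau>[unfolded singular_simplex_top_of_set]
  have eq': "p (\<sigma> x) = p (\<tau> x)" if "x \<in> standard_simplex k" for x
    using fun_cong[OF eq, of x] that by (simp add: simplex_map_def)
  obtain v where v: "v \<in> standard_simplex k" using nonempty_standard_simplex by blast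
  then obtain g where g: "g \<in> carrier (fundamental_group M x0)" "act g (\<sigma> v) = \<tau> v"
    using universal_covering_transitive[OF uc, of "\<sigma> v" "\<tau> v"] \<sigma> \<tau> eq' by blast
  note deck = universal_covering_deck_transformation[OF uc g(1)]
  have "(act g \<circ> \<sigma>) x = \<tau> x" if "x \<in> standard_simplex k" for x
  proof (rule covering_space_unique_lift[OF cov connected_standard_simplex v that])
    show "continuous_on (standard_simplex k) (act g \<circ> \<sigma>)"
      using \<sigma> by (intro continuous_on_compose continuous_on_subset[OF deck(1)]) auto
    show "(act g \<circ> \<sigma>) ` standard_simplex k \<subseteq> E" using \<sigma> deck(2) by fastforce
  qed (use \<sigma> \<tau> deck(3) eq' g in auto)
  then have "\<tau> = simplex_map k (act g) \<sigma>"
    using \<tau> unfolding simplex_map_def by (auto simp: extensional_def)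
  with g that show ?thesis by blast
qed

text \<open>After subdivision every simplex of a cycle lies in an evenly covered set.\<close>
lemma homology_class_lift:
  fixes E :: "'b::topological_space set" and M :: "'a::topological_space set"
  assumes cov: "covering_space E p M" and c: "c \<in> carrier (homology_group (int k) (top_of_set M))"
  obtains w where "singular_chain k (top_of_set E) w" "chain_map k p w \<in> c"
proof -
  obtain z where z: "singular_relcycle k (top_of_set M) {} z"
      "c = homologous_rel_set k (top_of_set M) {} z"
    using c unfolding carrier_relative_homology_group by auto
  define \<C> where "\<C> = {U. openin (top_of_set M) U \<and> (\<exists>\<V>. \<Union>\<V> = E \<inter> p -` U \<and>
      (\<forall>V\<in>\<V>. \<exists>q. homeomorphism V U p q))}"
  have "\<exists>z'. singular_relcycle k (top_of_set M) {} z' \<and> homologous_rel k (top_of_set M) {} z z' \<and>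
       (\<forall>f\<in>Poly_Mapping.keys z'. \<exists>U\<in>\<C>. f \<in> standard_simplex k \<rightarrow> U)"
  proof (rule small_homologous_rel_relcycle_exists[OF _ _ z(1), of \<C>])
    show "topspace (top_of_set M) \<subseteq> \<Union>\<C>"
    proof
      fix y assume "y \<in> topspace (top_of_set M)"
      then have "y \<in> M" by simp
      then obtain U \<V> where U: "y \<in> U" "openin (top_of_set M) U" "\<Union>\<V> = E \<inter> p -` U"
        "\<And>V. V \<in> \<V> \<Longrightarrow> \<exists>q. homeomorphism V U p q"
        by (rule covering_space_evenly_covered[OF cov]) (rule that)
      have "U \<in> \<C>"
        unfolding \<C>_def mem_Collect_eq using U(2-4) by (intro conjI exI[of _ \<V>] ballI)
      with U(1) show "y \<in> \<Union>\<C>" by (rule UnionI[rotated])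
    qed
  qed (auto simp: \<C>_def)
  then obtain z' where z': "singular_relcycle k (top_of_set M) {} z'"
      "homologous_rel k (top_of_set M) {} z z'"
      "\<And>f. f \<in> Poly_Mapping.keys z' \<Longrightarrow> \<exists>U\<in>\<C>. f \<in> standard_simplex k \<rightarrow> U" by blast
  have pE: "p ` E = M" using cov by (simp add: covering_space_def)
  have "\<exists>\<sigma>. singular_simplex k (top_of_set E) \<sigma> \<and> simplex_map k p \<sigma> = f"
    if f: "f \<in> Poly_Mapping.keys z'" for f
  proof -
    have sf: "singular_simplex k (top_of_set M) f"
      using z'(1) f by (auto simp: singular_relcycle_def singular_chain_def)
    note sf = sf[unfolded singular_simplex_top_of_set]
    obtain U where "U \<in> \<C>" and U1: "f \<in> standard_simplex k \<rightarrow> U"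
      using z'(3)[OF f] by (rule bexE)
    from this(1) obtain \<V> where U2: "\<Union>\<V> = E \<inter> p -` U"
      "\<And>V. V \<in> \<V> \<Longrightarrow> \<exists>q. homeomorphism V U p q"
      unfolding \<C>_def mem_Collect_eq by (elim conjE exE) (rule that, assumption, erule bspec)
    note U = U1 U2
    obtain v where v: "v \<in> standard_simplex k" using nonempty_standard_simplex by blast
    \<comment> \<open>A point over \<open>f v\<close> guarantees that there is a sheet over
      \<open>U\<close>. Any sheet will do, since its local inverse of \<open>p\<close> lifts the
      whole simplex at once.\<close>
    then obtain e where "e \<in> E" "p e = f v" using sf pE by (metis image_iff image_subset_iff)
    then have "e \<in> \<Union>\<V>" using U(1,2) v by auto
    then obtain V where V: "V \<in> \<V>" by (rule UnionE)
    obtain q where hom: "homeomorphism V U p q" using U(3)[OF V] by (rule exE)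
    have "V \<subseteq> E" using V U(2) by blast
    have "q \<in> U \<rightarrow> V" "continuous_on U q" "\<And>y. y \<in> U \<Longrightarrow> p (q y) = y"
      using hom by (auto simp: homeomorphism_def)
    note q = this
    have "continuous_on (standard_simplex k) (q \<circ> f)"
      using sf U(1) by (intro continuous_on_compose continuous_on_subset[OF q(2)]) auto
    then have "continuous_on (standard_simplex k) (simplex_map k q f)"
      unfolding simplex_map_def by (simp cong: continuous_on_cong)
    moreover have "simplex_map k q f ` standard_simplex k \<subseteq> E"
      using q(1) U(1) \<open>V \<subseteq> E\<close> unfolding simplex_map_def by fastforce
    ultimately have "singular_simplex k (top_of_set E) (simplex_map k q f)"
      unfolding singular_simplex_top_of_set by (simp add: simplex_map_def)
    moreover have "simplex_map k p (simplex_map k q f) = f"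
    proof
      show "simplex_map k p (simplex_map k q f) x = f x" for x
        using sf U(1) q(3) by (cases "x \<in> standard_simplex k") (auto simp: simplex_map_def extensional_def)
    qed
    ultimately show ?thesis by blast
  qed
  then obtain L where L: "\<And>f. f \<in> Poly_Mapping.keys z' \<Longrightarrow>
      singular_simplex k (top_of_set E) (L f) \<and> simplex_map k p (L f) = f" by metis
  define w where "w = frag_extend (frag_of \<circ> L) z'"
  have "singular_chain k (top_of_set E) w"
    unfolding w_def using L by (intro singular_chain_extend) (simp add: singular_chain_of)
  moreover have "chain_map k p w = z'"
  proof -
    have "chain_map k p w = frag_extend (frag_of \<circ> (simplex_map k p \<circ> L)) z'"
      unfolding w_def chain_map_def by (simp add: frag_extend_compose comp_assoc)
    also have "\<dots> = frag_extend frag_of z'"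
      using L by (intro frag_extend_eq) simp
    finally show ?thesis using frag_expansion by metis
  qed
  ultimately show ?thesis using that z(2) z'(2) by simp
qed

lemma homology_class_cycle:
  assumes "c \<in> carrier (homology_group (int k) X)" "z \<in> c"
  shows "chain_boundary k z = 0"
proof -
  obtain y where y: "singular_relcycle k X {} y" "c = homologous_rel_set k X {} y"
    using assms(1) unfolding carrier_relative_homology_group by auto
  have "singular_relcycle k X {} z"
    using homologous_rel_singular_relcycle[of k X "{}" y z] y assms(2) by simp
  then show ?thesis by (simp add: singular_cycle)
qed

section \<open>The cup product pairings\<close>

lemma field_involution_simps:
  assumes "field_involution bar"
  shows "bar (x + y) = bar x + bar y" "bar (x * y) = bar x * bar y" "bar (bar x) = x"
    "bar 0 = 0" "bar 1 = 1" "bar (- x) = - bar x"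
proof -
  have add: "bar (x + y) = bar x + bar y" and mult: "bar (x * y) = bar x * bar y"
    and inv: "bar (bar x) = x" for x y
    using assms unfolding field_involution_def by blast+
  show "bar (x + y) = bar x + bar y" "bar (x * y) = bar x * bar y" "bar (bar x) = x"
    by (rule add mult inv)+
  show zero: "bar 0 = 0" using add[of 0 0] by (metis add_0 add_cancel_right_right)
  \<comment> \<open>Evaluating \<open>bar (bar 1 * 1)\<close> in two ways gives 1 and
    \<open>bar 1\<close>.\<close>
  show one: "bar 1 = 1" using mult[of "bar 1" 1] inv[of 1] by simp
  show "bar (- x) = - bar x" using add[of x "- x"] zero by (simp add: eq_neg_iff_add_eq_0 add.commute)
qed

lemma sesquilinear_form_simps:
  assumes bar: "field_involution bar" and \<psi>: "hermitian_or_antihermitian bar \<psi>"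
  shows "\<psi> (u + v) w = \<psi> u w + \<psi> v w" "\<psi> u (v + w) = \<psi> u v + \<psi> u w"
    "\<psi> (a *s v) w = a * \<psi> v w" "\<psi> v (a *s w) = bar a * \<psi> v w"
    "\<psi> 0 w = 0" "\<psi> v 0 = 0"
    "\<psi> (\<Sum>m\<in>I. (-1) ^ m *s f m) w = (\<Sum>m\<in>I. (-1) ^ m * \<psi> (f m) w)"
    "\<psi> v (\<Sum>m\<in>I. (-1) ^ m *s f m) = (\<Sum>m\<in>I. (-1) ^ m * \<psi> v (f m))"
proof -
  have add: "\<psi> (u + v) w = \<psi> u w + \<psi> v w" "\<psi> u (v + w) = \<psi> u v + \<psi> u w"
    and scale: "\<psi> (a *s v) w = a * \<psi> v w" "\<psi> v (a *s w) = bar a * \<psi> v w" for u v w a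
    using \<psi> unfolding hermitian_or_antihermitian_def by blast+
  show "\<psi> (u + v) w = \<psi> u w + \<psi> v w" "\<psi> u (v + w) = \<psi> u v + \<psi> u w"
    "\<psi> (a *s v) w = a * \<psi> v w" "\<psi> v (a *s w) = bar a * \<psi> v w"
    by (rule add scale)+
  show zero: "\<psi> 0 w = 0" "\<psi> v 0 = 0" for v w
    using scale(1)[of 0 0 w] scale(2)[of v 0 0] field_involution_simps(4)[OF bar] by simp_all
  show "\<psi> (\<Sum>m\<in>I. (-1) ^ m *s f m) w = (\<Sum>m\<in>I. (-1) ^ m * \<psi> (f m) w)"
    by (induction I rule: infinite_finite_induct) (simp_all add: zero add scale)
  \<comment> \<open>Signs are fixed by \<open>bar\<close>, so alternating sums leave the conjugated
    argument with the same signs as the linear one.\<close>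
  have "bar ((-1) ^ m) = (-1) ^ m" for m :: nat
    by (induction m) (simp_all add: field_involution_simps[OF bar])
  then show "\<psi> v (\<Sum>m\<in>I. (-1) ^ m *s f m) = (\<Sum>m\<in>I. (-1) ^ m * \<psi> v (f m))"
    by (induction I rule: infinite_finite_induct) (simp_all add: zero add scale)
qed

text \<open>The sum in \<open>eval_descended\<close>, separated from the choice of the chain, so
  that additivity in the chain and in the cochain can be stated.\<close>

definition chain_eval :: "(((nat \<Rightarrow> real) \<Rightarrow> 'b) \<Rightarrow> 'f::field) \<Rightarrow> 'b chain \<Rightarrow> 'f" where
  "chain_eval u w = (\<Sum>\<sigma>\<in>Poly_Mapping.keys w. of_int (Poly_Mapping.lookup w \<sigma>) * u \<sigma>)"

lemma chain_eval_superset: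
  assumes "finite I" "Poly_Mapping.keys w \<subseteq> I"
  shows "chain_eval u w = (\<Sum>\<sigma>\<in>I. of_int (Poly_Mapping.lookup w \<sigma>) * u \<sigma>)"
  unfolding chain_eval_def using assms by (intro sum.mono_neutral_left) (auto simp: in_keys_iff)

lemma chain_eval_simps:
  "chain_eval u 0 = 0" "chain_eval u (frag_of \<sigma>) = u \<sigma>"
  "chain_eval u (a + b) = chain_eval u a + chain_eval u b"
  "chain_eval u (a - b) = chain_eval u a - chain_eval u b"
  "chain_eval u (sum h I) = (\<Sum>i\<in>I. chain_eval u (h i))"
  "chain_eval u (frag_cmul m a) = of_int m * chain_eval u a"
proof -
  show zero: "chain_eval u 0 = 0" by (simp add: chain_eval_def)
  show "chain_eval u (frag_of \<sigma>) = u \<sigma>" by (simp add: chain_eval_def)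
  show add: "chain_eval u (a + b) = chain_eval u a + chain_eval u b" for a b
  proof -
    let ?I = "Poly_Mapping.keys a \<union> Poly_Mapping.keys b"
    have "chain_eval u c = (\<Sum>\<sigma>\<in>?I. of_int (Poly_Mapping.lookup c \<sigma>) * u \<sigma>)"
      if "Poly_Mapping.keys c \<subseteq> ?I" for c
      using that by (intro chain_eval_superset) simp_all
    from this[of a] this[of b] this[of "a + b"] show ?thesis
      using keys_add[of a b] by (simp add: lookup_add ring_distribs sum.distrib)
  qed
  show "chain_eval u (a - b) = chain_eval u a - chain_eval u b"
    using add[of "a - b" b] by simp
  show "chain_eval u (sum h I) = (\<Sum>i\<in>I. chain_eval u (h i))"
    by (induction I rule: infinite_finite_induct) (simp_all add: zero add)
  show "chain_eval u (frag_cmul m a) = of_int m * chain_eval u a"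
    by (subst (1 2) chain_eval_superset[of "Poly_Mapping.keys a"])
       (simp_all add: keys_cmul sum_distrib_left mult.assoc)
qed

lemma chain_eval_fun_simps:
  "chain_eval (\<lambda>\<sigma>. u \<sigma> + v \<sigma>) w = chain_eval u w + chain_eval v w"
  "chain_eval (\<lambda>\<sigma>. a * u \<sigma>) w = a * chain_eval u w"
  by (simp_all add: chain_eval_def ring_distribs sum.distrib sum_distrib_left mult.left_commute)

lemma chain_eval_cong:
  assumes "singular_chain k X w" "\<And>\<sigma>. singular_simplex k X \<sigma> \<Longrightarrow> u \<sigma> = v \<sigma>"
  shows "chain_eval u w = chain_eval v w"
  using assms unfolding chain_eval_def singular_chain_def by (intro sum.cong) auto

lemma chain_eval_chain_map: "chain_eval u (chain_map k p w) = chain_eval (\<lambda>\<sigma>. u (simplex_map k p \<sigma>)) w"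
  using subset_UNIV
  by (induction w rule: frag_induction) (simp_all add: chain_map_diff chain_eval_simps)

text \<open>Stokes' formula: the alternating sum on the right is the coboundary of \<open>v\<close>,
  written out for a function given on simplices.\<close>

lemma chain_eval_boundary:
  "chain_eval v (chain_boundary (Suc k) w) =
     chain_eval (\<lambda>\<sigma>. \<Sum>m\<le>Suc k. (-1) ^ m * v (singular_face (Suc k) m \<sigma>)) w"
  using subset_UNIV
  by (induction w rule: frag_induction)
     (simp_all add: chain_boundary_diff chain_boundary_of chain_eval_simps)

text \<open>An invariant cochain descends to \<open>M\<close>.\<close>
lemma chain_eval_eq_0_if_projection_eq_0:
  fixes E :: "'b::topological_space set" and M :: "'a::topological_space set"
  assumes uc: "universal_covering M x0 E p e0 act"
    and w: "singular_chain k (top_of_set E) w" "chain_map k p w = 0"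
    and v: "\<And>g \<sigma>. g \<in> carrier (fundamental_group M x0) \<Longrightarrow> singular_simplex k (top_of_set E) \<sigma> \<Longrightarrow>
              v (simplex_map k (act g) \<sigma>) = v \<sigma>"
  shows "chain_eval v w = 0"
proof -
  define v' where "v' = (\<lambda>\<tau>. v (SOME \<sigma>. singular_simplex k (top_of_set E) \<sigma> \<and> simplex_map k p \<sigma> = \<tau>))"
  have "v \<sigma> = v' (simplex_map k p \<sigma>)" if \<sigma>: "singular_simplex k (top_of_set E) \<sigma>" for \<sigma>
  proof -
    define \<sigma>' where "\<sigma>' = (SOME \<sigma>'. singular_simplex k (top_of_set E) \<sigma>' \<and> simplex_map k p \<sigma>' = simplex_map k p \<sigma>)"
    have "singular_simplex k (top_of_set E) \<sigma>' \<and> simplex_map k p \<sigma>' = simplex_map k p \<sigma>"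
      unfolding \<sigma>'_def by (rule someI[of _ \<sigma>]) (use \<sigma> in simp)
    then obtain g where "g \<in> carrier (fundamental_group M x0)" "\<sigma>' = simplex_map k (act g) \<sigma>"
      using lifted_simplices_differ_by_deck_transformation[OF uc \<sigma>, of \<sigma>'] by metis
    then have "v \<sigma>' = v \<sigma>" using v \<sigma> by simp
    then show ?thesis by (simp add: v'_def \<sigma>'_def)
  qed
  then have "chain_eval v w = chain_eval (\<lambda>\<sigma>. v' (simplex_map k p \<sigma>)) w"
    by (intro chain_eval_cong[OF w(1)])
  also have "\<dots> = chain_eval v' (chain_map k p w)" by (rule chain_eval_chain_map[symmetric])
  finally show ?thesis using w(2) by (simp add: chain_eval_simps)
qed

text \<open>The boundary of \<open>w\<close> may be nonzero in the covering space; what vanishes is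
  its projection, and an invariant function depends on a chain only through the projection.\<close>

lemma chain_eval_coboundary_eq_0:
  fixes E :: "'b::topological_space set" and M :: "'a::topological_space set"
  assumes uc: "universal_covering M x0 E p e0 act"
    and w: "singular_chain (Suc k) (top_of_set E) w" "chain_boundary (Suc k) (chain_map (Suc k) p w) = 0"
    and v: "\<And>g \<sigma>. g \<in> carrier (fundamental_group M x0) \<Longrightarrow> singular_simplex k (top_of_set E) \<sigma> \<Longrightarrow>
              v (simplex_map k (act g) \<sigma>) = v \<sigma>"
  shows "chain_eval (\<lambda>\<sigma>. \<Sum>m\<le>Suc k. (-1) ^ m * v (singular_face (Suc k) m \<sigma>)) w = 0"
proof -
  have "chain_map k p (chain_boundary (Suc k) w) = 0"
    using chain_boundary_chain_map[OF w(1), of p] w(2) by simp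
  from chain_eval_eq_0_if_projection_eq_0[OF uc singular_chain_boundary_alt[OF w(1)] this v]
  show ?thesis by (simp add: chain_eval_boundary)
qed

text \<open>The affine inclusion of the standard \<open>j\<close>-simplex into the standard
  \<open>(i + j)\<close>-simplex as the face spanned by the last \<open>j + 1\<close>
  vertices.\<close>

definition shift_coords :: "nat \<Rightarrow> (nat \<Rightarrow> real) \<Rightarrow> nat \<Rightarrow> real" where
  "shift_coords i x = (\<lambda>l. if l < i then 0 else x (l - i))"

lemma shift_coords_in_standard_simplex:
  assumes "x \<in> standard_simplex j"
  shows "shift_coords i x \<in> standard_simplex (i + j)"
proof -
  have "(\<Sum>l\<le>i + j. shift_coords i x l) = (\<Sum>l\<in>{i..i + j}. shift_coords i x l)"
    by (intro sum.mono_neutral_right) (auto simp: shift_coords_def)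
  also have "\<dots> = (\<Sum>l\<le>j. x l)"
    by (intro sum.reindex_bij_witness[of _ "\<lambda>l. l + i" "\<lambda>l. l - i"]) (auto simp: shift_coords_def)
  finally show ?thesis
    using assms by (auto simp: standard_simplex_def shift_coords_def)
qed

lemma back_face_shift_coords:
  "back_face i j \<sigma> = restrict (\<lambda>x. \<sigma> (shift_coords i x)) (standard_simplex j)"
  by (simp add: back_face_def shift_coords_def)

lemma singular_simplex_front_face:
  assumes "singular_simplex (i + j) (top_of_set E) \<sigma>"
  shows "singular_simplex i (top_of_set E) (front_face i \<sigma>)"
proof -
  have sub: "standard_simplex i \<subseteq> standard_simplex (i + j)" by (rule standard_simplex_mono) simp
  note \<sigma> = assms[unfolded singular_simplex_top_of_set]
  have "continuous_on (standard_simplex i) (front_face i \<sigma>)"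
    by (rule continuous_on_eq[OF continuous_on_subset[OF _ sub]]) (use \<sigma> in \<open>auto simp: front_face_def\<close>)
  moreover have "front_face i \<sigma> ` standard_simplex i \<subseteq> E"
    using \<sigma> sub by (auto simp: front_face_def)
  ultimately show ?thesis
    unfolding singular_simplex_top_of_set by (simp add: front_face_def)
qed

lemma singular_simplex_back_face:
  assumes "singular_simplex (i + j) (top_of_set E) \<sigma>"
  shows "singular_simplex j (top_of_set E) (back_face i j \<sigma>)"
proof -
  note \<sigma> = assms[unfolded singular_simplex_top_of_set]
  have shift: "shift_coords i ` standard_simplex j \<subseteq> standard_simplex (i + j)"
    using shift_coords_in_standard_simplex by blast
  have "continuous_on (standard_simplex j) (\<lambda>x. shift_coords i x l)" for l
    by (cases "l < i") (auto simp: shift_coords_def intro: continuous_on_subset[OF continuous_on_product_coordinates])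
  then have "continuous_on (standard_simplex j) (shift_coords i)"
    by (intro continuous_on_coordinatewise_then_product)
  then have "continuous_on (standard_simplex j) (\<sigma> \<circ> shift_coords i)"
    using \<sigma> by (intro continuous_on_compose continuous_on_subset[OF _ shift]) simp_all
  then have "continuous_on (standard_simplex j) (back_face i j \<sigma>)"
    by (rule continuous_on_eq) (simp add: back_face_shift_coords)
  moreover have "back_face i j \<sigma> ` standard_simplex j \<subseteq> E"
    using \<sigma> shift by (auto simp: back_face_shift_coords)
  ultimately show ?thesis
    unfolding singular_simplex_top_of_set by (simp add: back_face_shift_coords)
qed

lemma front_face_simplex_map:
  "front_face i (simplex_map (i + j) g \<sigma>) = simplex_map i g (front_face i \<sigma>)"
  using standard_simplex_mono[of i "i + j"]
  by (auto simp: front_face_def simplex_map_def fun_eq_iff)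

lemma back_face_simplex_map:
  "back_face i j (simplex_map (i + j) g \<sigma>) = simplex_map j g (back_face i j \<sigma>)"
  by (auto simp: back_face_shift_coords simplex_map_def fun_eq_iff shift_coords_in_standard_simplex)

text \<open>Passing to face \<open>m\<close> deletes vertex \<open>m\<close>. If
  \<open>m \<le> i\<close>, the first \<open>i + 1\<close> remaining vertices are 0, ...,
  \<open>i + 1\<close> without \<open>m\<close>; a later vertex is missed by the front face
  altogether.\<close>

lemma front_face_singular_face:
  assumes "m \<le> Suc (i + j)"
  shows "front_face i (singular_face (Suc (i + j)) m \<sigma>) =
    (if m \<le> i then singular_face (Suc i) m (front_face (Suc i) \<sigma>) else front_face i \<sigma>)"
proof
  fix x
  show "front_face i (singular_face (Suc (i + j)) m \<sigma>) x =
    (if m \<le> i then singular_face (Suc i) m (front_face (Suc i) \<sigma>) else front_face i \<sigma>) x"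
  proof (cases "x \<in> standard_simplex i")
    case x: True
    have "x \<in> standard_simplex (i + j)" using x standard_simplex_mono[of i "i + j"] by auto
    moreover have "simplical_face m x \<in> standard_simplex (Suc i)" if "m \<le> i"
      using simplical_face_in_standard_simplex[of "Suc i" m x] that x by simp
    moreover have "simplical_face m x = x" if "\<not> m \<le> i"
      using x that by (auto simp: simplical_face_def standard_simplex_def fun_eq_iff)
    ultimately show ?thesis
      using x by (simp add: front_face_def singular_face_def)
  qed (simp add: front_face_def singular_face_def)
qed

lemma front_face_last_face: "singular_face (Suc i) (Suc i) (front_face (Suc i) \<sigma>) = front_face i \<sigma>"
proof
  fix x
  show "singular_face (Suc i) (Suc i) (front_face (Suc i) \<sigma>) x = front_face i \<sigma> x"
  proof (cases "x \<in> standard_simplex i")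
    case x: True
    have "simplical_face (Suc i) x = x"
      using x by (auto simp: simplical_face_def standard_simplex_def fun_eq_iff)
    moreover have "x \<in> standard_simplex (Suc i)" using x standard_simplex_mono[of i "Suc i"] by auto
    ultimately show ?thesis
      using x by (simp add: front_face_def singular_face_def)
  qed (simp add: front_face_def singular_face_def)
qed

text \<open>If a vertex \<open>m \<le> i\<close> is deleted, the numbering shifts and the back face
  starts at vertex \<open>i + 1\<close> of \<open>\<sigma>\<close>. A later vertex belongs to the
  back part starting at vertex \<open>i\<close>, where it has number \<open>m - i\<close>.\<close>

lemma back_face_singular_face:
  assumes "m \<le> Suc (i + j)"
  shows "back_face i j (singular_face (Suc (i + j)) m \<sigma>) =
    (if m \<le> i then back_face (Suc i) j \<sigma> else singular_face (Suc j) (m - i) (back_face i (Suc j) \<sigma>))"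
proof
  fix x
  show "back_face i j (singular_face (Suc (i + j)) m \<sigma>) x =
    (if m \<le> i then back_face (Suc i) j \<sigma> else singular_face (Suc j) (m - i) (back_face i (Suc j) \<sigma>)) x"
  proof (cases "x \<in> standard_simplex j")
    case x: True
    have "simplical_face m (shift_coords i x) = shift_coords (Suc i) x" if "m \<le> i"
      using that by (auto simp: simplical_face_def shift_coords_def fun_eq_iff)
    moreover have "simplical_face m (shift_coords i x) = shift_coords i (simplical_face (m - i) x)" if "\<not> m \<le> i"
      using that by (auto simp: simplical_face_def shift_coords_def fun_eq_iff intro!: arg_cong[where f = x])
    moreover have "simplical_face (m - i) x \<in> standard_simplex (Suc j)" if "\<not> m \<le> i"
      using simplical_face_in_standard_simplex[of "Suc j" "m - i" x] that x assms by simp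
    ultimately show ?thesis
      using x shift_coords_in_standard_simplex[OF x, of i]
      by (simp add: back_face_shift_coords singular_face_def)
  qed (simp add: back_face_shift_coords singular_face_def)
qed

lemma back_face_first_face: "singular_face (Suc j) 0 (back_face i (Suc j) \<sigma>) = back_face (Suc i) j \<sigma>"
proof
  fix x
  show "singular_face (Suc j) 0 (back_face i (Suc j) \<sigma>) x = back_face (Suc i) j \<sigma> x"
  proof (cases "x \<in> standard_simplex j")
    case x: True
    have "shift_coords i (simplical_face 0 x) = shift_coords (Suc i) x"
      by (auto simp: simplical_face_def shift_coords_def fun_eq_iff)
    moreover have "simplical_face 0 x \<in> standard_simplex (Suc j)"
      using simplical_face_in_standard_simplex[of "Suc j" 0 x] x by simp
    ultimately show ?thesis
      using x by (simp add: back_face_shift_coords singular_face_def)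
  qed (simp add: back_face_shift_coords singular_face_def)
qed

section \<open>Singular twisted cochains and the Leibniz rule\<close>

lemma singular_cochains_iff:
  "f \<in> cochains (singular_complex E act) \<pi> \<rho> k \<longleftrightarrow>
     (\<forall>x y. singular_chain k (top_of_set E) x \<longrightarrow> singular_chain k (top_of_set E) y \<longrightarrow> f (x + y) = f x + f y) \<and>
     (\<forall>g\<in>carrier \<pi>. \<forall>x. singular_chain k (top_of_set E) x \<longrightarrow> f (chain_map k (act g) x) = \<rho> g *v f x) \<and>
     (\<forall>x. \<not> singular_chain k (top_of_set E) x \<longrightarrow> f x = 0)"
  by (simp add: cochains_def singular_complex_def)

lemma singular_coboundary_apply:
  "coboundary (singular_complex E act) k f x =
     (if singular_chain (Suc k) (top_of_set E) x then f (chain_boundary (Suc k) x) else 0)"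
  by (simp add: coboundary_def singular_complex_def)

text \<open>A cochain is additive on singular chains and set to zero elsewhere, whence the side
  conditions on the arguments.\<close>

lemma singular_cochain_simps:
  assumes f: "f \<in> cochains (singular_complex E act) \<pi> \<rho> k"
  shows "f 0 = 0"
    "singular_chain k (top_of_set E) x \<Longrightarrow> f (frag_cmul ((-1) ^ m) x) = (-1) ^ m *s f x"
    "(\<And>i. i \<in> I \<Longrightarrow> singular_chain k (top_of_set E) (h i)) \<Longrightarrow> f (sum h I) = (\<Sum>i\<in>I. f (h i))"
proof -
  have add: "f (x + y) = f x + f y"
    if "singular_chain k (top_of_set E) x" "singular_chain k (top_of_set E) y" for x y
    using f that by (simp add: singular_cochains_iff)
  show zero: "f 0 = 0" using add[of 0 0] by simp
  have "f (- x) = - f x" if "singular_chain k (top_of_set E) x" for x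
    using add[of x "- x"] that zero
    by (simp add: singular_chain_minus eq_neg_iff_add_eq_0 add.commute)
  then show "f (frag_cmul ((-1) ^ m) x) = (-1) ^ m *s f x" if "singular_chain k (top_of_set E) x"
    using that by (cases "even m") (simp_all add: vector_sneg_minus1[symmetric])
  show "f (sum h I) = (\<Sum>i\<in>I. f (h i))" if "\<And>i. i \<in> I \<Longrightarrow> singular_chain k (top_of_set E) (h i)"
    using that by (induction I rule: infinite_finite_induct) (simp_all add: zero add singular_chain_sum)
qed

lemma singular_coboundary_simplex:
  assumes f: "f \<in> cochains (singular_complex E act) \<pi> \<rho> k"
    and \<sigma>: "singular_simplex (Suc k) (top_of_set E) \<sigma>"
  shows "coboundary (singular_complex E act) k f (frag_of \<sigma>) =
     (\<Sum>m\<le>Suc k. (-1) ^ m *s f (frag_of (singular_face (Suc k) m \<sigma>)))"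
proof -
  have face: "singular_chain k (top_of_set E) (frag_of (singular_face (Suc k) m \<sigma>))" if "m \<le> Suc k" for m
    using singular_simplex_singular_face[OF \<sigma> _ that] by (simp add: singular_chain_of)
  have "f (chain_boundary (Suc k) (frag_of \<sigma>)) =
      (\<Sum>m\<le>Suc k. f (frag_cmul ((-1) ^ m) (frag_of (singular_face (Suc k) m \<sigma>))))"
    unfolding chain_boundary_of by (simp only: nat.simps if_False)
      (rule singular_cochain_simps(3)[OF f], rule singular_chain_cmul, rule face, simp)
  also have "\<dots> = (\<Sum>m\<le>Suc k. (-1) ^ m *s f (frag_of (singular_face (Suc k) m \<sigma>)))"
    by (intro sum.cong refl singular_cochain_simps(2)[OF f] face) simp
  finally show ?thesis using \<sigma> by (simp add: singular_coboundary_apply singular_chain_of)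
qed

lemma sum_atMost_Suc_add_split:
  fixes h :: "nat \<Rightarrow> 'a::comm_monoid_add"
  shows "(\<Sum>m\<le>Suc (i + j). h m) = (\<Sum>m\<le>i. h m) + (\<Sum>n\<le>j. h (Suc (i + n)))"
  by (induction j) (simp_all add: add.assoc)

text \<open>
  The faces \<open>m \<le> i\<close> and \<open>m > i\<close> make up the two terms on the right, apart from the last face of
  the front and the first face of the back simplex, whose contributions cancel.
\<close>
lemma cup_form_Leibniz:
  fixes \<psi> :: "'f::field^'n \<Rightarrow> 'f^'n \<Rightarrow> 'f"
  assumes bar: "field_involution bar" and \<psi>: "hermitian_or_antihermitian bar \<psi>"
    and f: "f \<in> cochains (singular_complex E act) \<pi> \<rho> i"
    and f': "f' \<in> cochains (singular_complex E act) \<pi> \<rho> j"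
    and \<sigma>: "singular_simplex (Suc (i + j)) (top_of_set E) \<sigma>"
  shows "(\<Sum>m\<le>Suc (i + j). (-1) ^ m * cup_form \<psi> i j f f' (singular_face (Suc (i + j)) m \<sigma>)) =
     cup_form \<psi> (Suc i) j (coboundary (singular_complex E act) i f) f' \<sigma> +
     (-1) ^ i * cup_form \<psi> i (Suc j) f (coboundary (singular_complex E act) j f') \<sigma>"
proof -
  note \<psi> = sesquilinear_form_simps[OF bar \<psi>]
  define a where "a m = f (frag_of (singular_face (Suc i) m (front_face (Suc i) \<sigma>)))" for m
  define b where "b n = f' (frag_of (singular_face (Suc j) n (back_face i (Suc j) \<sigma>)))" for n
  define A where "A = f (frag_of (front_face i \<sigma>))"
  define B where "B = f' (frag_of (back_face (Suc i) j \<sigma>))"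
  have "singular_simplex (Suc i) (top_of_set E) (front_face (Suc i) \<sigma>)"
    using singular_simplex_front_face[of "Suc i" j] \<sigma> by simp
  from singular_coboundary_simplex[OF f this]
  have da: "coboundary (singular_complex E act) i f (frag_of (front_face (Suc i) \<sigma>)) =
      (\<Sum>m\<le>Suc i. (-1) ^ m *s a m)" by (simp only: a_def)
  have "singular_simplex (Suc j) (top_of_set E) (back_face i (Suc j) \<sigma>)"
    using singular_simplex_back_face[of i "Suc j"] \<sigma> by simp
  from singular_coboundary_simplex[OF f' this]
  have db: "coboundary (singular_complex E act) j f' (frag_of (back_face i (Suc j) \<sigma>)) =
      (\<Sum>m\<le>Suc j. (-1) ^ m *s b m)" by (simp only: b_def)
  have last: "a (Suc i) = A" "b 0 = B"
    by (simp_all add: a_def A_def b_def B_def front_face_last_face back_face_first_face)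
  have front_part: "cup_form \<psi> i j f f' (singular_face (Suc (i + j)) m \<sigma>) = \<psi> (a m) B" if "m \<le> i" for m
    using that by (simp add: cup_form_def a_def B_def front_face_singular_face back_face_singular_face)
  have back_part: "cup_form \<psi> i j f f' (singular_face (Suc (i + j)) (Suc (i + n)) \<sigma>) = \<psi> A (b (Suc n))"
    if "n \<le> j" for n
    using that by (simp add: cup_form_def b_def A_def front_face_singular_face back_face_singular_face Suc_diff_le)
  have "(\<Sum>m\<le>Suc (i + j). (-1) ^ m * cup_form \<psi> i j f f' (singular_face (Suc (i + j)) m \<sigma>)) =
      (\<Sum>m\<le>i. (-1) ^ m * \<psi> (a m) B) + (\<Sum>n\<le>j. (-1) ^ Suc (i + n) * \<psi> A (b (Suc n)))"
    unfolding sum_atMost_Suc_add_split by (intro arg_cong2[of _ _ _ _ "(+)"] sum.cong refl) (simp_all only: front_part back_part atMost_iff)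
  also have "(\<Sum>n\<le>j. (-1) ^ Suc (i + n) * \<psi> A (b (Suc n))) = (-1) ^ i * (\<Sum>n\<le>j. (-1) ^ Suc n * \<psi> A (b (Suc n)))"
    by (simp add: sum_distrib_left power_add mult.assoc sum_negf)
  \<comment> \<open>The missing last face of the front simplex enters with sign
    \<open>(-1) ^ Suc i\<close> and is compensated. The next step completes the other sum by its
    missing first face; the two compensations cancel in the end.\<close>
  also have "(\<Sum>m\<le>i. (-1) ^ m * \<psi> (a m) B) = (\<Sum>m\<le>Suc i. (-1) ^ m * \<psi> (a m) B) + (-1) ^ i * \<psi> A B"
    by (simp add: last)
  also have "(\<Sum>n\<le>j. (-1) ^ Suc n * \<psi> A (b (Suc n))) = (\<Sum>n\<le>Suc j. (-1) ^ n * \<psi> A (b n)) - \<psi> A B"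
    unfolding sum.atMost_Suc_shift by (simp add: last)
  also have "(\<Sum>m\<le>Suc i. (-1) ^ m * \<psi> (a m) B) = cup_form \<psi> (Suc i) j (coboundary (singular_complex E act) i f) f' \<sigma>"
    unfolding cup_form_def da \<psi> B_def ..
  also have "(\<Sum>n\<le>Suc j. (-1) ^ n * \<psi> A (b n)) = cup_form \<psi> i (Suc j) f (coboundary (singular_complex E act) j f') \<sigma>"
    unfolding cup_form_def db \<psi> A_def ..
  finally show ?thesis by (simp add: algebra_simps)
qed

lemma cup_form_deck_invariant:
  assumes inv: "\<forall>g\<in>carrier \<pi>. \<forall>v w. \<psi> (\<rho> g *v v) (\<rho> g *v w) = \<psi> v w"
    and f: "f \<in> cochains (singular_complex E act) \<pi> \<rho> i"
    and f': "f' \<in> cochains (singular_complex E act) \<pi> \<rho> j"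
    and g: "g \<in> carrier \<pi>" and \<sigma>: "singular_simplex (i + j) (top_of_set E) \<sigma>"
  shows "cup_form \<psi> i j f f' (simplex_map (i + j) (act g) \<sigma>) = cup_form \<psi> i j f f' \<sigma>"
proof -
  have "f (frag_of (simplex_map i (act g) (front_face i \<sigma>))) = \<rho> g *v f (frag_of (front_face i \<sigma>))"
    using f g singular_simplex_front_face[OF \<sigma>] unfolding singular_cochains_iff chain_map_of[symmetric]
    by (simp add: singular_chain_of del: chain_map_of)
  moreover have "f' (frag_of (simplex_map j (act g) (back_face i j \<sigma>))) = \<rho> g *v f' (frag_of (back_face i j \<sigma>))"
    using f' g singular_simplex_back_face[OF \<sigma>] unfolding singular_cochains_iff chain_map_of[symmetric]
    by (simp add: singular_chain_of del: chain_map_of)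
  ultimately show ?thesis
    using inv g by (simp add: cup_form_def front_face_simplex_map back_face_simplex_map)
qed

lemma coc_iff: "f \<in> coc C \<delta> i \<longleftrightarrow> f \<in> C i \<and> \<delta> i f = 0"
  by (simp add: coc_def)

text \<open>If one factor is the coboundary of \<open>a\<close> and the other is a cocycle, one term
  of the Leibniz rule drops out. The cup form is then, up to sign, the coboundary of the invariant
  form built from \<open>a\<close>, and this vanishes on \<open>w\<close>. In degree 0 the only
  coboundary is zero.\<close>

lemma cup_form_coboundary_eval:
  fixes \<psi> :: "'f::field^'n \<Rightarrow> 'f^'n \<Rightarrow> 'f"
    and E :: "'b::topological_space set" and M :: "'a::topological_space set"
  assumes uc: "universal_covering M x0 E p e0 act" and \<pi>: "\<pi> = fundamental_group M x0"
    and bar: "field_involution bar" and \<psi>: "hermitian_or_antihermitian bar \<psi>"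
    and inv: "\<forall>g\<in>carrier \<pi>. \<forall>v w. \<psi> (\<rho> g *v v) (\<rho> g *v w) = \<psi> v w"
    and w: "singular_chain (i + j) (top_of_set E) w" "chain_boundary (i + j) (chain_map (i + j) p w) = 0"
    and f: "f \<in> coc (cochains (singular_complex E act) \<pi> \<rho>) (coboundary (singular_complex E act)) i"
    and f': "f' \<in> coc (cochains (singular_complex E act) \<pi> \<rho>) (coboundary (singular_complex E act)) j"
  shows "f \<in> twisted_coboundaries (singular_complex E act) \<pi> \<rho> i \<Longrightarrow> chain_eval (cup_form \<psi> i j f f') w = 0"
    and "f' \<in> twisted_coboundaries (singular_complex E act) \<pi> \<rho> j \<Longrightarrow> chain_eval (cup_form \<psi> i j f f') w = 0"
proof -
  note \<psi>s = sesquilinear_form_simps[OF bar \<psi>]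
  have zero: "chain_eval (\<lambda>_. 0) w = 0" by (simp add: chain_eval_def)
  note f = f[unfolded coc_iff] and f' = f'[unfolded coc_iff]
  show "chain_eval (cup_form \<psi> i j f f') w = 0"
    if cob: "f \<in> twisted_coboundaries (singular_complex E act) \<pi> \<rho> i"
  proof (cases i)
    case 0
    then have "cup_form \<psi> i j f f' = (\<lambda>_. 0)" using cob \<psi>s by (auto simp: cob_def cup_form_def)
    then show ?thesis using zero by simp
  next
    case (Suc i')
    then obtain a where a: "a \<in> cochains (singular_complex E act) \<pi> \<rho> i'" "f = coboundary (singular_complex E act) i' a"
      using cob by (auto simp: cob_def)
    have "chain_eval (\<lambda>\<sigma>. \<Sum>m\<le>Suc (i' + j). (-1) ^ m * cup_form \<psi> i' j a f' (singular_face (Suc (i' + j)) m \<sigma>)) w = 0"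
      by (rule chain_eval_coboundary_eq_0[OF uc])
         (use w Suc cup_form_deck_invariant[OF inv a(1)] f' \<pi> in simp_all)
    moreover have "(\<Sum>m\<le>Suc (i' + j). (-1) ^ m * cup_form \<psi> i' j a f' (singular_face (Suc (i' + j)) m \<sigma>)) =
        cup_form \<psi> i j f f' \<sigma>" if "singular_simplex (i + j) (top_of_set E) \<sigma>" for \<sigma>
      unfolding a(2) Suc using that f' Suc
      by (subst cup_form_Leibniz[OF bar \<psi> a(1)]) (auto simp: cup_form_def \<psi>s)
    then have "chain_eval (\<lambda>\<sigma>. \<Sum>m\<le>Suc (i' + j). (-1) ^ m * cup_form \<psi> i' j a f' (singular_face (Suc (i' + j)) m \<sigma>)) w =
        chain_eval (cup_form \<psi> i j f f') w"
      by (rule chain_eval_cong[OF w(1)])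
    ultimately show ?thesis by simp
  qed
  show "chain_eval (cup_form \<psi> i j f f') w = 0"
    if cob: "f' \<in> twisted_coboundaries (singular_complex E act) \<pi> \<rho> j"
  proof (cases j)
    case 0
    then have "cup_form \<psi> i j f f' = (\<lambda>_. 0)" using cob \<psi>s by (auto simp: cob_def cup_form_def)
    then show ?thesis using zero by simp
  next
    case (Suc j')
    then obtain a where a: "a \<in> cochains (singular_complex E act) \<pi> \<rho> j'" "f' = coboundary (singular_complex E act) j' a"
      using cob by (auto simp: cob_def)
    have "chain_eval (\<lambda>\<sigma>. \<Sum>m\<le>Suc (i + j'). (-1) ^ m * cup_form \<psi> i j' f a (singular_face (Suc (i + j')) m \<sigma>)) w = 0"
      by (rule chain_eval_coboundary_eq_0[OF uc])
         (use w Suc cup_form_deck_invariant[OF inv _ a(1)] f \<pi> in simp_all)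
    moreover have "(\<Sum>m\<le>Suc (i + j'). (-1) ^ m * cup_form \<psi> i j' f a (singular_face (Suc (i + j')) m \<sigma>)) =
        (-1) ^ i * cup_form \<psi> i j f f' \<sigma>" if "singular_simplex (i + j) (top_of_set E) \<sigma>" for \<sigma>
      unfolding a(2) Suc using that f Suc
      by (subst cup_form_Leibniz[OF bar \<psi> _ a(1)]) (auto simp: cup_form_def \<psi>s)
    then have "chain_eval (\<lambda>\<sigma>. \<Sum>m\<le>Suc (i + j'). (-1) ^ m * cup_form \<psi> i j' f a (singular_face (Suc (i + j')) m \<sigma>)) w =
        chain_eval (\<lambda>\<sigma>. (-1) ^ i * cup_form \<psi> i j f f' \<sigma>) w"
      by (rule chain_eval_cong[OF w(1)])
    ultimately show ?thesis by (simp add: chain_eval_fun_simps)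
  qed
qed

section \<open>Linear structure of twisted cochains and the pairing on classes\<close>

lemma fscale_simps:
  "fscale a (f + g) = fscale a f + fscale a g" "fscale (a + b) f = fscale a f + fscale b f"
  "fscale a (fscale b f) = fscale (a * b) f" "fscale 1 f = f"
  by (simp_all add: fscale_def fun_eq_iff vector_add_ldistrib vector_sadd_rdistrib vector_smult_assoc)

lemma vector_space_fscale: "vector_space (fscale :: 'f::field \<Rightarrow> ('c \<Rightarrow> 'f^'n) \<Rightarrow> 'c \<Rightarrow> 'f^'n)"
  by unfold_locales (simp_all add: fscale_simps)

lemma cochains_subspace:
  fixes K :: "('g, 'c) eqv_complex" and \<rho> :: "'g \<Rightarrow> 'f::field^'n^'n"
  shows "module.subspace fscale (cochains K \<pi> \<rho> k)"
proof -
  interpret vector_space "fscale :: 'f::field \<Rightarrow> ('c \<Rightarrow> 'f^'n) \<Rightarrow> 'c \<Rightarrow> 'f^'n" by (rule vector_space_fscale)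
  show ?thesis
    unfolding subspace_def cochains_def
    by (auto simp: fscale_def matrix_vector_right_distrib vector_add_ldistrib vector_scalar_commute)
qed

lemma coboundary_linear:
  "coboundary K k (f + g) = coboundary K k f + coboundary K k g"
  "coboundary K k (fscale a f) = fscale a (coboundary K k f)"
  "coboundary K k 0 = 0"
  by (auto simp: coboundary_def fscale_def fun_eq_iff)

lemma coc_cob_subspace:
  fixes K :: "('g, 'c) eqv_complex" and \<rho> :: "'g \<Rightarrow> 'f::field^'n^'n"
  shows "module.subspace fscale (coc (cochains K \<pi> \<rho>) (coboundary K) k)"
    "module.subspace fscale (twisted_coboundaries K \<pi> \<rho> k)"
proof -
  interpret vector_space "fscale :: 'f \<Rightarrow> ('c \<Rightarrow> 'f^'n) \<Rightarrow> 'c \<Rightarrow> 'f^'n" by (rule vector_space_fscale)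
  note C = cochains_subspace[of K \<pi> \<rho>]
  show "subspace (coc (cochains K \<pi> \<rho>) (coboundary K) k)"
    using subspace_0[OF C] subspace_add[OF C] subspace_scale[OF C]
    by (intro subspaceI) (simp_all add: coc_iff coboundary_linear)
  show "subspace (twisted_coboundaries K \<pi> \<rho> k)"
  proof (cases k)
    case 0
    then show ?thesis by (simp add: cob_def subspace_0)
  next
    case (Suc k')
    show ?thesis
      unfolding subspace_def cob_def Suc nat.case
    proof (intro conjI ballI allI)
      show "0 \<in> coboundary K k' ` cochains K \<pi> \<rho> k'"
        using subspace_0[OF C] coboundary_linear(3)[of K k'] by (metis image_eqI)
      fix x y c assume x: "x \<in> coboundary K k' ` cochains K \<pi> \<rho> k'"
      then show "fscale c x \<in> coboundary K k' ` cochains K \<pi> \<rho> k'"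
        using subspace_scale[OF C] by (auto simp: coboundary_linear(2)[symmetric])
      assume "y \<in> coboundary K k' ` cochains K \<pi> \<rho> k'"
      with x show "x + y \<in> coboundary K k' ` cochains K \<pi> \<rho> k'"
        using subspace_add[OF C] by (auto simp: coboundary_linear(1)[symmetric])
    qed
  qed
qed

lemma zero_in_twisted_coboundaries:
  fixes K :: "('g, 'c) eqv_complex" and \<rho> :: "'g \<Rightarrow> 'f::field^'n^'n"
  shows "0 \<in> twisted_coboundaries K \<pi> \<rho> k"
proof -
  interpret vector_space "fscale :: 'f \<Rightarrow> ('c \<Rightarrow> 'f^'n) \<Rightarrow> 'c \<Rightarrow> 'f^'n" by (rule vector_space_fscale)
  show ?thesis by (rule subspace_0[OF coc_cob_subspace(2)])
qed

lemma singular_coboundary_closed: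
  assumes act: "\<And>g. g \<in> carrier \<pi> \<Longrightarrow> continuous_on E (act g) \<and> act g ` E \<subseteq> E"
    and f: "f \<in> cochains (singular_complex E act) \<pi> \<rho> k"
  shows "coboundary (singular_complex E act) k f \<in> cochains (singular_complex E act) \<pi> \<rho> (Suc k)"
    "coboundary (singular_complex E act) (Suc k) (coboundary (singular_complex E act) k f) = 0"
proof -
  have map: "singular_chain (Suc k) (top_of_set E) (chain_map (Suc k) (act g) x)"
    if "g \<in> carrier \<pi>" "singular_chain (Suc k) (top_of_set E) x" for g x
    using that act[of g] by (intro singular_chain_chain_map[OF that(2)]) (auto simp: continuous_map_subtopology_eu)
  note f = f[unfolded singular_cochains_iff]
  show "coboundary (singular_complex E act) k f \<in> cochains (singular_complex E act) \<pi> \<rho> (Suc k)"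
    unfolding singular_cochains_iff singular_coboundary_apply
    using f map
    by (simp add: singular_chain_add chain_boundary_add singular_chain_boundary_alt chain_boundary_chain_map)
  have "f 0 = 0" using f singular_chain_0 by (metis add_cancel_right_right add_0)
  then show "coboundary (singular_complex E act) (Suc k) (coboundary (singular_complex E act) k f) = 0"
    unfolding fun_eq_iff singular_coboundary_apply
    by (simp add: singular_chain_boundary_alt chain_boundary_boundary_alt)
qed

lemma coset_mod_self:
  assumes "0 \<in> B" shows "v \<in> coset_mod B v"
  using assms by (auto simp: coset_mod_def intro!: image_eqI[of _ _ 0])

text \<open>
  By the Leibniz rule the pairing does not depend on the cocycles chosen by \<open>SOME\<close> in the definition;
  since \<open>eval_descended\<close> uses a single chain \<open>w\<close>, it is then sesquilinear.
\<close>
lemma cup_pairing_on_cocycles: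
  fixes \<psi> :: "'f::field^'n \<Rightarrow> 'f^'n \<Rightarrow> 'f"
    and E :: "'b::topological_space set" and M :: "'a::topological_space set"
    and c :: "'a chain set" and i j :: nat
  assumes uc: "universal_covering M x0 E p e0 act" and \<pi>: "\<pi> = fundamental_group M x0"
    and bar: "field_involution bar" and \<psi>: "hermitian_or_antihermitian bar \<psi>"
    and inv: "\<forall>g\<in>carrier \<pi>. \<forall>v w. \<psi> (\<rho> g *v v) (\<rho> g *v w) = \<psi> v w"
    and c: "c \<in> carrier (homology_group (int (i + j)) (top_of_set M))"
  defines "K \<equiv> singular_complex E act"
  obtains P where
    "\<And>v u. v \<in> coc (cochains K \<pi> \<rho>) (coboundary K) i \<Longrightarrow> u \<in> coc (cochains K \<pi> \<rho>) (coboundary K) j \<Longrightarrow>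
       cup_pairing E p \<psi> i j c (coset_mod (twisted_coboundaries K \<pi> \<rho> i) v)
         (coset_mod (twisted_coboundaries K \<pi> \<rho> j) u) = P v u"
    "\<And>v v' u. P (v + v') u = P v u + P v' u" "\<And>v u u'. P v (u + u') = P v u + P v u'"
    "\<And>a v u. P (fscale a v) u = a * P v u" "\<And>a v u. P v (fscale a u) = bar a * P v u"
    "\<And>v u. v \<in> twisted_coboundaries K \<pi> \<rho> i \<Longrightarrow> u \<in> coc (cochains K \<pi> \<rho>) (coboundary K) j \<Longrightarrow> P v u = 0"
    "\<And>v u. v \<in> coc (cochains K \<pi> \<rho>) (coboundary K) i \<Longrightarrow> u \<in> twisted_coboundaries K \<pi> \<rho> j \<Longrightarrow> P v u = 0"
proof -
  interpret vector_space "fscale :: 'f \<Rightarrow> ('b chain \<Rightarrow> 'f^'n) \<Rightarrow> 'b chain \<Rightarrow> 'f^'n" by (rule vector_space_fscale)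
  have cov: "covering_space E p M" using uc by (simp add: universal_covering_def)
  define w where "w = (SOME w. singular_chain (i + j) (top_of_set E) w \<and> chain_map (i + j) p w \<in> c)"
  have "singular_chain (i + j) (top_of_set E) w \<and> chain_map (i + j) p w \<in> c"
    unfolding w_def by (rule someI_ex) (use homology_class_lift[OF cov c] in blast)
  then have w: "singular_chain (i + j) (top_of_set E) w" "chain_boundary (i + j) (chain_map (i + j) p w) = 0"
    using homology_class_cycle[OF c] by blast+
  have act: "continuous_on E (act g) \<and> act g ` E \<subseteq> E" if "g \<in> carrier \<pi>" for g
    using universal_covering_deck_transformation[OF uc] that \<pi> by blast
  let ?Z = "coc (cochains K \<pi> \<rho>) (coboundary K)" and ?B = "twisted_coboundaries K \<pi> \<rho>"
  have sub: "subspace (cochains K \<pi> \<rho> k)" for k by (rule cochains_subspace)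
  have BZ: "f \<in> ?Z k" if fB: "f \<in> ?B k" for f k
  proof (cases k)
    case 0
    then show ?thesis using fB subspace_0[OF sub] coboundary_linear(3)[of K 0] by (simp add: cob_def coc_iff)
  next
    case (Suc k')
    then obtain a where "a \<in> cochains K \<pi> \<rho> k'" "f = coboundary K k' a" using fB by (auto simp: cob_def)
    then show ?thesis
      using Suc singular_coboundary_closed[where act = act and E = E and \<pi> = \<pi> and \<rho> = \<rho>, OF act] unfolding K_def by (simp add: coc_iff)
  qed
  have Z_add: "f + g \<in> ?Z k" if "f \<in> ?Z k" "g \<in> ?Z k" for f g k
    using that subspace_add[OF sub] by (simp add: coc_iff coboundary_linear)
  define P where "P = (\<lambda>v u. chain_eval (cup_form \<psi> i j v u) w)"
  note \<psi>s = sesquilinear_form_simps[OF bar \<psi>]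
  have addl: "P (v + v') u = P v u + P v' u" for v v' u
    unfolding P_def chain_eval_fun_simps[symmetric] by (simp add: cup_form_def[abs_def] \<psi>s)
  have addr: "P v (u + u') = P v u + P v u'" for v u u'
    unfolding P_def chain_eval_fun_simps[symmetric] by (simp add: cup_form_def[abs_def] \<psi>s)
  have scalel: "P (fscale a v) u = a * P v u" for a v u
    unfolding P_def chain_eval_fun_simps[symmetric] by (simp add: cup_form_def[abs_def] fscale_def \<psi>s)
  have scaler: "P v (fscale a u) = bar a * P v u" for a v u
    unfolding P_def chain_eval_fun_simps[symmetric] by (simp add: cup_form_def[abs_def] fscale_def \<psi>s)
  have zerol: "P v u = 0" if "v \<in> ?B i" "u \<in> ?Z j" for v u
    using cup_form_coboundary_eval(1)[OF uc \<pi> bar \<psi> inv w, of v u] BZ[OF that(1)] that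
    unfolding P_def K_def by blast
  have zeror: "P v u = 0" if "v \<in> ?Z i" "u \<in> ?B j" for v u
    using cup_form_coboundary_eval(2)[OF uc \<pi> bar \<psi> inv w, of v u] BZ[OF that(2)] that
    unfolding P_def K_def by blast
  have "cup_pairing E p \<psi> i j c (coset_mod (?B i) v) (coset_mod (?B j) u) = P v u"
    if v: "v \<in> ?Z i" and u: "u \<in> ?Z j" for v u
  proof -
    define v' where "v' = (SOME f. f \<in> coset_mod (?B i) v)"
    define u' where "u' = (SOME f. f \<in> coset_mod (?B j) u)"
    have "v' \<in> coset_mod (?B i) v" unfolding v'_def by (rule someI[of _ v]) (rule coset_mod_self[OF zero_in_twisted_coboundaries])
    moreover have "u' \<in> coset_mod (?B j) u" unfolding u'_def by (rule someI[of _ u]) (rule coset_mod_self[OF zero_in_twisted_coboundaries])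
    ultimately obtain b b' where b: "b \<in> ?B i" "v' = v + b" "b' \<in> ?B j" "u' = u + b'"
      by (auto simp: coset_mod_def)
    have "cup_pairing E p \<psi> i j c (coset_mod (?B i) v) (coset_mod (?B j) u) = P v' u'"
      unfolding cup_pairing_def eval_descended_def Let_def P_def chain_eval_def w_def v'_def u'_def ..
    also have "\<dots> = P v u + P v b' + P b (u + b')" unfolding b by (simp only: addl addr ac_simps)
    also have "P v b' = 0" using zeror v b by blast
    also have "P b (u + b') = 0" using zerol b Z_add[OF u BZ[OF b(3)]] by blast
    finally show ?thesis by simp
  qed
  then show ?thesis using that addl addr scalel scaler zerol zeror by blast
qed

section \<open>Change of basis\<close>

lemma mat_mult_index:
  assumes "A \<in> carrier_mat m n" "B \<in> carrier_mat n k" "i < m" "j < k"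
  shows "(A * B) $$ (i, j) = (\<Sum>l<n. A $$ (i, l) * B $$ (l, j))"
  using assms by (simp add: scalar_prod_def atLeast0LessThan)

text \<open>If \<open>n < m\<close>, zero columns for \<open>A\<close> and zero rows for
  \<open>B\<close> make both matrices square without changing their product. A one-sided inverse of
  a square matrix is two-sided, but the product in the other order has a zero row with index
  \<open>n\<close>.\<close>

lemma left_inverse_mat_dim:
  fixes A B :: "'f::field Matrix.mat"
  assumes A: "A \<in> carrier_mat m n" and B: "B \<in> carrier_mat n m" and AB: "A * B = 1\<^sub>m m"
  shows "m \<le> n"
proof (rule ccontr)
  assume "\<not> m \<le> n"
  then have nm: "n < m" by simp
  define A' where "A' = Matrix.mat m m (\<lambda>(i, j). if j < n then A $$ (i, j) else 0)"
  define B' where "B' = Matrix.mat m m (\<lambda>(i, j). if i < n then B $$ (i, j) else 0)"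
  have A': "A' \<in> carrier_mat m m" and B': "B' \<in> carrier_mat m m" by (simp_all add: A'_def B'_def)
  have "A' * B' = A * B"
  proof (rule eq_matI)
    fix i j assume "i < dim_row (A * B)" "j < dim_col (A * B)"
    then have ij: "i < m" "j < m" using A B by simp_all
    have "(A' * B') $$ (i, j) = (\<Sum>l<m. A' $$ (i, l) * B' $$ (l, j))" by (rule mat_mult_index[OF A' B' ij])
    also have "\<dots> = (\<Sum>l<n. A $$ (i, l) * B $$ (l, j))"
      using nm ij by (intro sum.mono_neutral_cong_right) (auto simp: A'_def B'_def)
    also have "\<dots> = (A * B) $$ (i, j)" by (rule mat_mult_index[OF A B ij, symmetric])
    finally show "(A' * B') $$ (i, j) = (A * B) $$ (i, j)" .
  qed (use A B A' B' in simp_all)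
  then have "B' * A' = 1\<^sub>m m" using AB mat_mult_left_right_inverse[OF A' B'] by simp
  moreover have "(B' * A') $$ (n, n) = (\<Sum>l<m. B' $$ (n, l) * A' $$ (l, n))"
    by (rule mat_mult_index[OF B' A' nm nm])
  ultimately show False using nm by (simp add: B'_def)
qed

text \<open>Coordinates are stored in rows, transposed to \<open>base_change_det\<close>, so that
  successive changes multiply as \<open>A' * A\<close>. Congruence of representatives modulo
  \<open>B\<close> replaces equality in a quotient; bases of cochain spaces are the case
  \<open>B = {0}\<close>.\<close>

definition change_of_basis_mod ::
  "('f::field \<Rightarrow> 'v \<Rightarrow> 'v::ab_group_add) \<Rightarrow> 'v set \<Rightarrow> 'f Matrix.mat \<Rightarrow> 'v list \<Rightarrow> 'v list \<Rightarrow> bool" where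
  "change_of_basis_mod s B A us vs \<longleftrightarrow>
     A \<in> carrier_mat (length us) (length vs) \<and>
     (\<forall>i<length us. us ! i - lincomb s (\<lambda>j. A $$ (i, j)) vs \<in> B)"

lemma basis_mod_subset: "basis_mod s V B vs \<Longrightarrow> set vs \<subseteq> V"
  by (simp add: basis_mod_def)

context vector_space
begin

lemma lincomb_cong:
  "(\<And>i. i < length vs \<Longrightarrow> a i = b i) \<Longrightarrow> lincomb scale a vs = lincomb scale b vs"
  by (simp add: lincomb_def)

lemma lincomb_closed:
  assumes "subspace V" "set vs \<subseteq> V"
  shows "lincomb scale a vs \<in> V"
  unfolding lincomb_def using assms by (intro subspace_sum subspace_scale) (auto simp: subset_iff)

lemma lincomb_unit:
  assumes "i < length vs"
  shows "lincomb scale (\<lambda>j. if j = i then 1 else 0) vs = vs ! i"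
proof -
  have "lincomb scale (\<lambda>j. if j = i then 1 else 0) vs = (\<Sum>j<length vs. if j = i then vs ! i else 0)"
    unfolding lincomb_def by (intro sum.cong) auto
  then show ?thesis using assms by simp
qed

lemma lincomb_diff_left:
  "lincomb scale (\<lambda>j. a j - b j) vs = lincomb scale a vs - lincomb scale b vs"
  by (simp add: lincomb_def scale_left_diff_distrib sum_subtractf)

lemma lincomb_sum_left:
  "lincomb scale (\<lambda>j. \<Sum>k\<in>I. c k * a k j) vs = (\<Sum>k\<in>I. scale (c k) (lincomb scale (a k) vs))"
  unfolding lincomb_def scale_sum_left scale_sum_right by (subst sum.swap) simp

lemma basis_mod_coordinates:
  assumes "basis_mod scale V B vs" "v \<in> V"
  obtains a where "v - lincomb scale a vs \<in> B"
  using assms unfolding basis_mod_def by blast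

lemma basis_mod_unique:
  assumes V: "subspace V" and B: "subspace B" and basis: "basis_mod scale V B vs"
    and eq: "lincomb scale a vs - lincomb scale b vs \<in> B" and i: "i < length vs"
  shows "a i = b i"
proof -
  \<comment> \<open>\<open>basis_mod\<close> asserts uniqueness among coefficient functions
    vanishing beyond the length of the list, so both functions are first truncated.\<close>
  define cut where "cut = (\<lambda>a j. if j < length vs then a j else (0::'a))"
  have cut: "lincomb scale (cut a) vs = lincomb scale a vs" for a
    by (rule lincomb_cong) (simp add: cut_def)
  have "set vs \<subseteq> V" using basis by (rule basis_mod_subset)
  then have "lincomb scale a vs \<in> V" by (rule lincomb_closed[OF V])
  define Q where "Q = (\<lambda>c. (\<forall>j\<ge>length vs. c j = 0) \<and> lincomb scale a vs - lincomb scale c vs \<in> B)"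
  have ex: "\<exists>!c. Q c"
    using \<open>lincomb scale a vs \<in> V\<close> basis unfolding basis_mod_def Q_def by (elim conjE) (rule bspec)
  have a: "Q (cut a)" and b: "Q (cut b)"
    using eq subspace_0[OF B] by (simp_all add: Q_def cut) (simp_all add: cut_def)
  have "cut a = cut b"
    using ex a b by blast
  then show ?thesis using i by (metis cut_def)
qed

lemma change_of_basis_mod_lincomb:
  assumes B: "subspace B" and A: "change_of_basis_mod scale B A us vs"
  shows "lincomb scale a us - lincomb scale (\<lambda>j. \<Sum>k<length us. a k * A $$ (k, j)) vs \<in> B"
proof -
  have "lincomb scale a us - lincomb scale (\<lambda>j. \<Sum>k<length us. a k * A $$ (k, j)) vs =
      (\<Sum>k<length us. scale (a k) (us ! k - lincomb scale (\<lambda>j. A $$ (k, j)) vs))"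
    unfolding lincomb_sum_left by (simp add: lincomb_def[of _ a] scale_right_diff_distrib sum_subtractf)
  also have "\<dots> \<in> B"
    using A by (intro subspace_sum[OF B] subspace_scale[OF B]) (simp add: change_of_basis_mod_def)
  finally show ?thesis .
qed

lemma subspace_diff_trans:
  assumes "subspace B" "u - v \<in> B" "v - w \<in> B" shows "u - w \<in> B"
  using subspace_add[OF assms] by simp

lemma subspace_diff_sym:
  assumes "subspace B" "u - v \<in> B" shows "v - u \<in> B"
  using subspace_neg[OF assms] by simp

lemma change_of_basis_mod_mult:
  assumes B: "subspace B" and A: "change_of_basis_mod scale B A us vs"
    and A': "change_of_basis_mod scale B A' ws us"
  shows "change_of_basis_mod scale B (A' * A) ws vs"
proof -
  have dim: "A \<in> carrier_mat (length us) (length vs)" "A' \<in> carrier_mat (length ws) (length us)"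
    using A A' by (simp_all add: change_of_basis_mod_def)
  have "ws ! i - lincomb scale (\<lambda>j. (A' * A) $$ (i, j)) vs \<in> B" if i: "i < length ws" for i
  proof -
    have "lincomb scale (\<lambda>j. (A' * A) $$ (i, j)) vs =
        lincomb scale (\<lambda>j. \<Sum>k<length us. A' $$ (i, k) * A $$ (k, j)) vs"
      by (rule lincomb_cong) (rule mat_mult_index[OF dim(2,1) i])
    moreover have "ws ! i - lincomb scale (\<lambda>k. A' $$ (i, k)) us \<in> B"
      using A' i by (simp add: change_of_basis_mod_def)
    ultimately show ?thesis
      using subspace_diff_trans[OF B _ change_of_basis_mod_lincomb[OF B A]] by simp
  qed
  then show ?thesis using dim by (simp add: change_of_basis_mod_def)
qed

lemma change_of_basis_mod_self:
  assumes V: "subspace V" and B: "subspace B" and basis: "basis_mod scale V B vs"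
    and A: "change_of_basis_mod scale B A vs vs"
  shows "A = 1\<^sub>m (length vs)"
proof (rule eq_matI)
  fix i j assume ij: "i < dim_row (1\<^sub>m (length vs))" "j < dim_col (1\<^sub>m (length vs))"
  then have "lincomb scale (\<lambda>j. if j = i then 1 else 0) vs - lincomb scale (\<lambda>j. A $$ (i, j)) vs \<in> B"
    using A by (simp add: change_of_basis_mod_def lincomb_unit)
  from basis_mod_unique[OF V B basis this, of j] show "A $$ (i, j) = 1\<^sub>m (length vs) $$ (i, j)"
    using ij by auto
qed (use A in \<open>auto simp: change_of_basis_mod_def\<close>)

lemma change_of_basis_mod_exists:
  assumes basis: "basis_mod scale V B vs" and us: "set us \<subseteq> V"
  obtains A where "change_of_basis_mod scale B A us vs"
proof -
  have "\<exists>a. us ! i - lincomb scale a vs \<in> B" if "i < length us" for i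
    using basis_mod_coordinates[OF basis, of "us ! i"] us that by (meson nth_mem subsetD)
  then obtain a where a: "\<And>i. i < length us \<Longrightarrow> us ! i - lincomb scale (a i) vs \<in> B" by metis
  let ?A = "Matrix.mat (length us) (length vs) (\<lambda>(i, j). a i j)"
  have "lincomb scale (\<lambda>j. ?A $$ (i, j)) vs = lincomb scale (a i) vs" if "i < length us" for i
    by (rule lincomb_cong) (simp add: that)
  then have "change_of_basis_mod scale B ?A us vs"
    using a by (simp add: change_of_basis_mod_def)
  then show ?thesis by (rule that)
qed

text \<open>The transition matrices in the two directions are mutually inverse, because coordinates
  are unique. This forces equal lengths, and the two determinants multiply to 1.\<close>

lemma change_of_basis_mod_two_bases:
  assumes V: "subspace V" and B: "subspace B"
    and us: "basis_mod scale V B us" and vs: "basis_mod scale V B vs"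
  obtains A where "length us = length vs" "change_of_basis_mod scale B A us vs" "Determinant.det A \<noteq> 0"
proof -
  obtain A where A: "change_of_basis_mod scale B A us vs"
    by (rule change_of_basis_mod_exists[OF vs basis_mod_subset[OF us]])
  obtain A' where A': "change_of_basis_mod scale B A' vs us"
    by (rule change_of_basis_mod_exists[OF us basis_mod_subset[OF vs]])
  have inv: "A' * A = 1\<^sub>m (length vs)" "A * A' = 1\<^sub>m (length us)"
    using change_of_basis_mod_self[OF V B] change_of_basis_mod_mult[OF B] A A' us vs by blast+
  have dim: "A \<in> carrier_mat (length us) (length vs)" "A' \<in> carrier_mat (length vs) (length us)"
    using A A' by (simp_all add: change_of_basis_mod_def)
  have len: "length us = length vs"
    using left_inverse_mat_dim[OF dim(2,1) inv(1)] left_inverse_mat_dim[OF dim inv(2)] by simp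
  have "Determinant.det A * Determinant.det A' = 1"
    using Determinant.det_mult[of A "length us" A'] dim inv len by simp
  then have "Determinant.det A \<noteq> 0" by auto
  with len A show ?thesis by (rule that)
qed

lemma basis_mod_change_of_basis:
  assumes V: "subspace V" and B: "subspace B" and vs: "basis_mod scale V B vs"
    and A: "change_of_basis_mod scale B A us vs" and us: "set us \<subseteq> V" "length us = length vs"
    and det: "Determinant.det A \<noteq> 0"
  shows "basis_mod scale V B us"
proof -
  let ?n = "length vs"
  have dimA: "A \<in> carrier_mat ?n ?n" using A us by (simp add: change_of_basis_mod_def)
  \<comment> \<open>\<open>undefined\<close> instantiates the record extension field of
    \<open>ring_mat\<close>.\<close>
  from det_non_zero_imp_unit[OF dimA det, of undefined]
  obtain A' where A': "A' \<in> carrier_mat ?n ?n" "A' * A = 1\<^sub>m ?n" "A * A' = 1\<^sub>m ?n"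
    unfolding Units_def ring_mat_def by auto
  have AA': "(\<Sum>k<?n. A $$ (i, k) * A' $$ (k, j)) = (if i = j then 1 else 0)"
    and A'A: "(\<Sum>k<?n. A' $$ (i, k) * A $$ (k, j)) = (if i = j then 1 else 0)"
    if "i < ?n" "j < ?n" for i j
    using mat_mult_index[OF dimA A'(1) that] mat_mult_index[OF A'(1) dimA that] A' that by simp_all
  show ?thesis
    unfolding basis_mod_def
  proof (intro conjI ballI ex_ex1I us(1))
    fix v assume "v \<in> V"
    then obtain a where a: "v - lincomb scale a vs \<in> B" by (rule basis_mod_coordinates[OF vs])
    \<comment> \<open>The coordinate row \<open>a\<close> times the inverse matrix
      \<open>A'\<close>, padded by zeros as \<open>basis_mod\<close> demands.\<close>
    define b where "b = (\<lambda>i. if i < ?n then \<Sum>k<?n. a k * A' $$ (k, i) else 0)"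
    have "(\<Sum>i<?n. b i * A $$ (i, j)) = a j" if j: "j < ?n" for j
    proof -
      have "(\<Sum>i<?n. b i * A $$ (i, j)) = (\<Sum>i<?n. \<Sum>k<?n. a k * (A' $$ (k, i) * A $$ (i, j)))"
        by (simp add: b_def sum_distrib_right mult.assoc)
      also have "\<dots> = (\<Sum>k<?n. a k * (\<Sum>i<?n. A' $$ (k, i) * A $$ (i, j)))"
        by (subst sum.swap) (simp add: sum_distrib_left)
      also have "\<dots> = (\<Sum>k<?n. if k = j then a j else 0)"
        by (rule sum.cong) (simp_all add: A'A j)
      also have "\<dots> = a j" using j by simp
      finally show ?thesis .
    qed
    then have "lincomb scale (\<lambda>j. \<Sum>i<length us. b i * A $$ (i, j)) vs = lincomb scale a vs"
      unfolding us(2) by (intro lincomb_cong)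
    with change_of_basis_mod_lincomb[OF B A, of b] have "lincomb scale b us - lincomb scale a vs \<in> B" by simp
    from subspace_diff_trans[OF B a subspace_diff_sym[OF B this]]
    have "v - lincomb scale b us \<in> B" .
    then show "\<exists>a. (\<forall>i\<ge>length us. a i = 0) \<and> v - lincomb scale a us \<in> B"
      by (intro exI[of _ b]) (simp add: b_def us(2))
  next
    fix v a b
    assume a: "(\<forall>i\<ge>length us. a i = 0) \<and> v - lincomb scale a us \<in> B"
      and b: "(\<forall>i\<ge>length us. b i = 0) \<and> v - lincomb scale b us \<in> B"
    \<comment> \<open>The difference of two coordinate rows is annihilated by \<open>A\<close> from
      the right; a further multiplication by \<open>A'\<close> shows that it is zero.\<close>
    define c where "c = (\<lambda>i. a i - b i)"
    from subspace_diff_trans[OF B subspace_diff_sym[OF B conjunct2[OF a]] conjunct2[OF b]]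
    have "lincomb scale c us \<in> B" by (simp add: c_def lincomb_diff_left)
    moreover have "lincomb scale c us - lincomb scale (\<lambda>j. \<Sum>k<length us. c k * A $$ (k, j)) vs \<in> B"
      by (rule change_of_basis_mod_lincomb[OF B A])
    ultimately have "lincomb scale c us - (lincomb scale c us - lincomb scale (\<lambda>j. \<Sum>k<length us. c k * A $$ (k, j)) vs) \<in> B"
      by (rule subspace_diff[OF B])
    then have "lincomb scale (\<lambda>j. \<Sum>k<length us. c k * A $$ (k, j)) vs - lincomb scale (\<lambda>_. 0) vs \<in> B"
      by (simp add: lincomb_def[of _ "\<lambda>_. 0"])
    from basis_mod_unique[OF V B vs this]
    have cA: "(\<Sum>k<?n. c k * A $$ (k, j)) = 0" if "j < ?n" for j using that us(2) by simp
    have "c i = 0" if i: "i < ?n" for i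
    proof -
      have "0 = (\<Sum>j<?n. (\<Sum>k<?n. c k * A $$ (k, j)) * A' $$ (j, i))" by (simp add: cA)
      also have "\<dots> = (\<Sum>j<?n. \<Sum>k<?n. c k * (A $$ (k, j) * A' $$ (j, i)))"
        by (simp add: sum_distrib_right mult.assoc)
      also have "\<dots> = (\<Sum>k<?n. c k * (\<Sum>j<?n. A $$ (k, j) * A' $$ (j, i)))"
        by (subst sum.swap) (simp add: sum_distrib_left)
      also have "\<dots> = (\<Sum>k<?n. if k = i then c i else 0)"
        by (rule sum.cong) (simp_all add: AA' i)
      finally show ?thesis using i by simp
    qed
    show "a = b"
    proof
      fix i
      show "a i = b i" using a b us(2) \<open>\<And>i. i < ?n \<Longrightarrow> c i = 0\<close>[of i] by (cases "i < ?n") (simp_all add: c_def)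
    qed
  qed
qed

end

lemma coset_mod_iff: "v \<in> coset_mod B u \<longleftrightarrow> v - u \<in> B"
  by (auto simp: coset_mod_def intro!: image_eqI[of _ _ "v - u"])

section \<open>Base change determinants and the torsion\<close>

context vector_space
begin

lemma lincomb_append:
  "lincomb scale a (xs @ ys) = lincomb scale a xs + lincomb scale (\<lambda>j. a (length xs + j)) ys"
proof -
  have "{..<length xs + length ys} = {..<length xs} \<union> {length xs..<length xs + length ys}" by auto
  moreover have "(\<Sum>i\<in>{length xs..<length xs + length ys}. scale (a i) ((xs @ ys) ! i)) =
      (\<Sum>j<length ys. scale (a (length xs + j)) (ys ! j))"
    by (rule sum.reindex_bij_witness[of _ "\<lambda>j. length xs + j" "\<lambda>i. i - length xs"])
       (auto simp: nth_append)
  ultimately show ?thesis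
    by (simp add: lincomb_def sum.union_disjoint ivl_disj_int nth_append)
qed

lemma change_of_basis_mod_one:
  assumes "length us = length vs" "\<And>i. i < length vs \<Longrightarrow> us ! i - vs ! i \<in> B"
  shows "change_of_basis_mod scale B (1\<^sub>m (length vs)) us vs"
proof -
  have "lincomb scale (\<lambda>j. 1\<^sub>m (length vs) $$ (i, j)) vs = vs ! i" if "i < length vs" for i
    unfolding lincomb_unit[OF that, symmetric] using that by (intro lincomb_cong) auto
  then show ?thesis using assms by (simp add: change_of_basis_mod_def)
qed

lemma change_of_basis_mod_four_block:
  assumes A: "change_of_basis_mod scale {0} A xs xs'" and D: "change_of_basis_mod scale {0} D ys ys'"
  shows "change_of_basis_mod scale {0}
    (four_block_mat A (0\<^sub>m (length xs) (length ys')) (0\<^sub>m (length ys) (length xs')) D) (xs @ ys) (xs' @ ys')"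
proof -
  let ?Q = "four_block_mat A (0\<^sub>m (length xs) (length ys')) (0\<^sub>m (length ys) (length xs')) D"
  have dim: "A \<in> carrier_mat (length xs) (length xs')" "D \<in> carrier_mat (length ys) (length ys')"
    using A D by (simp_all add: change_of_basis_mod_def)
  have zero: "lincomb scale (\<lambda>_. 0) zs = 0" for zs by (simp add: lincomb_def)
  have "(xs @ ys) ! i = lincomb scale (\<lambda>j. ?Q $$ (i, j)) (xs' @ ys')" if i: "i < length xs + length ys" for i
  proof (cases "i < length xs")
    case True
    have "lincomb scale (\<lambda>j. ?Q $$ (i, j)) xs' = lincomb scale (\<lambda>j. A $$ (i, j)) xs'"
      by (rule lincomb_cong) (use dim True in simp)
    moreover have "lincomb scale (\<lambda>j. ?Q $$ (i, length xs' + j)) ys' = lincomb scale (\<lambda>_. 0) ys'"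
      by (rule lincomb_cong) (use dim True in simp)
    ultimately show ?thesis
      using A True by (simp add: lincomb_append zero nth_append change_of_basis_mod_def)
  next
    case False
    have "lincomb scale (\<lambda>j. ?Q $$ (i, j)) xs' = lincomb scale (\<lambda>_. 0) xs'"
      by (rule lincomb_cong) (use dim False i in simp)
    moreover have "lincomb scale (\<lambda>j. ?Q $$ (i, length xs' + j)) ys' = lincomb scale (\<lambda>j. D $$ (i - length xs, j)) ys'"
      by (rule lincomb_cong) (use dim False i in simp)
    ultimately show ?thesis
      using D False i by (simp add: lincomb_append zero nth_append change_of_basis_mod_def)
  qed
  then show ?thesis using dim by (simp add: change_of_basis_mod_def)
qed

text \<open>Uniqueness of coordinates forces the matrix in the definite description to be the
  transpose of \<open>A\<close>. The lengths of \<open>xs\<close> and \<open>c\<close> may differ;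
  both determinants are then 0 by definition.\<close>

lemma base_change_det_eq:
  assumes V: "subspace V" and c: "basis_mod scale V {0} c" and A: "change_of_basis_mod scale {0} A xs c"
  shows "base_change_det scale xs c = Determinant.det A"
proof -
  have dim: "A \<in> carrier_mat (length xs) (length c)" using A by (simp add: change_of_basis_mod_def)
  have det: "Determinant.det (transpose_mat A) = Determinant.det A"
  proof (cases "length xs = length c")
    case True
    then show ?thesis using Determinant.det_transpose[of A "length c"] dim by simp
  next
    case False
    then show ?thesis using dim by (simp add: Determinant.det_def)
  qed
  have eq: "P = transpose_mat A"
    if P: "P \<in> carrier_mat (length c) (length xs)" "\<forall>i<length xs. xs ! i = lincomb scale (\<lambda>j. P $$ (j, i)) c" for P
  proof (rule eq_matI)
    fix j i assume "j < dim_row (transpose_mat A)" "i < dim_col (transpose_mat A)"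
    then have ij: "i < length xs" "j < length c" using dim by simp_all
    have "lincomb scale (\<lambda>j. P $$ (j, i)) c - lincomb scale (\<lambda>j. A $$ (i, j)) c \<in> {0}"
      using A P(2) ij(1) by (simp add: change_of_basis_mod_def)
    from basis_mod_unique[OF V _ c this ij(2)] show "P $$ (j, i) = transpose_mat A $$ (j, i)"
      using dim ij by (simp add: subspace_0)
  qed (use dim P in simp_all)
  show ?thesis
    unfolding base_change_det_def
  proof (rule the_equality)
    show "\<exists>P\<in>carrier_mat (length c) (length xs).
        (\<forall>i<length xs. xs ! i = lincomb scale (\<lambda>j. P $$ (j, i)) c) \<and> Determinant.det A = Determinant.det P"
    proof (intro bexI[of _ "transpose_mat A"] conjI allI impI)
      fix i assume i: "i < length xs"
      have "lincomb scale (\<lambda>j. transpose_mat A $$ (j, i)) c = lincomb scale (\<lambda>j. A $$ (i, j)) c"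
        by (rule lincomb_cong) (use dim i in simp)
      then show "xs ! i = lincomb scale (\<lambda>j. transpose_mat A $$ (j, i)) c"
        using A i by (simp add: change_of_basis_mod_def)
    qed (use det dim in simp_all)
  qed (use eq det in auto)
qed

text \<open>The transition matrix of the new list is that of the old list, \<open>D\<close>,
  multiplied from the left by the block diagonal matrix with blocks 1, \<open>A\<close>, 1. If
  \<open>D\<close> is not square, both sides are 0.\<close>

lemma base_change_det_replace:
  assumes V: "subspace V" and c: "basis_mod scale V {0} c" and V': "set (bs @ zs @ ls) \<subseteq> V"
    and A: "change_of_basis_mod scale {0} A zs' zs" and len: "length zs' = length zs"
  shows "base_change_det scale (bs @ zs' @ ls) c = Determinant.det A * base_change_det scale (bs @ zs @ ls) c"
proof -
  obtain D where D: "change_of_basis_mod scale {0} D (bs @ zs @ ls) c"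
    by (rule change_of_basis_mod_exists[OF c V'])
  have one: "change_of_basis_mod scale {0} (1\<^sub>m (length xs)) xs xs" for xs
    by (rule change_of_basis_mod_one) simp_all
  let ?n = "length zs" and ?p = "length bs" and ?q = "length ls"
  let ?Q' = "four_block_mat A (0\<^sub>m ?n ?q) (0\<^sub>m ?q ?n) (1\<^sub>m ?q)"
  let ?Q = "four_block_mat (1\<^sub>m ?p) (0\<^sub>m ?p (?n + ?q)) (0\<^sub>m (?n + ?q) ?p) ?Q'"
  have dimA: "A \<in> carrier_mat ?n ?n" using A len by (simp add: change_of_basis_mod_def)
  have "change_of_basis_mod scale {0} ?Q (bs @ zs' @ ls) (bs @ zs @ ls)"
    using change_of_basis_mod_four_block[OF one[of bs] change_of_basis_mod_four_block[OF A one[of ls]]] len by simp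
  moreover have "subspace {0}" by (simp add: subspace_0)
  ultimately have "change_of_basis_mod scale {0} (?Q * D) (bs @ zs' @ ls) c"
    using D by (intro change_of_basis_mod_mult)
  then have *: "base_change_det scale (bs @ zs' @ ls) c = Determinant.det (?Q * D)"
    by (rule base_change_det_eq[OF V c])
  have dimD: "D \<in> carrier_mat (?p + (?n + ?q)) (length c)" using D by (simp add: change_of_basis_mod_def)
  have "Determinant.det ?Q' = Determinant.det A * Determinant.det (1\<^sub>m ?q :: 'a Matrix.mat)"
    by (rule det_four_block_mat_upper_right_zero[OF dimA refl zero_carrier_mat one_carrier_mat])
  moreover have "Determinant.det ?Q = Determinant.det (1\<^sub>m ?p :: 'a Matrix.mat) * Determinant.det ?Q'"
    by (rule det_four_block_mat_upper_right_zero[OF one_carrier_mat refl zero_carrier_mat])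
       (rule four_block_carrier_mat[OF dimA one_carrier_mat])
  ultimately have detQ: "Determinant.det ?Q = Determinant.det A" by simp
  have dimQ: "?Q \<in> carrier_mat (?p + (?n + ?q)) (?p + (?n + ?q))"
    by (intro four_block_carrier_mat dimA one_carrier_mat)
  have "Determinant.det (?Q * D) = Determinant.det ?Q * Determinant.det D"
  proof (cases "?p + (?n + ?q) = length c")
    case True
    then show ?thesis using Determinant.det_mult[OF dimQ, of D] dimD by simp
  next
    case False
    then have "Determinant.det X = 0" if "X \<in> carrier_mat (?p + (?n + ?q)) (length c)" for X :: "'a Matrix.mat"
      using that by (auto simp: Determinant.det_def)
    from this[OF dimD] this[OF mult_carrier_mat[OF dimQ dimD]] show ?thesis by simp
  qed
  then show ?thesis using * detQ base_change_det_eq[OF V c D] by simp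
qed

text \<open>\<open>quotient_basis\<close> provides some representatives \<open>ws\<close> that form
  a basis modulo \<open>B\<close>. The given \<open>us\<close> represent the same classes, so the
  identity matrix relates them to \<open>ws\<close>, and \<open>A\<close> leads on to
  \<open>us'\<close>.\<close>

lemma quotient_basis_change_of_basis:
  assumes V: "subspace V" and B: "subspace B" and us: "quotient_basis scale V B (map (coset_mod B) us)"
    and V': "set us \<subseteq> V" "set us' \<subseteq> V"
    and A: "change_of_basis_mod scale B A us' us" "length us' = length us" "Determinant.det A \<noteq> 0"
  shows "quotient_basis scale V B (map (coset_mod B) us')"
proof -
  obtain ws where ws: "map (coset_mod B) us = map (coset_mod B) ws" "basis_mod scale V B ws"
    using us unfolding quotient_basis_def by (elim exE conjE)
  have len: "length us = length ws" using ws(1) by (rule map_eq_imp_length_eq)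
  have "us ! i - ws ! i \<in> B" if "i < length ws" for i
  proof -
    have "coset_mod B (us ! i) = coset_mod B (ws ! i)"
      using arg_cong[OF ws(1), of "\<lambda>xs. xs ! i"] that len by simp
    then show ?thesis using coset_mod_self[OF subspace_0[OF B], of "us ! i"] by (simp add: coset_mod_iff)
  qed
  then have "basis_mod scale V B us"
    using basis_mod_change_of_basis[OF V B ws(2) change_of_basis_mod_one[OF len] V'(1) len] by simp
  then have "basis_mod scale V B us'"
    by (rule basis_mod_change_of_basis[OF V B _ A(1) V'(2) A(2,3)])
  then show ?thesis unfolding quotient_basis_def by blast
qed

text \<open>The bases \<open>b\<close> and the lifts \<open>l\<close> behind the value
  \<open>t\<close> are kept. The new classes are lifted to the combinations of the old lifts
  \<open>z i\<close> by the rows of \<open>A i\<close>. These lie in the right classes because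
  \<open>z i\<close> and \<open>us i\<close> agree modulo coboundaries, and each determinant gains
  exactly the factor \<open>det (A i)\<close>.\<close>

lemma is_torsion_change_of_basis:
  assumes t: "is_torsion scale k C \<delta> c h t"
    and C: "\<And>i. i \<le> k \<Longrightarrow> subspace (C i)" and Z: "\<And>i. i \<le> k \<Longrightarrow> subspace (coc C \<delta> i)"
    and B: "\<And>i. i \<le> k \<Longrightarrow> subspace (cob C \<delta> i)" "\<And>i. i \<le> k \<Longrightarrow> cob C \<delta> i \<subseteq> C i"
    and h: "\<And>i. i \<le> k \<Longrightarrow> h i = map (coset_mod (cob C \<delta> i)) (us i)"
    and h': "\<And>i. i \<le> k \<Longrightarrow> h' i = map (coset_mod (cob C \<delta> i)) (us' i)"
    and us: "\<And>i. i \<le> k \<Longrightarrow> set (us i) \<subseteq> coc C \<delta> i" "\<And>i. i \<le> k \<Longrightarrow> set (us' i) \<subseteq> coc C \<delta> i"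
    and A: "\<And>i. i \<le> k \<Longrightarrow> change_of_basis_mod scale (cob C \<delta> i) (A i) (us' i) (us i)"
      "\<And>i. i \<le> k \<Longrightarrow> length (us' i) = length (us i)" "\<And>i. i \<le> k \<Longrightarrow> Determinant.det (A i) \<noteq> 0"
  shows "is_torsion scale k C \<delta> c h' (t * (\<Prod>i\<le>k. Determinant.det (A i) powi ((-1) ^ (i + 1))))"
proof -
  obtain b z l where c: "\<And>i. i \<le> k \<Longrightarrow> basis_mod scale (C i) {0} (c i)"
    and hb: "\<And>i. i \<le> k \<Longrightarrow> cohom_basis scale C \<delta> i (h i)"
    and b: "\<And>i. i \<le> Suc k \<Longrightarrow> basis_mod scale (cob C \<delta> i) {0} (b i)"
    and z: "\<And>i. i \<le> k \<Longrightarrow> list_all2 (\<in>) (z i) (h i)"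
    and l: "\<And>i. i \<le> k \<Longrightarrow> set (l i) \<subseteq> C i \<and> map (\<delta> i) (l i) = b (Suc i)"
    and t': "t = (\<Prod>i\<le>k. base_change_det scale (b i @ z i @ l i) (c i) powi ((-1) ^ (i + 1)))"
    using t unfolding is_torsion_def by blast
  define z' where "z' = (\<lambda>i. map (\<lambda>r. lincomb scale (\<lambda>j. A i $$ (r, j)) (z i)) [0..<length (us i)])"
  have zlen: "length (z i) = length (us i)" if "i \<le> k" for i
    using list_all2_lengthD[OF z[OF that]] h[OF that] by simp
  have zmem: "z i ! r - us i ! r \<in> cob C \<delta> i" if "i \<le> k" "r < length (us i)" for i r
    using list_all2_nthD[OF z[OF that(1)], of r] zlen[OF that(1)] h[OF that(1)] that(2)
    by (simp add: coset_mod_iff)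
  have z'A: "change_of_basis_mod scale {0} (A i) (z' i) (z i)" if "i \<le> k" for i
    using A(1,2)[OF that] zlen[OF that] by (simp add: change_of_basis_mod_def z'_def)
  have z': "list_all2 (\<in>) (z' i) (h' i)" if i: "i \<le> k" for i
  proof (rule list_all2_all_nthI)
    show "length (z' i) = length (h' i)" using A(2)[OF i] h'[OF i] by (simp add: z'_def)
    fix r assume "r < length (z' i)"
    then have r: "r < length (us i)" by (simp add: z'_def)
    let ?n = "length (us i)"
    have dimA: "A i \<in> carrier_mat ?n ?n" using A(1,2)[OF i] by (simp add: change_of_basis_mod_def)
    have z'z: "change_of_basis_mod scale (cob C \<delta> i) (A i) (z' i) (z i)"
      using z'A[OF i] subspace_0[OF B(1)[OF i]] by (simp add: change_of_basis_mod_def)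
    have "change_of_basis_mod scale (cob C \<delta> i) (1\<^sub>m ?n) (z i) (us i)"
      by (rule change_of_basis_mod_one[OF zlen[OF i] zmem[OF i]])
    from change_of_basis_mod_mult[OF B(1)[OF i] this z'z]
    have zA: "z' i ! r - lincomb scale (\<lambda>j. A i $$ (r, j)) (us i) \<in> cob C \<delta> i"
      using r dimA by (simp add: change_of_basis_mod_def z'_def)
    have uA: "us' i ! r - lincomb scale (\<lambda>j. A i $$ (r, j)) (us i) \<in> cob C \<delta> i"
      using A(1,2)[OF i] r by (simp add: change_of_basis_mod_def)
    have "z' i ! r - us' i ! r \<in> cob C \<delta> i"
      by (rule subspace_diff_trans[OF B(1)[OF i] zA subspace_diff_sym[OF B(1)[OF i] uA]])
    then show "z' i ! r \<in> h' i ! r" using h'[OF i] A(2)[OF i] r by (simp add: coset_mod_iff)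
  qed
  have det: "base_change_det scale (b i @ z' i @ l i) (c i) =
      Determinant.det (A i) * base_change_det scale (b i @ z i @ l i) (c i)" if i: "i \<le> k" for i
  proof (rule base_change_det_replace[OF C[OF i] c[OF i] _ z'A[OF i]])
    show "length (z' i) = length (z i)" using zlen[OF i] by (simp add: z'_def)
    have "z i ! r \<in> C i" if "r < length (us i)" for r
    proof -
      have "us i ! r \<in> C i" using us(1)[OF i] that nth_mem by (fastforce simp: coc_iff)
      moreover have "z i ! r - us i ! r \<in> C i" using zmem[OF i that] B(2)[OF i] by blast
      ultimately show ?thesis using subspace_add[OF C[OF i], of "z i ! r - us i ! r" "us i ! r"] by simp
    qed
    then have "set (z i) \<subseteq> C i" using zlen[OF i] by (auto simp: set_conv_nth)
    moreover have "set (b i) \<subseteq> C i" using basis_mod_subset[OF b, of i] B(2)[OF i] i by simp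
    ultimately show "set (b i @ z i @ l i) \<subseteq> C i" using l[OF i] by simp
  qed
  have "(\<Prod>i\<le>k. base_change_det scale (b i @ z' i @ l i) (c i) powi ((-1) ^ (i + 1))) =
      (\<Prod>i\<le>k. Determinant.det (A i) powi ((-1) ^ (i + 1)) *
              base_change_det scale (b i @ z i @ l i) (c i) powi ((-1) ^ (i + 1)))"
    by (intro prod.cong refl) (simp add: det power_int_mult_distrib)
  then have t'': "t * (\<Prod>i\<le>k. Determinant.det (A i) powi ((-1) ^ (i + 1))) =
      (\<Prod>i\<le>k. base_change_det scale (b i @ z' i @ l i) (c i) powi ((-1) ^ (i + 1)))"
    by (simp add: t' prod.distrib mult.commute)
  have hb': "cohom_basis scale C \<delta> i (h' i)" if i: "i \<le> k" for i
    unfolding cohom_basis_def h'[OF i]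
    by (rule quotient_basis_change_of_basis[OF Z[OF i] B(1)[OF i] _ us(1)[OF i] us(2)[OF i] A(1)[OF i] A(2)[OF i] A(3)[OF i]])
       (use hb[OF i] in \<open>simp add: cohom_basis_def h[OF i]\<close>)
  show ?thesis
    unfolding is_torsion_def t''
    using c hb' b z' l by (intro conjI exI[of _ b] exI[of _ z'] exI[of _ l]) simp_all
qed

end

section \<open>Gram matrices of sesquilinear pairings\<close>

definition gram :: "('v \<Rightarrow> 'v \<Rightarrow> 'f) \<Rightarrow> 'v list \<Rightarrow> 'v list \<Rightarrow> 'f Matrix.mat" where
  "gram P vs us = Matrix.mat (length vs) (length us) (\<lambda>(i, j). P (vs ! i) (us ! j))"

lemma gram_dim: "gram P vs us \<in> carrier_mat (length vs) (length us)"
  by (simp add: gram_def)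

lemma field_involution_det:
  assumes bar: "field_involution bar"
  shows "Determinant.det (map_mat bar A) = bar (Determinant.det A)"
proof -
  interpret comm_ring_hom bar
    by unfold_locales (simp_all add: field_involution_simps[OF bar])
  show ?thesis by (rule hom_det)
qed

context vector_space
begin

context
  fixes bar :: "'a \<Rightarrow> 'a" and P :: "'b \<Rightarrow> 'b \<Rightarrow> 'a"
  assumes bar: "field_involution bar"
    and addl: "\<And>v v' u. P (v + v') u = P v u + P v' u" and addr: "\<And>v u u'. P v (u + u') = P v u + P v u'"
    and scalel: "\<And>a v u. P (scale a v) u = a * P v u" and scaler: "\<And>a v u. P v (scale a u) = bar a * P v u"
begin

lemma sesquilinear_lincomb_left: "P (lincomb scale a vs) u = (\<Sum>k<length vs. a k * P (vs ! k) u)"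
proof -
  have zero: "P 0 u = 0" using scalel[of 0 0 u] by simp
  have "P (\<Sum>k\<in>I. scale (a k) (vs ! k)) u = (\<Sum>k\<in>I. a k * P (vs ! k) u)" for I
    by (induction I rule: infinite_finite_induct) (simp_all add: zero addl scalel)
  then show ?thesis by (simp add: lincomb_def)
qed

lemma sesquilinear_lincomb_right: "P v (lincomb scale a us) = (\<Sum>k<length us. bar (a k) * P v (us ! k))"
proof -
  have zero: "P v 0 = 0" using scaler[of v 0 0] by (simp add: field_involution_simps[OF bar])
  have "P v (\<Sum>k\<in>I. scale (a k) (us ! k)) = (\<Sum>k\<in>I. bar (a k) * P v (us ! k))" for I
    by (induction I rule: infinite_finite_induct) (simp_all add: zero addr scaler)
  then show ?thesis by (simp add: lincomb_def)
qed

text \<open>The new vectors are combinations of the old ones only modulo \<open>B\<close> and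
  \<open>B'\<close>, but these subspaces pair to zero, so the transformation rule of a sesquilinear
  form holds without correction terms. The first argument is replaced first; the combination
  \<open>x\<close> lies in \<open>V\<close>, as \<open>zr\<close> asks when the second one is
  replaced.\<close>

lemma gram_change_of_basis:
  assumes W: "subspace W" and zl: "\<And>v u. v \<in> B \<Longrightarrow> u \<in> W \<Longrightarrow> P v u = 0"
    and zr: "\<And>v u. v \<in> V \<Longrightarrow> u \<in> B' \<Longrightarrow> P v u = 0" and V: "subspace V"
    and A: "change_of_basis_mod scale B A vs' vs" and A': "change_of_basis_mod scale B' A' us' us"
    and sub: "set vs \<subseteq> V" "set us' \<subseteq> W"
  shows "gram P vs' us' = A * gram P vs us * transpose_mat (map_mat bar A')"
proof (rule eq_matI)
  have dim: "A \<in> carrier_mat (length vs') (length vs)" "A' \<in> carrier_mat (length us') (length us)"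
    using A A' by (simp_all add: change_of_basis_mod_def)
  let ?G = "gram P vs us" and ?D = "transpose_mat (map_mat bar A')"
  have dimG: "?G \<in> carrier_mat (length vs) (length us)" by (rule gram_dim)
  have dimD: "?D \<in> carrier_mat (length us) (length us')" using dim by simp
  fix i j assume "i < dim_row (A * ?G * ?D)" "j < dim_col (A * ?G * ?D)"
  then have i: "i < length vs'" and j: "j < length us'" using dim by simp_all
  define x where "x = lincomb scale (\<lambda>k. A $$ (i, k)) vs"
  define y where "y = lincomb scale (\<lambda>l. A' $$ (j, l)) us"
  have xV: "x \<in> V" unfolding x_def by (rule lincomb_closed[OF V sub(1)])
  have "vs' ! i - x \<in> B" using A i by (simp add: change_of_basis_mod_def x_def)
  moreover have jW: "us' ! j \<in> W" using sub(2) j by auto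
  ultimately have "P (vs' ! i - x) (us' ! j) = 0" by (rule zl)
  then have "P (vs' ! i) (us' ! j) = P x (us' ! j)"
    using addl[of "vs' ! i - x" x "us' ! j"] by simp
  moreover have "us' ! j - y \<in> B'" using A' j by (simp add: change_of_basis_mod_def y_def)
  then have "P x (us' ! j - y) = 0" by (rule zr[OF xV])
  then have "P x (us' ! j) = P x y" using addr[of x "us' ! j - y" y] by simp
  moreover have "P x y = (\<Sum>l<length us. bar (A' $$ (j, l)) * (\<Sum>k<length vs. A $$ (i, k) * P (vs ! k) (us ! l)))"
    unfolding y_def sesquilinear_lincomb_right x_def sesquilinear_lincomb_left ..
  moreover have "(A * ?G * ?D) $$ (i, j) = (\<Sum>l<length us. (A * ?G) $$ (i, l) * ?D $$ (l, j))"
    by (rule mat_mult_index[OF mult_carrier_mat[OF dim(1) dimG] dimD i j])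
  moreover have "(A * ?G) $$ (i, l) = (\<Sum>k<length vs. A $$ (i, k) * P (vs ! k) (us ! l))" if "l < length us" for l
    unfolding mat_mult_index[OF dim(1) dimG i that] using that by (simp add: gram_def)
  moreover have "?D $$ (l, j) = bar (A' $$ (j, l))" if "l < length us" for l
    using dim j that by simp
  ultimately show "gram P vs' us' $$ (i, j) = (A * ?G * ?D) $$ (i, j)"
    using i j by (simp add: gram_def mult.commute)
qed (use A A' in \<open>auto simp: gram_def change_of_basis_mod_def\<close>)

lemma det_gram_change_of_basis:
  assumes G: "gram P vs' us' = A * gram P vs us * transpose_mat (map_mat bar A')"
    and A: "A \<in> carrier_mat n n" and A': "A' \<in> carrier_mat n n" and len: "length vs = n" "length us = n"
  shows "Determinant.det (gram P vs' us') = Determinant.det A * Determinant.det (gram P vs us) * bar (Determinant.det A')"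
proof -
  have dimG: "gram P vs us \<in> carrier_mat n n" using gram_dim[of P vs us] len by simp
  have dimD: "map_mat bar A' \<in> carrier_mat n n" using A' by simp
  show ?thesis
    unfolding G Determinant.det_mult[OF mult_carrier_mat[OF A dimG] transpose_carrier_mat[THEN iffD2, OF dimD]]
      Determinant.det_mult[OF A dimG] Determinant.det_transpose[OF dimD] field_involution_det[OF bar] ..
qed

text \<open>A kernel vector would give a nontrivial combination \<open>X\<close> of the basis that
  pairs to zero with the basis and hence with all of \<open>V\<close>. By nondegeneracy
  \<open>X\<close> would lie in \<open>B\<close>, contradicting uniqueness of coordinates.\<close>

lemma det_gram_nonzero:
  assumes V: "subspace V" and B: "subspace B" and vs: "basis_mod scale V B vs"
    and zr: "\<And>v u. v \<in> V \<Longrightarrow> u \<in> B \<Longrightarrow> P v u = 0"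
    and nondeg: "\<And>x. x \<in> V \<Longrightarrow> (\<And>y. y \<in> V \<Longrightarrow> P x y = 0) \<Longrightarrow> x \<in> B"
  shows "Determinant.det (gram P vs vs) \<noteq> 0"
proof
  let ?n = "length vs" and ?G = "gram P vs vs"
  have dimG: "?G \<in> carrier_mat ?n ?n" by (rule gram_dim)
  assume "Determinant.det ?G = 0"
  \<comment> \<open>Transposing puts the coefficients of the kernel vector into the linear argument
    of \<open>P\<close>, where they are not conjugated.\<close>
  then have "Determinant.det (transpose_mat ?G) = 0" using Determinant.det_transpose[OF dimG] by simp
  then obtain x where x: "x \<in> carrier_vec ?n" "x \<noteq> 0\<^sub>v ?n" "transpose_mat ?G *\<^sub>v x = 0\<^sub>v ?n"
    using det_0_iff_vec_prod_zero_field[OF transpose_carrier_mat[THEN iffD2, OF dimG]] by blast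
  define X where "X = lincomb scale (\<lambda>k. vec_index x k) vs"
  have XV: "X \<in> V" unfolding X_def by (rule lincomb_closed[OF V basis_mod_subset[OF vs]])
  have Xv: "P X (vs ! l) = 0" if l: "l < ?n" for l
  proof -
    have "(\<Sum>k<?n. ?G $$ (k, l) * vec_index x k) = vec_index (transpose_mat ?G *\<^sub>v x) l"
      using x(1) l dimG by (simp add: scalar_prod_def atLeast0LessThan)
    then have "(\<Sum>k<?n. ?G $$ (k, l) * vec_index x k) = 0" using x(3) l by simp
    then show ?thesis
      unfolding X_def sesquilinear_lincomb_left using l by (simp add: gram_def mult.commute)
  qed
  have "X \<in> B"
  proof (rule nondeg[OF XV])
    fix y assume "y \<in> V"
    then obtain a where a: "y - lincomb scale a vs \<in> B" by (rule basis_mod_coordinates[OF vs])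
    have "P X (lincomb scale a vs) = 0" unfolding sesquilinear_lincomb_right using Xv by simp
    then show "P X y = 0" using addr[of X "y - lincomb scale a vs" "lincomb scale a vs"] zr[OF XV a] by simp
  qed
  then have "lincomb scale (\<lambda>k. vec_index x k) vs - lincomb scale (\<lambda>_. 0) vs \<in> B"
    by (simp add: X_def lincomb_def[of _ "\<lambda>_. 0"])
  from basis_mod_unique[OF V B vs this] have "vec_index x k = 0" if "k < ?n" for k using that by simp
  then have "x = 0\<^sub>v ?n" using x(1) by (intro eq_vecI) auto
  with x(2) show False ..
qed

end

end

section \<open>Transport to cellular cochains\<close>

text \<open>The record \<open>eqv_complex\<close> carries no laws; these make the coboundary of an
  equivariant cochain an equivariant cochain again.\<close>

definition eqv_chain_complex :: "('g, 'c) eqv_complex \<Rightarrow> 'g monoid \<Rightarrow> bool" where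
  "eqv_chain_complex K \<pi> \<longleftrightarrow>
     (\<forall>k. group (grp K k)) \<and> (\<forall>k. bd K k \<in> hom (grp K (Suc k)) (grp K k)) \<and>
     (\<forall>k. \<forall>g\<in>carrier \<pi>. actn K k g \<in> carrier (grp K k) \<rightarrow> carrier (grp K k)) \<and>
     (\<forall>k. \<forall>g\<in>carrier \<pi>. \<forall>x\<in>carrier (grp K (Suc k)). bd K k (actn K (Suc k) g x) = actn K k g (bd K k x))"

lemma eqv_chain_complexD:
  assumes "eqv_chain_complex K \<pi>"
  shows "x \<in> carrier (grp K k) \<Longrightarrow> y \<in> carrier (grp K k) \<Longrightarrow> x \<otimes>\<^bsub>grp K k\<^esub> y \<in> carrier (grp K k)"
    "x \<in> carrier (grp K (Suc k)) \<Longrightarrow> bd K k x \<in> carrier (grp K k)"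
    "x \<in> carrier (grp K (Suc k)) \<Longrightarrow> y \<in> carrier (grp K (Suc k)) \<Longrightarrow>
       bd K k (x \<otimes>\<^bsub>grp K (Suc k)\<^esub> y) = bd K k x \<otimes>\<^bsub>grp K k\<^esub> bd K k y"
    "g \<in> carrier \<pi> \<Longrightarrow> x \<in> carrier (grp K k) \<Longrightarrow> actn K k g x \<in> carrier (grp K k)"
    "g \<in> carrier \<pi> \<Longrightarrow> x \<in> carrier (grp K (Suc k)) \<Longrightarrow> bd K k (actn K (Suc k) g x) = actn K k g (bd K k x)"
proof -
  note K = assms[unfolded eqv_chain_complex_def]
  note K1 = K[THEN conjunct1, rule_format] and K2 = K[THEN conjunct2, THEN conjunct1, rule_format]
    and K3 = K[THEN conjunct2, THEN conjunct2, THEN conjunct1, rule_format]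
    and K4 = K[THEN conjunct2, THEN conjunct2, THEN conjunct2, rule_format]
  interpret group "grp K k" by (rule K1)
  show "x \<otimes>\<^bsub>grp K k\<^esub> y \<in> carrier (grp K k)" if "x \<in> carrier (grp K k)" "y \<in> carrier (grp K k)"
    using that by (rule m_closed)
  show "bd K k x \<in> carrier (grp K k)" if "x \<in> carrier (grp K (Suc k))"
    using K2 that by (rule hom_in_carrier)
  show "bd K k (x \<otimes>\<^bsub>grp K (Suc k)\<^esub> y) = bd K k x \<otimes>\<^bsub>grp K k\<^esub> bd K k y"
    if "x \<in> carrier (grp K (Suc k))" "y \<in> carrier (grp K (Suc k))"
    using K2 that by (rule hom_mult)
  show "actn K k g x \<in> carrier (grp K k)" if "g \<in> carrier \<pi>" "x \<in> carrier (grp K k)"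
    using K3[OF that(1)] that(2) by (rule funcset_mem)
  show "bd K k (actn K (Suc k) g x) = actn K k g (bd K k x)" if "g \<in> carrier \<pi>" "x \<in> carrier (grp K (Suc k))"
    using that by (rule K4)
qed

lemma coboundary_closed:
  assumes K: "eqv_chain_complex K \<pi>" and f: "f \<in> cochains K \<pi> \<rho> k"
  shows "coboundary K k f \<in> cochains K \<pi> \<rho> (Suc k)"
  using f unfolding cochains_def coboundary_def by (simp add: eqv_chain_complexD[OF K])

lemma twisted_coboundaries_subset:
  fixes K :: "('g, 'c) eqv_complex" and \<rho> :: "'g \<Rightarrow> 'f::field^'n^'n"
  assumes K: "eqv_chain_complex K \<pi>"
  shows "twisted_coboundaries K \<pi> \<rho> k \<subseteq> cochains K \<pi> \<rho> k"
proof (cases k)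
  case 0
  have "(0::'c \<Rightarrow> 'f^'n) \<in> cochains K \<pi> \<rho> k"
    using module.subspace_0[OF _ cochains_subspace] vector_space_fscale module_iff_vector_space by blast
  then show ?thesis using 0 by (simp add: cob_def)
next
  case (Suc k')
  then show ?thesis using coboundary_closed[OF K] by (auto simp: cob_def)
qed

section \<open>Pullback of cochains along equivariant chain maps\<close>

definition pullback_cochain ::
  "('g, 'c) eqv_complex \<Rightarrow> (nat \<Rightarrow> 'c \<Rightarrow> 'd) \<Rightarrow> nat \<Rightarrow> ('d \<Rightarrow> 'f::field^'n) \<Rightarrow> 'c \<Rightarrow> 'f^'n" where
  "pullback_cochain K \<phi> k f = (\<lambda>y. if y \<in> carrier (grp K k) then f (\<phi> k y) else 0)"

lemma pullback_cochain_linear: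
  "pullback_cochain K \<phi> k (f + g) = pullback_cochain K \<phi> k f + pullback_cochain K \<phi> k g"
  "pullback_cochain K \<phi> k (f - g) = pullback_cochain K \<phi> k f - pullback_cochain K \<phi> k g"
  "pullback_cochain K \<phi> k (fscale a f) = fscale a (pullback_cochain K \<phi> k f)"
  "pullback_cochain K \<phi> k 0 = 0"
  by (auto simp: pullback_cochain_def fscale_def fun_eq_iff)

definition eqv_chain_map ::
  "('g, 'c) eqv_complex \<Rightarrow> ('g, 'd) eqv_complex \<Rightarrow> 'g monoid \<Rightarrow> (nat \<Rightarrow> 'c \<Rightarrow> 'd) \<Rightarrow> bool" where
  "eqv_chain_map K L \<pi> \<phi> \<longleftrightarrow>
     (\<forall>k. \<phi> k \<in> hom (grp K k) (grp L k) \<and>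
          (\<forall>g\<in>carrier \<pi>. \<forall>x\<in>carrier (grp K k). \<phi> k (actn K k g x) = actn L k g (\<phi> k x)) \<and>
          (\<forall>x\<in>carrier (grp K (Suc k)). bd L k (\<phi> (Suc k) x) = \<phi> k (bd K k x)))"

lemma pullback_cochain_closed:
  assumes K: "eqv_chain_complex K \<pi>" and \<phi>: "eqv_chain_map K L \<pi> \<phi>" and f: "f \<in> cochains L \<pi> \<rho> k"
  shows "pullback_cochain K \<phi> k f \<in> cochains K \<pi> \<rho> k"
proof -
  have "\<phi> k x \<in> carrier (grp L k)" if "x \<in> carrier (grp K k)" for x
    using \<phi> that by (auto simp: eqv_chain_map_def hom_def)
  moreover have "\<phi> k (x \<otimes>\<^bsub>grp K k\<^esub> y) = \<phi> k x \<otimes>\<^bsub>grp L k\<^esub> \<phi> k y"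
    if "x \<in> carrier (grp K k)" "y \<in> carrier (grp K k)" for x y
    using \<phi> that by (auto simp: eqv_chain_map_def hom_def)
  moreover have "\<phi> k (actn K k g x) = actn L k g (\<phi> k x)" if "g \<in> carrier \<pi>" "x \<in> carrier (grp K k)" for g x
    using \<phi> that by (simp add: eqv_chain_map_def)
  ultimately show ?thesis
    using f unfolding cochains_def pullback_cochain_def by (simp add: eqv_chain_complexD[OF K])
qed

lemma coboundary_pullback_cochain:
  assumes K: "eqv_chain_complex K \<pi>" and \<phi>: "eqv_chain_map K L \<pi> \<phi>"
  shows "coboundary K k (pullback_cochain K \<phi> k f) = pullback_cochain K \<phi> (Suc k) (coboundary L k f)"
proof -
  have "\<phi> (Suc k) x \<in> carrier (grp L (Suc k))" if "x \<in> carrier (grp K (Suc k))" for x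
    using \<phi> that by (auto simp: eqv_chain_map_def hom_def)
  then show ?thesis
    using \<phi> by (simp add: coboundary_def pullback_cochain_def fun_eq_iff eqv_chain_complexD[OF K] eqv_chain_map_def)
qed

lemma pullback_cochain_coboundaries:
  assumes K: "eqv_chain_complex K \<pi>" and \<phi>: "eqv_chain_map K L \<pi> \<phi>"
    and f: "f \<in> twisted_coboundaries L \<pi> \<rho> k"
  shows "pullback_cochain K \<phi> k f \<in> twisted_coboundaries K \<pi> \<rho> k"
proof (cases k)
  case 0
  then show ?thesis using f by (simp add: cob_def pullback_cochain_linear)
next
  case (Suc k')
  then obtain a where a: "a \<in> cochains L \<pi> \<rho> k'" "f = coboundary L k' a" using f by (auto simp: cob_def)
  have "pullback_cochain K \<phi> k f = coboundary K k' (pullback_cochain K \<phi> k' a)"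
    unfolding a(2) Suc coboundary_pullback_cochain[OF K \<phi>] ..
  then show ?thesis using pullback_cochain_closed[OF K \<phi> a(1)] Suc by (auto simp: cob_def)
qed

lemma pullback_cochain_cocycles:
  assumes K: "eqv_chain_complex K \<pi>" and \<phi>: "eqv_chain_map K L \<pi> \<phi>"
    and f: "f \<in> coc (cochains L \<pi> \<rho>) (coboundary L) k"
  shows "pullback_cochain K \<phi> k f \<in> coc (cochains K \<pi> \<rho>) (coboundary K) k"
  using f
  by (simp add: coc_iff pullback_cochain_closed[OF K \<phi>] coboundary_pullback_cochain[OF K \<phi>] pullback_cochain_linear)

text \<open>The union in \<open>to_cellular_class\<close> runs over all representatives of a class.
  Two of them differ by a coboundary, whose pullback is again a coboundary, so all cosets in the
  union coincide.\<close>

lemma to_cellular_class_coset: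
  fixes K :: "('g, 'c) eqv_complex" and L :: "('g, 'd) eqv_complex" and \<rho> :: "'g \<Rightarrow> 'f::field^'n^'n"
  assumes K: "eqv_chain_complex K \<pi>" and \<phi>: "eqv_chain_map K L \<pi> \<phi>"
  shows "to_cellular_class K \<pi> \<rho> \<phi> k (coset_mod (twisted_coboundaries L \<pi> \<rho> k) v) =
    coset_mod (twisted_coboundaries K \<pi> \<rho> k) (pullback_cochain K \<phi> k v)"
proof -
  interpret vector_space "fscale :: 'f \<Rightarrow> ('c \<Rightarrow> 'f^'n) \<Rightarrow> 'c \<Rightarrow> 'f^'n" by (rule vector_space_fscale)
  let ?BK = "twisted_coboundaries K \<pi> \<rho> k" and ?BL = "twisted_coboundaries L \<pi> \<rho> k"
  let ?F = "pullback_cochain K \<phi> k :: ('d \<Rightarrow> 'f^'n) \<Rightarrow> _"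
  have sub: "subspace ?BK" by (rule coc_cob_subspace)
  have "coset_mod ?BK (?F f) = coset_mod ?BK (?F v)" if "f \<in> coset_mod ?BL v" for f
  proof -
    have "?F f - ?F v \<in> ?BK"
      using pullback_cochain_coboundaries[OF K \<phi>, of "f - v"] that
      by (simp add: coset_mod_iff pullback_cochain_linear)
    then have "w - ?F f \<in> ?BK \<longleftrightarrow> w - ?F v \<in> ?BK" for w
      using subspace_diff_trans[OF sub, of w "?F f" "?F v"] subspace_diff_trans[OF sub, of w "?F v" "?F f"]
        subspace_diff_sym[OF sub, of "?F f" "?F v"] by blast
    then show ?thesis by (auto simp: coset_mod_iff)
  qed
  moreover have "v \<in> coset_mod ?BL v" by (rule coset_mod_self[OF zero_in_twisted_coboundaries])
  ultimately show ?thesis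
    unfolding to_cellular_class_def pullback_cochain_def[symmetric] by blast
qed

text \<open>Maps over \<open>p\<close> preserve the preimages of the skeleta, and equivariance of
  the cellular boundary is naturality of the connecting homomorphism of a triple.\<close>

lemma eqv_chain_complex_cellular:
  assumes act: "\<And>g. g \<in> carrier \<pi> \<Longrightarrow> continuous_on E (act g) \<and> act g ` E \<subseteq> E \<and> (\<forall>e\<in>E. p (act g e) = p e)"
  shows "eqv_chain_complex (cellular_complex E p act chi) \<pi>"
proof -
  define Sk where "Sk = skelE E p chi"
  have "skel chi k \<subseteq> skel chi (Suc k)" for k unfolding skel_def by (rule UN_mono) auto
  then have mono: "Sk k \<subseteq> Sk (Suc k)" for k unfolding Sk_def skelE_def by blast
  \<comment> \<open>\<open>hom_relboundary\<close> ends in the homology of a subtopology and in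
    degree \<open>int (Suc k) - 1\<close>; \<open>sub\<close> and \<open>deg\<close> bring its
    target into the form used by \<open>cellular_complex\<close>.\<close>
  have sub: "subtopology (top_of_set (Sk (Suc (Suc k)))) (Sk (Suc k)) = top_of_set (Sk (Suc k))" for k
    using mono[of "Suc k"] by (simp add: subtopology_subtopology inf.absorb2)
  have inv: "act g \<in> Sk k \<rightarrow> Sk k" if "g \<in> carrier \<pi>" for g k
    using act[OF that] by (auto simp: Sk_def skelE_def)
  have cont: "continuous_map (top_of_set (Sk k)) (top_of_set (Sk k)) (act g)" if "g \<in> carrier \<pi>" for g k
    using act[OF that] inv[OF that, of k]
    by (auto simp: Sk_def skelE_def intro: continuous_on_subset)
  let ?C = "cellular_complex E p act chi"
  have C: "grp ?C = (\<lambda>k. relative_homology_group (int k) (top_of_set (Sk (Suc k))) (Sk k))"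
    "bd ?C = (\<lambda>k. hom_relboundary (int (Suc k)) (top_of_set (Sk (Suc (Suc k)))) (Sk (Suc k)) (Sk k))"
    "actn ?C = (\<lambda>k g. hom_induced (int k) (top_of_set (Sk (Suc k))) (Sk k) (top_of_set (Sk (Suc k))) (Sk k) (act g))"
    by (simp_all add: cellular_complex_def Sk_def Let_def)
  have deg: "int (Suc k) - 1 = int k" for k by simp
  show ?thesis
    unfolding eqv_chain_complex_def
  proof (intro conjI allI ballI)
    fix k
    show "group (grp ?C k)" unfolding C by simp
    show "bd ?C k \<in> hom (grp ?C (Suc k)) (grp ?C k)"
      using group_homomorphism_hom_relboundary[of "int (Suc k)" "top_of_set (Sk (Suc (Suc k)))" "Sk (Suc k)" "Sk k"]
      unfolding deg sub C .
    fix g assume g: "g \<in> carrier \<pi>"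
    show "actn ?C k g \<in> carrier (grp ?C k) \<rightarrow> carrier (grp ?C k)"
      unfolding C using hom_induced_carrier by blast
    show "bd ?C k (actn ?C (Suc k) g x) = actn ?C k g (bd ?C k x)" for x
      using fun_cong[OF naturality_hom_induced_relboundary[OF cont[OF g, of "Suc (Suc k)"] inv[OF g, of "Suc k"]
          inv[OF g, of k], of "int (Suc k)"], of x]
      unfolding deg sub C comp_apply .
  qed
qed

section \<open>Independence of the basis\<close>

text \<open>Pullback is linear and maps coboundaries to coboundaries, so the matrix survives
  unchanged.\<close>

lemma change_of_basis_mod_pullback:
  fixes L :: "('g, 'd) eqv_complex" and K :: "('g, 'c) eqv_complex" and \<rho> :: "'g \<Rightarrow> 'f::field^'n^'n"
  assumes K: "eqv_chain_complex K \<pi>" and \<phi>: "eqv_chain_map K L \<pi> \<phi>"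
    and A: "change_of_basis_mod fscale (twisted_coboundaries L \<pi> \<rho> k) A us vs"
  shows "change_of_basis_mod fscale (twisted_coboundaries K \<pi> \<rho> k) A
    (map (pullback_cochain K \<phi> k) us) (map (pullback_cochain K \<phi> k) vs)"
proof -
  let ?F = "pullback_cochain K \<phi> k :: ('d \<Rightarrow> 'f^'n) \<Rightarrow> 'c \<Rightarrow> 'f^'n"
  have "?F (\<Sum>i\<in>I. fscale (a i) (vs ! i)) = (\<Sum>i\<in>I. fscale (a i) (?F (vs ! i)))" for a I
    by (induction I rule: infinite_finite_induct)
       (simp_all only: sum.infinite sum.empty sum.insert pullback_cochain_linear simp_thms)
  then have lin: "?F (lincomb fscale a vs) = lincomb fscale a (map ?F vs)" for a
    by (simp add: lincomb_def)
  have "?F (us ! i) - lincomb fscale (\<lambda>j. A $$ (i, j)) (map ?F vs) \<in> twisted_coboundaries K \<pi> \<rho> k"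
    if "i < length us" for i
    unfolding lin[symmetric] pullback_cochain_linear(2)[symmetric]
    by (rule pullback_cochain_coboundaries[OF K \<phi>]) (use A that in \<open>simp add: change_of_basis_mod_def\<close>)
  then show ?thesis using A by (simp add: change_of_basis_mod_def)
qed

lemma is_torsion_transported_bases:
  fixes L :: "('g, 'd) eqv_complex" and K :: "('g, 'c) eqv_complex" and \<rho> :: "'g \<Rightarrow> 'f::field^'n^'n"
    and vs vs' us us' :: "('d \<Rightarrow> 'f^'n) list"
  assumes K: "eqv_chain_complex K \<pi>" and \<phi>: "eqv_chain_map K L \<pi> \<phi>"
  defines "Z \<equiv> coc (cochains L \<pi> \<rho>) (coboundary L)" and "B \<equiv> twisted_coboundaries L \<pi> \<rho>"
  defines "h \<equiv> (\<lambda>x y (k::nat). if k = 1 then map (to_cellular_class K \<pi> \<rho> \<phi> 1) (map (coset_mod (B 1)) x)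
                   else if k = 2 then map (to_cellular_class K \<pi> \<rho> \<phi> 2) (map (coset_mod (B 2)) y) else [])"
  assumes t: "is_torsion fscale 3 (cochains K \<pi> \<rho>) (coboundary K) c (h vs us) t"
    and Z: "set vs \<subseteq> Z 1" "set vs' \<subseteq> Z 1" "set us \<subseteq> Z 2" "set us' \<subseteq> Z 2"
    and len: "length vs' = length vs" "length us' = length us"
    and A: "change_of_basis_mod fscale (B 1) A vs' vs" "change_of_basis_mod fscale (B 2) D us' us"
    and det: "Determinant.det A \<noteq> 0" "Determinant.det D = Determinant.det A"
  shows "is_torsion fscale 3 (cochains K \<pi> \<rho>) (coboundary K) c (h vs' us') t"
proof -
  interpret vector_space "fscale :: 'f \<Rightarrow> ('c \<Rightarrow> 'f^'n) \<Rightarrow> 'c \<Rightarrow> 'f^'n" by (rule vector_space_fscale)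
  let ?F = "\<lambda>k. pullback_cochain K \<phi> k :: ('d \<Rightarrow> 'f^'n) \<Rightarrow> 'c \<Rightarrow> 'f^'n"
  define l where "l = (\<lambda>x y (k::nat). if k = 1 then map (?F 1) x else if k = 2 then map (?F 2) y else [])"
  \<comment> \<open>The bases in degrees 0 and 3 are empty and are related by the empty matrix,
    whose determinant is 1.\<close>
  define M where "M = (\<lambda>k::nat. if k = 1 then A else if k = 2 then D else 1\<^sub>m 0)"
  have h: "h x y k = map (coset_mod (twisted_coboundaries K \<pi> \<rho> k)) (l x y k)" for x y k
    unfolding h_def l_def B_def by (simp add: to_cellular_class_coset[OF K \<phi>])
  have l: "set (l x y k) \<subseteq> coc (cochains K \<pi> \<rho>) (coboundary K) k" if "set x \<subseteq> Z 1" "set y \<subseteq> Z 2" for x y k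
    using that unfolding l_def Z_def by (auto intro!: pullback_cochain_cocycles[OF K \<phi>])
  have "is_torsion fscale 3 (cochains K \<pi> \<rho>) (coboundary K) c (h vs' us')
      (t * (\<Prod>i\<le>3. Determinant.det (M i) powi ((-1) ^ (i + 1))))"
  proof (rule is_torsion_change_of_basis[OF t cochains_subspace coc_cob_subspace(1) coc_cob_subspace(2)
        twisted_coboundaries_subset[OF K] h h l[OF Z(1,3)] l[OF Z(2,4)]])
    show "change_of_basis_mod fscale (twisted_coboundaries K \<pi> \<rho> i) (M i) (l vs' us' i) (l vs us i)" for i
      using change_of_basis_mod_pullback[OF K \<phi> A(1)[unfolded B_def]]
        change_of_basis_mod_pullback[OF K \<phi> A(2)[unfolded B_def]]
      by (simp add: l_def M_def change_of_basis_mod_def[of _ _ "1\<^sub>m 0"])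
    show "length (l vs' us' i) = length (l vs us i)" for i using len by (simp add: l_def)
    show "Determinant.det (M i) \<noteq> 0" for i using det by (simp add: M_def)
  qed
  \<comment> \<open>The exponent \<open>(-1) ^ (i + 1)\<close> is 1 in degree 1 and -1 in degree 2,
    so the two equal determinants cancel.\<close>
  moreover have "(\<Prod>i\<le>3. Determinant.det (M i) powi ((-1) ^ (i + 1))) = 1"
    using det by (simp add: M_def numeral_3_eq_3 power_int_minus)
  ultimately show ?thesis by simp
qed

text \<open>
  \<open>A\<close> preserves the Gram matrix of the pairing on degree one, so its determinant has norm one; duality makes
  \<open>D\<close> the inverse of the conjugate transpose of \<open>A\<close>.
\<close>
lemma transition_matrices:
  fixes M :: "'a::topological_space set" and E :: "'b::topological_space set"
    and \<psi> :: "'f::field^'n \<Rightarrow> 'f^'n \<Rightarrow> 'f" and \<rho> :: "(real \<Rightarrow> 'a) set \<Rightarrow> 'f^'n^'n"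
  assumes uc: "universal_covering M x0 E p e0 act" and \<pi>: "\<pi> = fundamental_group M x0"
    and bar: "field_involution bar" and \<psi>: "hermitian_or_antihermitian bar \<psi>"
    and inv: "\<forall>g\<in>carrier \<pi>. \<forall>v w. \<psi> (\<rho> g *v v) (\<rho> g *v w) = \<psi> v w"
    and S: "S \<in> carrier (homology_group (int (1 + 1)) (top_of_set M))"
    and X: "X \<in> carrier (homology_group (int (1 + 2)) (top_of_set M))"
    and adm: "admissible E p act \<pi> X S \<rho> \<psi>"
    and h1: "normalized_orthonormal_basis E p act \<pi> S \<rho> \<psi> J h1"
    and h1': "normalized_orthonormal_basis E p act \<pi> S \<rho> \<psi> J h1'"
    and h2: "dual_basis E p act \<pi> X \<rho> \<psi> h1 h2"
    and h2': "dual_basis E p act \<pi> X \<rho> \<psi> h1' h2'"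
  defines "L \<equiv> singular_complex E act"
  defines "Z \<equiv> coc (cochains L \<pi> \<rho>) (coboundary L)" and "B \<equiv> twisted_coboundaries L \<pi> \<rho>"
  obtains vs vs' us us' A D where
    "h1 = map (coset_mod (B 1)) vs" "h1' = map (coset_mod (B 1)) vs'"
    "h2 = map (coset_mod (B 2)) us" "h2' = map (coset_mod (B 2)) us'"
    "set vs \<subseteq> Z 1" "set vs' \<subseteq> Z 1" "set us \<subseteq> Z 2" "set us' \<subseteq> Z 2"
    "length vs' = length vs" "length us' = length us"
    "change_of_basis_mod fscale (B 1) A vs' vs" "change_of_basis_mod fscale (B 2) D us' us"
    "Determinant.det A \<noteq> 0" "Determinant.det D = Determinant.det A"
proof -
  interpret vector_space "fscale :: 'f \<Rightarrow> ('b chain \<Rightarrow> 'f^'n) \<Rightarrow> 'b chain \<Rightarrow> 'f^'n" by (rule vector_space_fscale)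
  have sub: "subspace (Z k)" "subspace (B k)" for k unfolding Z_def B_def by (rule coc_cob_subspace)+
  have basis: "\<exists>vs. h = map (coset_mod (B k)) vs \<and> basis_mod fscale (Z k) (B k) vs"
    if "twisted_cohomology_basis L \<pi> \<rho> k h" for h k
    using that unfolding cohom_basis_def quotient_basis_def Z_def B_def .
  have "twisted_cohomology_basis L \<pi> \<rho> 1 h1" "twisted_cohomology_basis L \<pi> \<rho> 1 h1'"
    "twisted_cohomology_basis L \<pi> \<rho> 2 h2" "twisted_cohomology_basis L \<pi> \<rho> 2 h2'"
    using h1 h1' h2 h2' unfolding normalized_orthonormal_basis_def dual_basis_def L_def by simp_all
  from this[THEN basis] obtain vs vs' us us' where
    vs: "h1 = map (coset_mod (B 1)) vs" "basis_mod fscale (Z 1) (B 1) vs" and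
    vs': "h1' = map (coset_mod (B 1)) vs'" "basis_mod fscale (Z 1) (B 1) vs'" and
    us: "h2 = map (coset_mod (B 2)) us" "basis_mod fscale (Z 2) (B 2) us" and
    us': "h2' = map (coset_mod (B 2)) us'" "basis_mod fscale (Z 2) (B 2) us'"
    by (elim exE conjE) (rule that)
  note vsZ = basis_mod_subset[OF vs(2)] and vsZ' = basis_mod_subset[OF vs'(2)]
    and usZ = basis_mod_subset[OF us(2)] and usZ' = basis_mod_subset[OF us'(2)]
  obtain A where A: "length vs' = length vs" "change_of_basis_mod fscale (B 1) A vs' vs" "Determinant.det A \<noteq> 0"
    by (rule change_of_basis_mod_two_bases[OF sub vs'(2) vs(2)])
  obtain D where D: "length us' = length us" "change_of_basis_mod fscale (B 2) D us' us" "Determinant.det D \<noteq> 0"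
    by (rule change_of_basis_mod_two_bases[OF sub us'(2) us(2)])
  obtain P where P: "\<And>v u. v \<in> Z 1 \<Longrightarrow> u \<in> Z 1 \<Longrightarrow>
       cup_pairing E p \<psi> 1 1 S (coset_mod (B 1) v) (coset_mod (B 1) u) = P v u"
    "\<And>v v' u. P (v + v') u = P v u + P v' u" "\<And>v u u'. P v (u + u') = P v u + P v u'"
    "\<And>a v u. P (fscale a v) u = a * P v u" "\<And>a v u. P v (fscale a u) = bar a * P v u"
    "\<And>v u. v \<in> B 1 \<Longrightarrow> u \<in> Z 1 \<Longrightarrow> P v u = 0" "\<And>v u. v \<in> Z 1 \<Longrightarrow> u \<in> B 1 \<Longrightarrow> P v u = 0"
    by (rule cup_pairing_on_cocycles[OF uc \<pi> bar \<psi> inv S, folded L_def, folded Z_def B_def]) (rule that)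
  obtain Q where Q: "\<And>v u. v \<in> Z 1 \<Longrightarrow> u \<in> Z 2 \<Longrightarrow>
       cup_pairing E p \<psi> 1 2 X (coset_mod (B 1) v) (coset_mod (B 2) u) = Q v u"
    "\<And>v v' u. Q (v + v') u = Q v u + Q v' u" "\<And>v u u'. Q v (u + u') = Q v u + Q v u'"
    "\<And>a v u. Q (fscale a v) u = a * Q v u" "\<And>a v u. Q v (fscale a u) = bar a * Q v u"
    "\<And>v u. v \<in> B 1 \<Longrightarrow> u \<in> Z 2 \<Longrightarrow> Q v u = 0" "\<And>v u. v \<in> Z 1 \<Longrightarrow> u \<in> B 2 \<Longrightarrow> Q v u = 0"
    by (rule cup_pairing_on_cocycles[OF uc \<pi> bar \<psi> inv X, folded L_def, folded Z_def B_def]) (rule that)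
  let ?n = "length vs"
  have len: "length us = ?n"
    using h2 vs(1) us(1) by (simp add: dual_basis_def)
  have dim: "A \<in> carrier_mat ?n ?n" "D \<in> carrier_mat ?n ?n"
    using A D len by (simp_all add: change_of_basis_mod_def)
  \<comment> \<open>The Gram matrix of a normalized basis is determined by \<open>J\<close> and the
    length of the basis, and \<open>vs\<close> and \<open>vs'\<close> have the same length.\<close>
  have gramP: "gram P x x = Matrix.mat (length x) (length x) (\<lambda>(i, j). J i j)"
    if "set x \<subseteq> Z 1" "normalized_orthonormal_basis E p act \<pi> S \<rho> \<psi> J (map (coset_mod (B 1)) x)" for x
  proof (rule eq_matI)
    fix i j assume "i < dim_row (Matrix.mat (length x) (length x) (\<lambda>(i, j). J i j))"
      "j < dim_col (Matrix.mat (length x) (length x) (\<lambda>(i, j). J i j))"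
    then have ij: "i < length x" "j < length x" by simp_all
    then have "x ! i \<in> Z 1" "x ! j \<in> Z 1" using that(1) by auto
    note P(1)[OF this, symmetric]
    then show "gram P x x $$ (i, j) = Matrix.mat (length x) (length x) (\<lambda>(i, j). J i j) $$ (i, j)"
      using that(2) ij by (simp add: normalized_orthonormal_basis_def gram_def)
  qed (simp_all add: gram_def)
  have gramQ: "gram Q x y = 1\<^sub>m (length x)"
    if "set x \<subseteq> Z 1" "set y \<subseteq> Z 2" "dual_basis E p act \<pi> X \<rho> \<psi> (map (coset_mod (B 1)) x) (map (coset_mod (B 2)) y)" for x y
  proof (rule eq_matI)
    fix i j assume "i < dim_row (1\<^sub>m (length x) :: 'f Matrix.mat)" "j < dim_col (1\<^sub>m (length x) :: 'f Matrix.mat)"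
    then have ij: "i < length x" "j < length x" by simp_all
    have leny: "length y = length x" using that(3) by (simp add: dual_basis_def)
    have "x ! i \<in> Z 1" "y ! j \<in> Z 2" using that(1,2) ij leny by auto
    note Q(1)[OF this, symmetric]
    then show "gram Q x y $$ (i, j) = 1\<^sub>m (length x) $$ (i, j)"
      using that(3) ij leny by (simp add: dual_basis_def gram_def)
  qed (use that(3) in \<open>simp_all add: gram_def dual_basis_def\<close>)
  have GP: "gram P vs' vs' = gram P vs vs"
    using gramP[OF vsZ] gramP[OF vsZ'] h1 h1' vs(1) vs'(1) A(1) by simp
  have GQ: "gram Q vs' us' = 1\<^sub>m ?n" "gram Q vs us = 1\<^sub>m ?n"
    using gramQ[OF vsZ usZ] gramQ[OF vsZ' usZ'] h2 h2' vs(1) vs'(1) us(1) us'(1) A(1) by simp_all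
  have "Determinant.det (gram P vs vs) \<noteq> 0"
  proof (rule det_gram_nonzero[OF bar P(2-5) sub vs(2) P(7)])
    fix x assume x: "x \<in> Z 1" "\<And>y. y \<in> Z 1 \<Longrightarrow> P x y = 0"
    \<comment> \<open>The zero class is the coset \<open>B 1\<close> itself. Nondegeneracy on
      classes thus says that a cocycle pairing to zero with all cocycles is a coboundary.\<close>
    have "nondegenerate_pairing (B 1) (coset_mod (B 1) ` Z 1) (B 1) (coset_mod (B 1) ` Z 1) (cup_pairing E p \<psi> 1 1 S)"
      using adm unfolding admissible_def Let_def cohom_def Z_def B_def L_def by (rule conjunct1)
    then have "(\<forall>y\<in>coset_mod (B 1) ` Z 1. cup_pairing E p \<psi> 1 1 S (coset_mod (B 1) x) y = 0) \<longrightarrow> coset_mod (B 1) x = B 1"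
      unfolding nondegenerate_pairing_def using x(1) by blast
    then have "coset_mod (B 1) x = B 1" using x P(1) by auto
    then show "x \<in> B 1" using coset_mod_self[OF subspace_0[OF sub(2)], of x 1] by simp
  qed
  moreover have "Determinant.det (gram P vs' vs') =
      Determinant.det A * Determinant.det (gram P vs vs) * bar (Determinant.det A)"
    by (rule det_gram_change_of_basis[OF bar P(2-5)
        gram_change_of_basis[OF bar P(2-5) sub(1) P(6,7) sub(1) A(2) A(2) vsZ vsZ'] dim(1) dim(1) refl refl])
  ultimately have norm: "Determinant.det A * bar (Determinant.det A) = 1"
    unfolding GP by (simp add: mult.commute)
  have "Determinant.det (gram Q vs' us') =
      Determinant.det A * Determinant.det (gram Q vs us) * bar (Determinant.det D)"
    by (rule det_gram_change_of_basis[OF bar Q(2-5)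
        gram_change_of_basis[OF bar Q(2-5) sub(1) Q(6,7) sub(1) A(2) D(2) vsZ usZ'] dim refl len])
  then have "Determinant.det A * bar (Determinant.det D) = 1"
    unfolding GQ by simp
  with norm have "bar (Determinant.det D) = bar (Determinant.det A)"
    using A(3) by (metis mult_left_cancel)
  then have "Determinant.det D = Determinant.det A"
    using field_involution_simps(3)[OF bar] by metis
  then show ?thesis
    by (rule that[OF vs(1) vs'(1) us(1) us'(1) vsZ vsZ' usZ usZ' A(1) D(1) A(2) D(2) A(3)])
qed

theorem proposition7p2:
  fixes M :: "'a::topological_space set" and x0 :: 'a
    and E :: "'b::topological_space set" and p :: "'b \<Rightarrow> 'a" and e0 :: 'b
    and act :: "(real \<Rightarrow> 'a) set \<Rightarrow> 'b \<Rightarrow> 'b"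
    and X_fund \<Sigma>\<^sub>\<alpha> :: "'a chain set"
    and \<alpha> :: "(real \<Rightarrow> 'a) set \<Rightarrow> int"
    and bar :: "'f::field \<Rightarrow> 'f"
    and \<rho> :: "(real \<Rightarrow> 'a) set \<Rightarrow> 'f^'n^'n"
    and \<psi> :: "'f^'n \<Rightarrow> 'f^'n \<Rightarrow> 'f"
    and chi :: "nat \<Rightarrow> ((nat \<Rightarrow> real) \<Rightarrow> 'a) list"
    and chiE :: "nat \<Rightarrow> ((nat \<Rightarrow> real) \<Rightarrow> 'b) list"
    and \<phi> :: "nat \<Rightarrow> 'b chain set \<Rightarrow> 'b chain"
    and \<pi> :: "(real \<Rightarrow> 'a) set monoid"
    and J :: "nat \<Rightarrow> nat \<Rightarrow> 'f"
    and h1 h1' h2 h2' :: "('b chain \<Rightarrow> 'f^'n) set list"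
  assumes "\<pi> = fundamental_group M x0"
    and "closed_connected_3_manifold M"
    and "fundamental_class M X_fund"
    and "universal_covering M x0 E p e0 act"
    and "\<alpha> \<in> epi \<pi> integer_group"
    and "poincare_dual_of_hom M x0 X_fund \<alpha> \<Sigma>\<^sub>\<alpha>"
    and "field_involution bar"
    and "\<rho> \<in> hom \<pi> general_linear_group"
    and "hermitian_or_antihermitian bar \<psi>"
    and "nondegenerate_pairing 0 UNIV 0 UNIV \<psi>"
    and "\<forall>g\<in>carrier \<pi>. \<forall>v w. \<psi> (\<rho> g *v v) (\<rho> g *v w) = \<psi> v w"
    and "admissible E p act \<pi> X_fund \<Sigma>\<^sub>\<alpha> \<rho> \<psi>"
    and "twisted_homology E act \<pi> \<rho> 0 = {twisted_boundaries E act \<pi> \<rho> 0}"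
    and "finite_cw_structure M chi"
    and "lifted_cells E p chi chiE"
    and "cellular_to_singular E p act \<pi> chi \<phi>"
    and "normalized_orthonormal_basis E p act \<pi> \<Sigma>\<^sub>\<alpha> \<rho> \<psi> J h1"
    and "normalized_orthonormal_basis E p act \<pi> \<Sigma>\<^sub>\<alpha> \<rho> \<psi> J h1'"
    and "dual_basis E p act \<pi> X_fund \<rho> \<psi> h1 h2"
    and "dual_basis E p act \<pi> X_fund \<rho> \<psi> h1' h2'"
  shows "refined_torsion E p act \<pi> chi chiE \<phi> \<rho> h1 h2 = refined_torsion E p act \<pi> chi chiE \<phi> \<rho> h1' h2'"
proof -
  note \<pi> = assms(1) and fund = assms(3) and uc = assms(4) and pd = assms(6) and bar = assms(7) and \<psi> = assms(9)
    and inv = assms(11) and adm = assms(12) and cell = assms(16)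
  let ?L = "singular_complex E act" and ?K = "cellular_complex E p act chi"
  \<comment> \<open>The degrees are written as sums to match the degree \<open>i + j\<close> in
    \<open>cup_pairing_on_cocycles\<close>.\<close>
  have S: "\<Sigma>\<^sub>\<alpha> \<in> carrier (homology_group (int (1 + 1)) (top_of_set M))"
    using pd by (simp add: poincare_dual_of_hom_def)
  have X: "X_fund \<in> carrier (homology_group (int (1 + 2)) (top_of_set M))"
    using fund by (simp add: fundamental_class_def)
  have act: "continuous_on E (act g) \<and> act g ` E \<subseteq> E \<and> (\<forall>e\<in>E. p (act g e) = p e)" if "g \<in> carrier \<pi>" for g
    using universal_covering_deck_transformation[OF uc, of g] that \<pi> by simp
  have K: "eqv_chain_complex ?K \<pi>"
    by (rule eqv_chain_complex_cellular[OF act])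
  have \<phi>: "eqv_chain_map ?K ?L \<pi> \<phi>"
    using cell unfolding cellular_to_singular_def Let_def eqv_chain_map_def by simp
  let ?c = "cell_cochain_basis E p act \<pi> chi chiE \<rho>"
  define H where "H = (\<lambda>x y (k::nat). if k = 1 then map (to_cellular_class ?K \<pi> \<rho> \<phi> 1) x
                        else if k = 2 then map (to_cellular_class ?K \<pi> \<rho> \<phi> 2) y else [])"
  let ?T = "\<lambda>x y. is_torsion fscale 3 (cochains ?K \<pi> \<rho>) (coboundary ?K) ?c (H x y)"
  have step: "?T x' y' t"
    if t: "?T x y t" and x: "normalized_orthonormal_basis E p act \<pi> \<Sigma>\<^sub>\<alpha> \<rho> \<psi> J x"
      and x': "normalized_orthonormal_basis E p act \<pi> \<Sigma>\<^sub>\<alpha> \<rho> \<psi> J x'"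
      and y: "dual_basis E p act \<pi> X_fund \<rho> \<psi> x y" and y': "dual_basis E p act \<pi> X_fund \<rho> \<psi> x' y'" for x x' y y' t
    by (rule transition_matrices[OF uc \<pi> bar \<psi> inv S X adm x x' y y'])
       (use t in \<open>simp only: H_def, elim is_torsion_transported_bases[OF K \<phi>]\<close>)
  \<comment> \<open>The hypotheses of \<open>step\<close> on the bases are symmetric, so it gives
    the implication in both directions.\<close>
  have "?T h1 h2 = ?T h1' h2'"
    using step assms(17-20) by (intro ext iffI) blast+
  then have "torsion fscale 3 (cochains ?K \<pi> \<rho>) (coboundary ?K) ?c (H h1 h2) =
      torsion fscale 3 (cochains ?K \<pi> \<rho>) (coboundary ?K) ?c (H h1' h2')"
    unfolding torsion_def by simp
  then show ?thesis
    unfolding refined_torsion_def Let_def H_def by simp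
qed

end
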